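(* Let $u_0\in\mathcal{B}\cap BV(\mathbb{R})$ and let $f:\mathbb{R}\to\mathbb{R}$ be twice continuously differentiable and convex, with $f(0)=0$ being the minimum of $f$. Then the front tracking approximation $u^{\delta,\Delta x}$ (with $\delta=O(\Delta x)$) converges towards the entropy solution $u$ of $u_t+f(u)_x=0$, $u(x,0)=u_0(x)$, at a rate of $O(\Delta x)$ in $W_\infty$, i.e. $$W_\infty\big(u(t),u^{\delta,\Delta x}(t)\big)\leq L(t)\,\Delta x,$$ where $L(t)=1+t\max_{u\in[0,M+\delta]}|f''(u)|$ and $M=\|u_0\|_{L^\infty(\mathbb{R})}$.
   Context: $\mathcal{B}:=\{u\in L^\infty(\mathbb{R}): u\geq0,\ \mathrm{supp}(u)\text{ compact},\ \int_{\mathbb{R}}u\,dx=1\}$. Front tracking approximation: for $\Delta x>0$ set $x_{i+1/2}=(i+\tfrac12)\Delta x$ and $u_0^{\Delta x}(x)=u_i:=\frac1{\Delta x}\int_{x_{i-1/2}}^{x_{i+1/2}}u_0(y)\,dy$ for $x\in[x_{i-1/2},x_{i+1/2})$, $i\in\mathbb{Z}$. For $\delta>0$, $\delta=O(\Delta x)$, let $f^\delta$ be the piecewise linear interpolation of $f$, $$f^\delta(u)=f(j\delta)+(u-j\delta)\frac{f((j+1)\delta)-f(j\delta)}{\delta},\quad u\in(j\delta,(j+1)\delta],\quad j\in\mathbb{Z}\cap[-(M+1)/\delta,M/\delta].$$ Then $u^{\delta,\Delta x}$ is the unique entropy solution of $u_t+f^\delta(u)_x=0$, $u(x,0)=u_0^{\Delta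 x}(x)$. For $u,v\in\mathcal{B}$, $W_\infty(u,v)=\|U^{-1}-V^{-1}\|_{L^\infty([0,1])}$, where $U(x)=\int_{-\infty}^xu\,dy$, $U^{-1}(\xi)=\inf\{x:U(x)>\xi\}$, and similarly for $V$.
   Formalization: The displayed bound with L(t)=1+t max|f''| fails for δ=CΔx with C large; it is proved for δ≤Δx. For δ≤CΔx the bound is proved with L(t)=1+Ct max|f''|, and for every δ=O(Δx) the O(Δx) rate is proved. *)

theory Defs
  imports "HOL-Analysis.Analysis" "HOL-Probability.Essential_Supremum"
    "HOL-Library.Landau_Symbols"
begin

text \<open>Elements of \<open>L\<^sup>\<infinity>\<close> and \<open>BV\<close> are represented by Lebesgue measurable functions; all notions
  below depend only on the class modulo null sets.\<close>

definition Linf_norm :: "'a measure \<Rightarrow> ('a \<Rightarrow> real) \<Rightarrow> ereal" where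
  "Linf_norm M u = esssup M (\<lambda>x. ereal \<bar>u x\<bar>)"

definition in_Linf :: "'a measure \<Rightarrow> ('a \<Rightarrow> real) \<Rightarrow> bool" where
  "in_Linf M u \<longleftrightarrow> u \<in> borel_measurable M \<and> Linf_norm M u < \<infinity>"

definition class_B :: "(real \<Rightarrow> real) set" where
  "class_B = {u. in_Linf lebesgue u \<and> (AE x in lebesgue. 0 \<le> u x) \<and>
     (\<exists>K. compact K \<and> (AE x in lebesgue. x \<notin> K \<longrightarrow> u x = 0)) \<and>
     (LINT x|lebesgue. u x) = 1}"

text \<open>\<open>BV(\<real>)\<close>: integrable functions of finite (distributional) total variation.\<close>

definition class_BV :: "(real \<Rightarrow> real) set" where
  "class_BV = {u. integrable lebesgue u \<and>
     (\<exists>T. \<forall>\<phi> \<phi>'. (\<forall>x. (\<phi> has_real_derivative \<phi>' x) (at x)) \<longrightarrow> continuous_on UNIV \<phi>' \<longrightarrow>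
        (\<exists>K. compact K \<and> (\<forall>x. x \<notin> K \<longrightarrow> \<phi> x = 0)) \<longrightarrow> (\<forall>x. \<bar>\<phi> x\<bar> \<le> 1) \<longrightarrow>
        (LINT x|lebesgue. u x * \<phi>' x) \<le> T)}"

definition C2_fun :: "(real \<Rightarrow> real) \<Rightarrow> bool" where
  "C2_fun f \<longleftrightarrow> f differentiable_on UNIV \<and> deriv f differentiable_on UNIV \<and>
     continuous_on UNIV (deriv (deriv f))"

definition max_abs_deriv2 :: "(real \<Rightarrow> real) \<Rightarrow> real \<Rightarrow> real" where
  "max_abs_deriv2 f b = (SUP p\<in>{0..b}. \<bar>deriv (deriv f) p\<bar>)"

primrec Ck :: "nat \<Rightarrow> (real \<times> real \<Rightarrow> real) \<Rightarrow> bool" where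
  "Ck 0 \<phi> = continuous_on UNIV \<phi>"
| "Ck (Suc n) \<phi> = (\<exists>\<phi>1 \<phi>2. (\<forall>p. (\<phi> has_derivative (\<lambda>v. fst v * \<phi>1 p + snd v * \<phi>2 p)) (at p)) \<and>
     Ck n \<phi>1 \<and> Ck n \<phi>2)"

text \<open>Nonnegative \<open>C\<^sub>c\<^sup>\<infinity>\<close> test functions of \<open>(t, x)\<close> on the open half plane, extended by zero.\<close>

definition test_fun :: "(real \<times> real \<Rightarrow> real) \<Rightarrow> bool" where
  "test_fun \<phi> \<longleftrightarrow> (\<forall>n. Ck n \<phi>) \<and> (\<forall>p. 0 \<le> \<phi> p) \<and>
     (\<exists>K. compact K \<and> K \<subseteq> {0<..} \<times> UNIV \<and> (\<forall>p. p \<notin> K \<longrightarrow> \<phi> p = 0))"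

text \<open>Kruzkov entropy solutions \<open>u t x\<close> in \<open>L\<^sup>\<infinity> \<inter> C([0,\<infinity>); L\<^sup>1)\<close>. Continuity in time makes
  \<open>u t\<close> meaningful for every single \<open>t\<close> and gives the initial condition its sense.
  Values at negative times are irrelevant.\<close>

definition entropy_solution ::
  "(real \<Rightarrow> real) \<Rightarrow> (real \<Rightarrow> real) \<Rightarrow> (real \<Rightarrow> real \<Rightarrow> real) \<Rightarrow> bool" where
  "entropy_solution f u0 u \<longleftrightarrow>
     in_Linf (lebesgue_on ({0<..} \<times> UNIV)) (\<lambda>(t, x). u t x) \<and>
     (\<forall>t\<ge>0. integrable lebesgue (u t)) \<and>
     (\<forall>t\<ge>0. ((\<lambda>s. LINT x|lebesgue. \<bar>u s x - u t x\<bar>) \<longlongrightarrow> 0) (at t within {0..})) \<and>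
     (AE x in lebesgue. u 0 x = u0 x) \<and>
     (\<forall>k \<phi>. test_fun \<phi> \<longrightarrow>
        0 \<le> (LINT (t, x)|lebesgue_on ({0<..} \<times> UNIV).
               \<bar>u t x - k\<bar> * deriv (\<lambda>s. \<phi> (s, x)) t
             + sgn (u t x - k) * (f (u t x) - f k) * deriv (\<lambda>y. \<phi> (t, y)) x))"

text \<open>The average of \<open>u0\<close> over the cell \<open>[(i - 1/2) h, (i + 1/2) h)\<close> containing \<open>x\<close>.\<close>

definition cell_avg :: "real \<Rightarrow> (real \<Rightarrow> real) \<Rightarrow> real \<Rightarrow> real" where
  "cell_avg h u0 x = (let i = real_of_int \<lfloor>x / h + 1/2\<rfloor> in
     (1 / h) * (LINT y:{(i - 1/2) * h .. (i + 1/2) * h}|lebesgue. u0 y))"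

text \<open>Here \<open>u \<in> (j d, (j + 1) d]\<close>. The interpolation is carried out over all \<open>j \<in> \<int>\<close>, so that the
  flux is defined on the whole line.\<close>

definition pl_interp :: "real \<Rightarrow> (real \<Rightarrow> real) \<Rightarrow> real \<Rightarrow> real" where
  "pl_interp d f u = (let j = real_of_int (\<lceil>u / d\<rceil> - 1) in
     f (j * d) + (u - j * d) * ((f ((j + 1) * d) - f (j * d)) / d))"

definition primitive :: "(real \<Rightarrow> real) \<Rightarrow> real \<Rightarrow> real" where
  "primitive u x = (LINT y:{..x}|lebesgue. u y)"

text \<open>Only \<open>\<xi> \<in> [0, 1)\<close> matters; at \<open>\<xi> = 1\<close> the set is empty and the value is arbitrary, which
  the essential supremum in \<open>W_infty\<close> does not see.\<close>

definition pseudo_inv :: "(real \<Rightarrow> real) \<Rightarrow> real \<Rightarrow> real" where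
  "pseudo_inv U \<xi> = Inf {x. U x > \<xi>}"

definition W_infty :: "(real \<Rightarrow> real) \<Rightarrow> (real \<Rightarrow> real) \<Rightarrow> ereal" where
  "W_infty u v = Linf_norm (lebesgue_on {0..1})
     (\<lambda>\<xi>. pseudo_inv (primitive u) \<xi> - pseudo_inv (primitive v) \<xi>)"

end

theory Submission
  imports Defs
begin

text \<open>Let \<open>U(t,\<cdot>)\<close> and \<open>V(t,\<cdot>)\<close> be the primitives of the two solutions. The estimate says that
  \<open>U(t, x) \<le> V(t, x + h + c t)\<close> and \<open>V(t, x) \<le> U(t, x + h)\<close>, where \<open>f \<le> f\<^sup>\<delta> \<le> f + c p\<close> on \<open>[0, M]\<close> and
  \<open>c = \<delta> max \<bar>f''\<bar>\<close>; this is a comparison principle for the Hamilton-Jacobi equations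
  \<open>U\<^sub>t + f(U\<^sub>x) = 0\<close>. Spatial averages of a primitive are subsolutions by Jensen's inequality. For the
  supersolution property it suffices to compare a primitive \<open>W\<close> with an affine function \<open>A + k x - f(k) t\<close>:
  with \<open>D\<close> their difference, the Kruzkov inequality for \<open>k\<close> times \<open>\<beta>(D)\<close> is again a conservation
  inequality for \<open>\<bar>W\<^sub>x - k\<bar> \<beta>(D)\<close>, because \<open>D\<^sub>x = W\<^sub>x - k\<close> and \<open>D\<^sub>t = - (f(W\<^sub>x) - f(k))\<close>; if \<open>\<beta>\<close> is supported on
  the negative half line and \<open>D \<ge> 0\<close> initially on an interval, then \<open>D \<ge> 0\<close> on the cone of dependence. Small
  time steps combine the two facts, since an averaged primitive lies above its tangents up to a
  quadratic error.\<close>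

section \<open>Smooth test functions\<close>

text \<open>The interpolation error has to be charged as \<open>c * p\<close>, proportional to the
  slope of the primitive. Such a term in a Hamiltonian is transport at speed \<open>c\<close>: it
  moves graphs horizontally, and horizontal distance between primitives is what the Wasserstein
  distance measures. A bound uniform in \<open>p\<close> would be a vertical error, which a quantile
  cannot absorb where the density is small. The proportional bound is available because 0 is an
  interpolation node and the solutions are nonnegative. On the analytic side the obstacle is that
  the weight \<beta>(D) is built from the solution itself; it is merely Lipschitz and thus no test
  function. The entropy inequality is therefore extended to Lipschitz weights in \<open>x\<close>
  between two fixed times (\<open>ent_pair\<close>). Over a short step the weight is frozen at the
  initial time of the step and its change is expanded to first order. All errors are then bounded by
  step length times (L1 modulus of continuity + step length), and such errors sum to arbitrarily
  little.\<close>

primrec Ck1 :: "nat \<Rightarrow> (real \<Rightarrow> real) \<Rightarrow> bool" where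
  "Ck1 0 g = continuous_on UNIV g"
| "Ck1 (Suc n) g = (\<exists>g'. (\<forall>x. (g has_real_derivative g' x) (at x)) \<and> Ck1 n g')"

lemma Ck1_SucD: "Ck1 (Suc n) g \<Longrightarrow> Ck1 n g"
proof (induction n arbitrary: g)
  case 0
  then show ?case
    by (auto simp: continuous_on_eq_continuous_at intro: DERIV_isCont)
next
  case (Suc n)
  then show ?case by (metis Ck1.simps(2))
qed

lemma Ck1_const: "Ck1 n (\<lambda>x. c)"
proof (induction n arbitrary: c)
  case (Suc n)
  show ?case using Suc[of 0] by (auto intro!: exI[of _ "\<lambda>x. 0"])
qed auto

lemma Ck1_ident: "Ck1 n (\<lambda>x. x)"
proof (cases n)
  case (Suc m)
  then show ?thesis using Ck1_const[of m 1] by (auto intro!: exI[of _ "\<lambda>x. 1"])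
qed auto

lemma Ck1_add: "Ck1 n g \<Longrightarrow> Ck1 n h \<Longrightarrow> Ck1 n (\<lambda>x. g x + h x)"
proof (induction n arbitrary: g h)
  case (Suc n)
  then obtain g' h' where "\<forall>x. (g has_real_derivative g' x) (at x)" "Ck1 n g'"
    "\<forall>x. (h has_real_derivative h' x) (at x)" "Ck1 n h'" by auto
  then show ?case using Suc.IH[of g' h']
    by (auto intro!: exI[of _ "\<lambda>x. g' x + h' x"] derivative_eq_intros)
qed (auto intro: continuous_intros)

lemma Ck1_mult: "Ck1 n g \<Longrightarrow> Ck1 n h \<Longrightarrow> Ck1 n (\<lambda>x. g x * h x)"
proof (induction n arbitrary: g h)
  case (Suc n)
  then obtain g' h' where "\<forall>x. (g has_real_derivative g' x) (at x)" "Ck1 n g'"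
    "\<forall>x. (h has_real_derivative h' x) (at x)" "Ck1 n h'" by auto
  moreover have "Ck1 n (\<lambda>x. g' x * h x + g x * h' x)"
    using calculation Ck1_SucD[OF Suc.prems(1)] Ck1_SucD[OF Suc.prems(2)]
    by (intro Ck1_add Suc.IH) simp_all
  ultimately show ?case
    by (auto intro!: exI[of _ "\<lambda>x. g' x * h x + g x * h' x"] derivative_eq_intros)
qed (auto intro: continuous_intros)

lemma Ck1_inverse: "Ck1 n g \<Longrightarrow> (\<And>x. g x \<noteq> 0) \<Longrightarrow> Ck1 n (\<lambda>x. inverse (g x))"
proof (induction n arbitrary: g)
  case (Suc n)
  then obtain g' where g': "\<forall>x. (g has_real_derivative g' x) (at x)" "Ck1 n g'" by auto
  have "Ck1 n (\<lambda>x. (- 1) * (inverse (g x) * g' x * inverse (g x)))"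
    using Suc.prems(2) g' Ck1_SucD[OF Suc.prems(1)]
    by (intro Ck1_mult Ck1_const Suc.IH) simp_all
  then show ?case using g' Suc.prems
    by (auto intro!: exI[of _ "\<lambda>x. (- 1) * (inverse (g x) * g' x * inverse (g x))"]
        derivative_eq_intros)
qed (auto intro: continuous_intros)

lemma Ck1_affine: "Ck1 n g \<Longrightarrow> Ck1 n (\<lambda>x. g (a * x + b))"
proof (induction n arbitrary: g)
  case 0
  then show ?case by (auto intro!: continuous_intros elim: continuous_on_compose2)
next
  case (Suc n)
  then obtain g' where g': "\<forall>x. (g has_real_derivative g' x) (at x)" "Ck1 n g'" by auto
  have "((\<lambda>x. g (a * x + b)) has_real_derivative a * g' (a * x + b)) (at x)" for x
  proof -
    have "((\<lambda>x. a * x + b) has_real_derivative a) (at x)"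
      by (auto intro!: derivative_eq_intros)
    from DERIV_chain'[OF this g'(1)[rule_format]] show ?thesis by (simp add: mult.commute)
  qed
  then show ?case using Suc.IH[OF g'(2)] Ck1_mult[OF Ck1_const[of n a]]
    by (auto intro!: exI[of _ "\<lambda>x. a * g' (a * x + b)"])
qed

lemma Ck1_sum: "(\<And>i. i \<in> I \<Longrightarrow> Ck1 n (g i)) \<Longrightarrow> Ck1 n (\<lambda>x. \<Sum>i\<in>I. g i x)"
  by (induction I rule: infinite_finite_induct) (auto intro: Ck1_const Ck1_add)

lemma Ck1_power: "Ck1 n (\<lambda>x. x ^ i)"
  by (induction i) (auto intro: Ck1_const Ck1_mult Ck1_ident)

section \<open>Functions of class C^k in two variables\<close>

lemma Ck_SucD: "Ck (Suc n) g \<Longrightarrow> Ck n g"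
proof (induction n arbitrary: g)
  case 0
  then obtain g1 g2 where
    "\<forall>p. (g has_derivative (\<lambda>v. fst v * g1 p + snd v * g2 p)) (at p)" by auto
  then have "isCont g p" for p using has_derivative_continuous by blast
  then show ?case by (simp add: continuous_on_eq_continuous_at)
next
  case (Suc n)
  from Suc.prems obtain g1 g2 where
    "\<forall>p. (g has_derivative (\<lambda>v. fst v * g1 p + snd v * g2 p)) (at p)" "Ck n g1" "Ck n g2"
    unfolding Ck.simps(2)[of "Suc n"] using Suc.IH by blast
  then show ?case unfolding Ck.simps(2) by blast
qed

lemma Ck_zero: "Ck n (\<lambda>p. 0)"
  by (induction n) (auto intro!: exI[of _ "\<lambda>p. 0"])

lemma Ck_add: "Ck n g \<Longrightarrow> Ck n h \<Longrightarrow> Ck n (\<lambda>p. g p + h p)"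
proof (induction n arbitrary: g h)
  case (Suc n)
  then obtain g1 g2 h1 h2 where
    g: "\<forall>p. (g has_derivative (\<lambda>v. fst v * g1 p + snd v * g2 p)) (at p)" "Ck n g1" "Ck n g2"
    and h: "\<forall>p. (h has_derivative (\<lambda>v. fst v * h1 p + snd v * h2 p)) (at p)" "Ck n h1" "Ck n h2"
    by auto
  have "((\<lambda>p. g p + h p) has_derivative
      (\<lambda>v. fst v * (g1 p + h1 p) + snd v * (g2 p + h2 p))) (at p)" for p
    by (rule has_derivative_eq_rhs[OF has_derivative_add[OF g(1)[rule_format] h(1)[rule_format]]])
      (auto simp: algebra_simps)
  moreover have "Ck n (\<lambda>p. g1 p + h1 p)" "Ck n (\<lambda>p. g2 p + h2 p)"
    using g(2,3) h(2,3) by (intro Suc.IH; simp only:)+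
  ultimately show ?case unfolding Ck.simps
    by (intro exI[of _ "\<lambda>p. g1 p + h1 p"] exI[of _ "\<lambda>p. g2 p + h2 p"]) simp
qed (auto intro: continuous_intros)

lemma Ck_mult: "Ck n g \<Longrightarrow> Ck n h \<Longrightarrow> Ck n (\<lambda>p. g p * h p)"
proof (induction n arbitrary: g h)
  case (Suc n)
  then obtain g1 g2 h1 h2 where
    g: "\<forall>p. (g has_derivative (\<lambda>v. fst v * g1 p + snd v * g2 p)) (at p)" "Ck n g1" "Ck n g2"
    and h: "\<forall>p. (h has_derivative (\<lambda>v. fst v * h1 p + snd v * h2 p)) (at p)" "Ck n h1" "Ck n h2"
    by auto
  have "((\<lambda>p. g p * h p) has_derivative
      (\<lambda>v. fst v * (g1 p * h p + g p * h1 p) + snd v * (g2 p * h p + g p * h2 p))) (at p)" for p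
    by (rule has_derivative_eq_rhs[OF has_derivative_mult[OF g(1)[rule_format] h(1)[rule_format]]])
      (auto simp: algebra_simps)
  moreover have "Ck n (\<lambda>p. g1 p * h p + g p * h1 p)" "Ck n (\<lambda>p. g2 p * h p + g p * h2 p)"
    using g(2,3) h(2,3) Ck_SucD[OF Suc.prems(1)] Ck_SucD[OF Suc.prems(2)]
    by (intro Ck_add Suc.IH; simp only:)+
  ultimately show ?case unfolding Ck.simps
    by (intro exI[of _ "\<lambda>p. g1 p * h p + g p * h1 p"] exI[of _ "\<lambda>p. g2 p * h p + g p * h2 p"]) simp
qed (auto intro: continuous_intros)

lemma Ck_fst: "Ck1 n a \<Longrightarrow> Ck n (\<lambda>p. a (fst p))"
proof (induction n arbitrary: a)
  case 0
  then show ?case by (auto intro!: continuous_intros elim: continuous_on_compose2)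
next
  case (Suc n)
  then obtain a' where a': "\<forall>x. (a has_real_derivative a' x) (at x)" "Ck1 n a'" by auto
  have "((\<lambda>p. a (fst p)) has_derivative (\<lambda>v. fst v * a' (fst p) + snd v * 0)) (at p)"
    for p :: "real \<times> real"
    using has_derivative_compose[OF has_derivative_fst[OF has_derivative_ident],
        of a "(*) (a' (fst p))" p UNIV] a'(1)
    by (simp add: has_field_derivative_def mult.commute)
  then show ?case using Suc.IH[OF a'(2)] Ck_zero[of n] unfolding Ck.simps
    by (intro exI[of _ "\<lambda>p. a' (fst p)"] exI[of _ "\<lambda>p. 0"]) simp
qed

lemma Ck_snd: "Ck1 n a \<Longrightarrow> Ck n (\<lambda>p. a (snd p))"
proof (induction n arbitrary: a)
  case 0
  then show ?case by (auto intro!: continuous_intros elim: continuous_on_compose2)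
next
  case (Suc n)
  then obtain a' where a': "\<forall>x. (a has_real_derivative a' x) (at x)" "Ck1 n a'" by auto
  have "((\<lambda>p. a (snd p)) has_derivative (\<lambda>v. fst v * 0 + snd v * a' (snd p))) (at p)"
    for p :: "real \<times> real"
    using has_derivative_compose[OF has_derivative_snd[OF has_derivative_ident],
        of a "(*) (a' (snd p))" p UNIV] a'(1)
    by (simp add: has_field_derivative_def mult.commute)
  then show ?case using Suc.IH[OF a'(2)] Ck_zero[of n] unfolding Ck.simps
    by (intro exI[of _ "\<lambda>p. 0"] exI[of _ "\<lambda>p. a' (snd p)"]) simp
qed

text \<open>Products a(t) b(x) are the only test functions to which the entropy inequality is
  applied, so smoothness in the plane reduces to smoothness of two functions of one
  variable.\<close>

lemma test_fun_prod:
  assumes "\<And>n. Ck1 n a" "\<And>n. Ck1 n b" "\<And>t. 0 \<le> a t" "\<And>x. 0 \<le> b x"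
    and "0 < t1" "\<And>t. t \<notin> {t1..t2} \<Longrightarrow> a t = 0" "\<And>x. R < \<bar>x\<bar> \<Longrightarrow> b x = 0"
  shows "test_fun (\<lambda>p. a (fst p) * b (snd p))"
  unfolding test_fun_def
proof (intro conjI allI exI[of _ "{t1..t2} \<times> {-R..R}"] impI)
  show "compact ({t1..t2} \<times> {-R..R})" by (intro compact_Times compact_Icc)
  fix p :: "real \<times> real" assume "p \<notin> {t1..t2} \<times> {-R..R}"
  then have "fst p \<notin> {t1..t2} \<or> R < \<bar>snd p\<bar>" by (cases p) auto
  then show "a (fst p) * b (snd p) = 0" using assms by auto
next
  show "Ck n (\<lambda>p. a (fst p) * b (snd p))" for n
    using assms by (intro Ck_mult Ck_fst Ck_snd) simp_all
qed (use assms in auto)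

section \<open>The function exp(-1/x) and a smooth step\<close>

definition exp_bump :: "real poly \<Rightarrow> real \<Rightarrow> real" where
  "exp_bump p x = (if x > 0 then poly p (1 / x) * exp (- (1 / x)) else 0)"

lemma poly_exp_tendsto_0: "((\<lambda>y. poly p y * exp (- y)) \<longlongrightarrow> (0::real)) at_top"
proof -
  have "((\<lambda>y. \<Sum>i\<le>degree p. coeff p i * (y ^ i / exp y)) \<longlongrightarrow> (\<Sum>i\<le>degree p. coeff p i * 0)) at_top"
    by (intro tendsto_intros tendsto_power_div_exp_0)
  then show ?thesis
    by (simp add: poly_altdef exp_minus sum_distrib_right divide_inverse mult.assoc)
qed

text \<open>With y = 1/x, d/dx is -y^2 d/dy, which turns p(y) exp(-y) into y^2 (p - p')(y) exp(-y).
  The polynomial parameter is there to close the family under differentiation, so that smoothness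
  follows by induction.\<close>

lemma exp_bump_deriv:
  "(exp_bump p has_real_derivative exp_bump ([:0, 0, 1:] * (p - pderiv p)) x) (at x)"
proof -
  consider "x > 0" | "x < 0" | "x = 0" by linarith
  then show ?thesis
  proof cases
    case 1
    have d: "((\<lambda>x. 1 / x) has_real_derivative - (1 / x\<^sup>2)) (at x)"
      using 1 by (auto intro!: derivative_eq_intros simp: power2_eq_square)
    have "((\<lambda>x. poly p (1 / x) * exp (- (1 / x))) has_real_derivative
        exp_bump ([:0, 0, 1:] * (p - pderiv p)) x) (at x)"
      by (rule DERIV_cong[OF DERIV_mult[OF DERIV_chain2[OF poly_DERIV d]
              DERIV_chain2[OF DERIV_exp DERIV_minus[OF d]]]])
        (use 1 in \<open>simp add: exp_bump_def power2_eq_square algebra_simps\<close>)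
    then show ?thesis
      by (rule DERIV_cong_ev[THEN iffD1, rotated 3])
        (use 1 in \<open>auto simp: exp_bump_def eventually_nhds intro!: exI[of _ "{0<..}"]\<close>)
  next
    case 2
    have "((\<lambda>x. 0) has_real_derivative
        exp_bump ([:0, 0, 1:] * (p - pderiv p)) x) (at x)"
      using 2 by (auto intro!: derivative_eq_intros simp: exp_bump_def)
    then show ?thesis
      by (rule DERIV_cong_ev[THEN iffD1, rotated 3])
        (use 2 in \<open>auto simp: exp_bump_def eventually_nhds intro!: exI[of _ "{..<0}"]\<close>)
  next
    case 3
    have "((\<lambda>h. (exp_bump p (0 + h) - exp_bump p 0) / h) \<longlongrightarrow> 0) (at_left 0)"
      by (rule Lim_transform_eventually[OF tendsto_const])
        (auto simp: exp_bump_def eventually_at intro!: exI[of _ 1])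
    moreover have "((\<lambda>h. (exp_bump p (0 + h) - exp_bump p 0) / h) \<longlongrightarrow> 0) (at_right 0)"
    proof -
      \<comment> \<open>Dividing the value at \<open>h\<close> by \<open>h\<close> multiplies the
        polynomial by y = 1/h, hence \<open>pCons 0 p\<close>.\<close>
      have "((\<lambda>h. poly (pCons 0 p) (inverse h) * exp (- inverse h)) \<longlongrightarrow> 0) (at_right 0)"
        by (rule filterlim_compose[OF poly_exp_tendsto_0 filterlim_inverse_at_top_right])
      then show ?thesis
        by (rule Lim_transform_eventually)
          (auto simp: exp_bump_def eventually_at divide_inverse intro!: exI[of _ 1])
    qed
    ultimately show ?thesis using 3
      by (auto simp: DERIV_def filterlim_split_at exp_bump_def)
  qed
qed

lemma Ck1_exp_bump: "Ck1 n (exp_bump p)"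
proof (induction n arbitrary: p)
  case 0
  show ?case using exp_bump_deriv DERIV_isCont
    by (fastforce simp: continuous_on_eq_continuous_at)
next
  case (Suc n)
  then show ?case using exp_bump_deriv by (metis Ck1.simps(2))
qed

definition smooth_step :: "real \<Rightarrow> real" where
  "smooth_step x = exp_bump 1 x * inverse (exp_bump 1 x + exp_bump 1 (1 - x))"

lemma exp_bump_1: "exp_bump 1 x = (if x > 0 then exp (- (1 / x)) else 0)"
  by (simp add: exp_bump_def)

lemma exp_bump_1_sum_pos: "exp_bump 1 x + exp_bump 1 (1 - x) > 0"
  by (simp add: exp_bump_1 add_pos_pos)

lemma Ck1_smooth_step: "Ck1 n smooth_step"
proof -
  have "exp_bump 1 x + exp_bump 1 (- 1 * x + 1) \<noteq> 0" for x
    using exp_bump_1_sum_pos[of x] by simp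
  then have "Ck1 n (\<lambda>x. exp_bump 1 x * inverse (exp_bump 1 x + exp_bump 1 (- 1 * x + 1)))"
    by (intro Ck1_mult Ck1_exp_bump Ck1_inverse Ck1_add Ck1_affine)
  moreover have "(\<lambda>x. exp_bump 1 x * inverse (exp_bump 1 x + exp_bump 1 (- 1 * x + 1))) = smooth_step"
    by (simp add: smooth_step_def fun_eq_iff)
  ultimately show ?thesis by simp
qed

lemma smooth_step_simps: "x \<le> 0 \<Longrightarrow> smooth_step x = 0" "1 \<le> x \<Longrightarrow> smooth_step x = 1"
  by (auto simp: smooth_step_def exp_bump_1)

lemma smooth_step_bounds: "0 \<le> smooth_step x" "smooth_step x \<le> 1"
proof -
  have "0 \<le> exp_bump 1 x" "0 \<le> exp_bump 1 (1 - x)" by (auto simp: exp_bump_1)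
  then show "0 \<le> smooth_step x" "smooth_step x \<le> 1"
    by (auto simp: smooth_step_def divide_inverse[symmetric] divide_le_eq_1)
qed

lemma smooth_step_mono: assumes "x \<le> y" shows "smooth_step x \<le> smooth_step y"
proof -
  have m: "exp_bump 1 a \<le> exp_bump 1 b" if "a \<le> b" for a b
    using that by (auto simp: exp_bump_1 frac_le)
  have "exp_bump 1 x * exp_bump 1 (1 - y) \<le> exp_bump 1 y * exp_bump 1 (1 - x)"
    using assms by (intro mult_mono m) (auto simp: exp_bump_1)
  then show ?thesis
    unfolding smooth_step_def divide_inverse[symmetric]
    using exp_bump_1_sum_pos[of x] exp_bump_1_sum_pos[of y]
    by (simp add: divide_simps) (simp add: algebra_simps)
qed

lemma smooth_step_deriv:
  obtains D C where "\<And>x. (smooth_step has_real_derivative D x) (at x)" "continuous_on UNIV D"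
    "\<And>x. 0 \<le> D x" "\<And>x. D x \<le> C" "\<And>x. x \<notin> {0..1} \<Longrightarrow> D x = 0"
proof -
  obtain D where D: "\<And>x. (smooth_step has_real_derivative D x) (at x)" "continuous_on UNIV D"
    using Ck1_smooth_step[of "Suc 0"] by auto
  have pos: "0 \<le> D x" for x
    by (rule mono_on_imp_deriv_nonneg[of UNIV, OF _ D(1)])
      (auto intro: mono_onI smooth_step_mono)
  have z: "D x = 0" if "x \<notin> {0..1}" for x
  proof -
    obtain c where "((\<lambda>x. c) has_real_derivative D x) (at x)"
    proof (cases "x < 0")
      case True
      have "((\<lambda>x. 0) has_real_derivative D x) (at x)"
        by (rule DERIV_cong_ev[THEN iffD1, rotated 3, OF D(1)])
          (use True in \<open>auto simp: smooth_step_simps eventually_nhds intro!: exI[of _ "{..<0}"]\<close>)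
      then show ?thesis using that by blast
    next
      case False
      have "((\<lambda>x. 1) has_real_derivative D x) (at x)"
        by (rule DERIV_cong_ev[THEN iffD1, rotated 3, OF D(1)])
          (use False \<open>x \<notin> _\<close> in \<open>auto simp: smooth_step_simps eventually_nhds intro!: exI[of _ "{1<..}"]\<close>)
      then show ?thesis using that by blast
    qed
    then show "D x = 0" using DERIV_unique[OF _ DERIV_const] by blast
  qed
  have "bounded (D ` {0..1})"
    using D(2) by (intro compact_imp_bounded compact_continuous_image) (auto intro: continuous_on_subset)
  then obtain C where "\<forall>x\<in>{0..1}. \<bar>D x\<bar> \<le> C" by (auto simp: bounded_iff)
  then have "D x \<le> max 0 C" for x
    using z[of x] by (cases "x \<in> {0..1}") force+
  with that D pos z show ?thesis by blast
qed

section \<open>Approximation of bounded measurable functions\<close>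

text \<open>Clipping the continuous approximants at height \<open>K\<close> does not disturb the
  limit, since \<rho> itself stays within \<open>K\<close>, and it supplies the bound for dominated
  convergence.\<close>

lemma bounded_measurable_approx_continuous:
  fixes \<rho> :: "real \<Rightarrow> real"
  assumes \<rho>: "\<rho> \<in> borel_measurable borel" "\<And>x. \<bar>\<rho> x\<bar> \<le> K"
  obtains g where "\<And>n::nat. continuous_on UNIV (g n)" "\<And>n x. \<bar>g n x\<bar> \<le> K"
    "AE x in lborel. (\<lambda>n. g n x) \<longlonglongrightarrow> \<rho> x"
proof -
  have "\<rho> \<in> borel_measurable lebesgue"
    using \<rho>(1) by (simp add: measurable_completion)
  then have "\<rho> measurable_on UNIV"
    by (intro lebesgue_measurable_imp_measurable_on) auto
  then obtain N g where N: "negligible N" "\<And>n. continuous_on UNIV (g n)"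
    "\<And>x. x \<notin> N \<Longrightarrow> (\<lambda>n. g n x) \<longlonglongrightarrow> \<rho> x"
    unfolding measurable_on_def by (auto simp: if_distrib)
  have K: "0 \<le> K" using \<rho>(2)[of 0] by linarith
  have lim: "(\<lambda>n. max (- K) (min K (g n x))) \<longlonglongrightarrow> \<rho> x" if "x \<notin> N" for x
  proof -
    have "(\<lambda>n. max (- K) (min K (g n x))) \<longlonglongrightarrow> max (- K) (min K (\<rho> x))"
      by (intro tendsto_intros N(3) that)
    moreover have "max (- K) (min K (\<rho> x)) = \<rho> x" using \<rho>(2)[of x] by auto
    ultimately show ?thesis by simp
  qed
  have "AE x in lebesgue. x \<notin> N"
    using N(1) by (simp add: negligible_iff_null_sets AE_not_in)
  then have "AE x in lebesgue. (\<lambda>n. max (- K) (min K (g n x))) \<longlonglongrightarrow> \<rho> x"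
    by eventually_elim (rule lim)
  then have "AE x in lborel. (\<lambda>n. max (- K) (min K (g n x))) \<longlonglongrightarrow> \<rho> x"
    by (simp add: AE_completion_iff)
  moreover have "\<bar>max (- K) (min K (g n x))\<bar> \<le> K" for n x using K by auto
  moreover have "continuous_on UNIV (\<lambda>x. max (- K) (min K (g n x)))" for n
    by (intro continuous_intros N(2))
  ultimately show ?thesis using that[of "\<lambda>n x. max (- K) (min K (g n x))"] by blast
qed

lemma integrable_indicator_Icc [simp]: "integrable lborel (indicator {a..b} :: real \<Rightarrow> real)"
  by (rule integrable_real_indicator) (simp_all add: emeasure_lborel_Icc_eq)

lemma integrable_indicator_bounded:
  fixes f :: "real \<Rightarrow> real"
  assumes [measurable]: "f \<in> borel_measurable borel" and "\<And>x. x \<in> {a..b} \<Longrightarrow> \<bar>f x\<bar> \<le> K"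
  shows "integrable lborel (\<lambda>x. indicator {a..b} x * f x)"
proof (rule Bochner_Integration.integrable_bound[where f = "\<lambda>x. indicator {a..b} x * K"])
  show "integrable lborel (\<lambda>x. indicator {a..b} x * K)" by simp
  show "AE x in lborel. norm (indicator {a..b} x * f x) \<le> norm (indicator {a..b} x * K)"
    using assms(2) by (intro always_eventually) (force simp: indicator_def)
qed simp

text \<open>Polynomials are used because their primitives are explicit and lie in every
  \<open>Ck1\<close>. As \<open>R\<close> has a prescribed value at \<open>a\<close>, the L1 bound
  on \<open>r - \<rho>\<close> also bounds the distance of \<open>R\<close> from the primitive of
  \<rho> with the same value at \<open>a\<close>, uniformly on [a, b].\<close>

lemma L1_approx_polynomial:
  fixes \<rho> :: "real \<Rightarrow> real"
  assumes [measurable]: "\<rho> \<in> borel_measurable borel" and "\<And>x. \<bar>\<rho> x\<bar> \<le> K"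
    and "0 < e" "a \<le> b"
  obtains R r where "\<And>n. Ck1 n R" "\<And>x. (R has_real_derivative r x) (at x)"
    "continuous_on UNIV r" "R a = c" "(LBINT x. indicator {a..b} x * \<bar>r x - \<rho> x\<bar>) \<le> e"
proof -
  obtain g where g: "\<And>n::nat. continuous_on UNIV (g n)" "\<And>n x. \<bar>g n x\<bar> \<le> K"
    "AE x in lborel. (\<lambda>n. g n x) \<longlonglongrightarrow> \<rho> x"
    using bounded_measurable_approx_continuous[OF assms(1,2)] by blast
  have [measurable]: "g n \<in> borel_measurable borel" for n
    using g(1) by (rule borel_measurable_continuous_onI)
  have K: "0 \<le> K" using assms(2)[of 0] by linarith
  have "(\<lambda>n. LBINT x. indicator {a..b} x * \<bar>g n x - \<rho> x\<bar>) \<longlonglongrightarrow> integral\<^sup>L lborel (\<lambda>x::real. 0::real)"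
  proof (rule integral_dominated_convergence[where w = "\<lambda>x. indicator {a..b} x * (2 * K)"
        and f = "\<lambda>x. 0" and s = "\<lambda>n x. indicator {a..b} x * \<bar>g n x - \<rho> x\<bar>"])
    show "AE x in lborel. (\<lambda>n. indicator {a..b} x * \<bar>g n x - \<rho> x\<bar>) \<longlonglongrightarrow> 0"
      using g(3)
    proof eventually_elim
      case (elim x)
      have "(\<lambda>n. indicator {a..b} x * \<bar>g n x - \<rho> x\<bar>) \<longlonglongrightarrow> indicator {a..b} x * \<bar>\<rho> x - \<rho> x\<bar>"
        by (intro tendsto_intros elim)
      then show ?case by simp
    qed
    show "AE x in lborel. norm (indicator {a..b} x * \<bar>g n x - \<rho> x\<bar>) \<le> indicator {a..b} x * (2 * K)" for n
    proof (intro always_eventually allI)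
      fix x
      have "\<bar>g n x - \<rho> x\<bar> \<le> 2 * K" using g(2)[of n x] assms(2)[of x] by linarith
      then show "norm (indicator {a..b} x * \<bar>g n x - \<rho> x\<bar>) \<le> indicator {a..b} x * (2 * K)"
        by (auto simp: indicator_def)
    qed
  qed (auto simp: K)
  then have "\<forall>\<^sub>F n in sequentially. (LBINT x. indicator {a..b} x * \<bar>g n x - \<rho> x\<bar>) < e / 2"
    using \<open>0 < e\<close> by (intro order_tendstoD) auto
  then obtain n where n: "(LBINT x. indicator {a..b} x * \<bar>g n x - \<rho> x\<bar>) < e / 2"
    by (auto simp: eventually_sequentially)
  \<comment> \<open>One half of \<open>e\<close> pays for the L1 approximation by
    \<open>g n\<close>, the other for the uniform approximation of \<open>g n\<close>, whose error
    is multiplied by b - a; the added 1 covers a = b.\<close>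
  define d where "d = e / (2 * (b - a + 1))"
  have d: "0 < d" "d * (b - a) \<le> e / 2" using assms(3,4) by (auto simp: d_def field_simps)
  obtain r where r: "real_polynomial_function r" "\<And>x. x \<in> {a..b} \<Longrightarrow> \<bar>g n x - r x\<bar> < d"
    using Stone_Weierstrass_real_polynomial_function[of "{a..b}" "g n" d] d g(1)
    by (auto intro: continuous_on_subset)
  obtain w m where w: "r = (\<lambda>x. \<Sum>i\<le>m. w i * x ^ i)"
    using r(1) by (auto simp: real_polynomial_function_iff_sum)
  have rc: "continuous_on UNIV r" unfolding w by (intro continuous_intros)
  then have [measurable]: "r \<in> borel_measurable borel" by (rule borel_measurable_continuous_onI)
  define R where "R = (\<lambda>x. (\<Sum>i\<le>m. w i / (i + 1) * x ^ (i + 1)) + (c - (\<Sum>i\<le>m. w i / (i + 1) * a ^ (i + 1))))"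
  have "Ck1 j R" for j
    unfolding R_def by (intro Ck1_add Ck1_sum Ck1_mult Ck1_const Ck1_power)
  moreover have "(R has_real_derivative r x) (at x)" for x
  proof -
    have "((\<lambda>x. w i / (i + 1) * x ^ (i + 1)) has_real_derivative w i * x ^ i) (at x)" for i
      by (rule DERIV_cong[OF DERIV_cmult[OF DERIV_pow]]) (simp add: field_simps)
    from DERIV_add[OF DERIV_sum[OF this] DERIV_const] show ?thesis
      unfolding R_def w by simp
  qed
  moreover have "R a = c" by (simp add: R_def)
  moreover have "(LBINT x. indicator {a..b} x * \<bar>r x - \<rho> x\<bar>) \<le> e"
  proof -
    have "bounded (r ` {a..b})"
      using rc by (intro compact_imp_bounded compact_continuous_image) (auto intro: continuous_on_subset)
    then obtain C where C: "\<And>x. x \<in> {a..b} \<Longrightarrow> \<bar>r x\<bar> \<le> C"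
      unfolding bounded_iff real_norm_def ball_simps by metis
    have "(LBINT x. indicator {a..b} x * \<bar>r x - \<rho> x\<bar>) \<le>
       (LBINT x. indicator {a..b} x * d + indicator {a..b} x * \<bar>g n x - \<rho> x\<bar>)"
    proof (rule integral_mono)
      show "integrable lborel (\<lambda>x. indicator {a..b} x * \<bar>r x - \<rho> x\<bar>)"
      proof (rule integrable_indicator_bounded[where K = "C + K"])
        fix x assume "x \<in> {a..b}"
        from C[OF this] assms(2)[of x] show "\<bar>\<bar>r x - \<rho> x\<bar>\<bar> \<le> C + K" by linarith
      qed simp
      have "\<bar>\<bar>g n x - \<rho> x\<bar>\<bar> \<le> K + K" for x using g(2)[of n x] assms(2)[of x] by linarith
      then have "integrable lborel (\<lambda>x. indicator {a..b} x * \<bar>g n x - \<rho> x\<bar>)"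
        by (intro integrable_indicator_bounded[where K="K + K"]) auto
      then show "integrable lborel (\<lambda>x. indicator {a..b} x * d + indicator {a..b} x * \<bar>g n x - \<rho> x\<bar>)"
        by simp
      fix x
      show "indicator {a..b} x * \<bar>r x - \<rho> x\<bar> \<le> indicator {a..b} x * d + indicator {a..b} x * \<bar>g n x - \<rho> x\<bar>"
        using r(2)[of x] by (auto simp: indicator_def)
    qed
    also have "\<dots> = d * (b - a) + (LBINT x. indicator {a..b} x * \<bar>g n x - \<rho> x\<bar>)"
    proof -
      have "\<bar>\<bar>g n x - \<rho> x\<bar>\<bar> \<le> K + K" for x using g(2)[of n x] assms(2)[of x] by linarith
      then have "integrable lborel (\<lambda>x. indicator {a..b} x * \<bar>g n x - \<rho> x\<bar>)"
        by (intro integrable_indicator_bounded[where K="K + K"]) auto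
      then show ?thesis using assms(4) by (simp add: mult.commute)
    qed
    also have "\<dots> \<le> e" using n d by linarith
    finally show ?thesis .
  qed
  ultimately show ?thesis using that rc by blast
qed

section \<open>Lipschitz functions as primitives of bounded densities\<close>

definition antideriv :: "(real \<Rightarrow> real) \<Rightarrow> (real \<Rightarrow> real) \<Rightarrow> bool" where
  "antideriv P p \<longleftrightarrow> p \<in> borel_measurable borel \<and> (\<exists>K. \<forall>x. \<bar>p x\<bar> \<le> K) \<and>
     (\<forall>x y. x \<le> y \<longrightarrow> P y - P x = (LBINT z. indicator {x..y} z * p z))"

lemma antiderivD:
  assumes "antideriv P p"
  shows "p \<in> borel_measurable borel" "x \<le> y \<Longrightarrow> P y - P x = (LBINT z. indicator {x..y} z * p z)"
  using assms by (auto simp: antideriv_def)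

lemma indicator_integral_bound:
  fixes p :: "real \<Rightarrow> real"
  assumes "p \<in> borel_measurable borel" "\<And>x. x \<in> {a..b} \<Longrightarrow> \<bar>p x\<bar> \<le> K" "a \<le> b"
  shows "\<bar>LBINT z. indicator {a..b} z * p z\<bar> \<le> K * (b - a)"
proof -
  have "\<bar>LBINT z. indicator {a..b} z * p z\<bar> \<le> (LBINT z. indicator {a..b} z * K)"
    unfolding real_norm_def[symmetric]
  proof (rule Bochner_Integration.integral_norm_bound_integral)
    show "integrable lborel (\<lambda>z. indicator {a..b} z * p z)"
      by (rule integrable_indicator_bounded[OF assms(1,2)])
    show "integrable lborel (\<lambda>z. indicator {a..b} z * K)" by simp
    show "norm (indicator {a..b} z * p z) \<le> indicator {a..b} z * K" for z
      using assms(2)[of z] by (auto simp: indicator_def)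
  qed
  then show ?thesis using assms(3) by (simp add: mult.commute)
qed

lemma antideriv_lipschitz:
  assumes "antideriv P p" "\<And>x. \<bar>p x\<bar> \<le> K"
  shows "\<bar>P y - P x\<bar> \<le> K * \<bar>y - x\<bar>"
  using indicator_integral_bound[OF antiderivD(1)[OF assms(1)], of x y K]
    indicator_integral_bound[OF antiderivD(1)[OF assms(1)], of y x K]
    antiderivD(2)[OF assms(1), of x y] antiderivD(2)[OF assms(1), of y x] assms(2)
  by (cases "x \<le> y") (auto simp: abs_minus_commute)

lemma antideriv_continuous:
  assumes "antideriv P p" shows "continuous_on UNIV P"
proof -
  obtain K where K: "\<And>x. \<bar>p x\<bar> \<le> K" using assms by (auto simp: antideriv_def)
  have "K-lipschitz_on UNIV P"
    unfolding lipschitz_on_def dist_real_def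
    using antideriv_lipschitz[OF assms K] K[of 0] abs_ge_zero order_trans by blast
  then show ?thesis by (rule lipschitz_on_continuous_on)
qed

text \<open>\<open>P\<close> is only Lipschitz. If its density is replaced by a continuous
  \<open>g n\<close>, the primitive \<open>Q n\<close> is C^1 and the fundamental theorem applies;
  \<open>g n\<close> tends to \<open>p\<close> almost everywhere and stays bounded, so
  \<open>Q n\<close> tends to \<open>P\<close> and both sides converge.\<close>

lemma antideriv_chain:
  fixes G Gx Gy :: "real \<Rightarrow> real \<Rightarrow> real"
  assumes P: "antideriv P p"
    and G: "\<And>x y. ((\<lambda>q. G (fst q) (snd q)) has_derivative (\<lambda>v. fst v * Gx x y + snd v * Gy x y)) (at (x, y))"
    and Gx: "continuous_on UNIV (\<lambda>q. Gx (fst q) (snd q))"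
    and Gy: "continuous_on UNIV (\<lambda>q. Gy (fst q) (snd q))"
    and "a \<le> b"
  shows "G b (P b) - G a (P a) = (LBINT z. indicator {a..b} z * (Gx z (P z) + Gy z (P z) * p z))"
proof -
  note [measurable] = antiderivD(1)[OF P]
  obtain K where K: "\<And>x. \<bar>p x\<bar> \<le> K" using P by (auto simp: antideriv_def)
  have K0: "0 \<le> K" using K[of 0] by linarith
  obtain g where g: "\<And>n::nat. continuous_on UNIV (g n)" "\<And>n x. \<bar>g n x\<bar> \<le> K"
    "AE x in lborel. (\<lambda>n. g n x) \<longlonglongrightarrow> p x"
    using bounded_measurable_approx_continuous[OF antiderivD(1)[OF P] K] by blast
  have [measurable]: "g n \<in> borel_measurable borel" for n
    using g(1) by (rule borel_measurable_continuous_onI)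
  define Q where "Q n x = P a + integral {a..x} (g n)" for n x
  have Qd: "(Q n has_vector_derivative g n x) (at x within {a..b})" if "x \<in> {a..b}" for n x
    unfolding Q_def
    by (auto intro!: derivative_eq_intros integral_has_vector_derivative that continuous_on_subset[OF g(1)])
  have Qint: "Q n x = P a + (LBINT z. indicator {a..x} z * g n z)" if "a \<le> x" for n x
  proof -
    have "set_integrable lborel {a..x} (g n)"
      by (intro borel_integrable_atLeastAtMost' continuous_on_subset[OF g(1)]) auto
    then have "(LBINT z:{a..x}. g n z) = integral {a..x} (g n)"
      by (rule set_borel_integral_eq_integral)
    then show ?thesis by (simp add: Q_def set_lebesgue_integral_def)
  qed
  have Qlim: "(\<lambda>n. Q n x) \<longlonglongrightarrow> P x" if "x \<in> {a..b}" for x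
  proof -
    have "(\<lambda>n. LBINT z. indicator {a..x} z * g n z) \<longlonglongrightarrow> (LBINT z. indicator {a..x} z * p z)"
    proof (rule integral_dominated_convergence[where w = "\<lambda>z. indicator {a..x} z * K"])
      show "AE z in lborel. (\<lambda>n. indicator {a..x} z * g n z) \<longlonglongrightarrow> indicator {a..x} z * p z"
        using g(3) by eventually_elim (intro tendsto_intros)
      show "AE z in lborel. norm (indicator {a..x} z * g n z) \<le> indicator {a..x} z * K" for n
        using g(2) by (intro always_eventually) (auto simp: indicator_def)
    qed auto
    then have "(\<lambda>n. P a + (LBINT z. indicator {a..x} z * g n z)) \<longlonglongrightarrow> P a + (P x - P a)"
      using antiderivD(2)[OF P, of a x] that by (intro tendsto_intros) auto
    then show ?thesis using Qint that by simp
  qed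
  have Qb: "Q n x \<in> {P a - K * (b - a)..P a + K * (b - a)}" if "x \<in> {a..b}" for n x
  proof -
    have "\<bar>Q n x - P a\<bar> \<le> K * (x - a)"
      using indicator_integral_bound[of "g n" a x K] g(2) that Qint[of x n] by auto
    also have "\<dots> \<le> K * (b - a)" using that K0 by (intro mult_left_mono) auto
    finally show ?thesis by auto
  qed
  \<comment> \<open>All graphs of \<open>Q n\<close> over [a, b] lie in this rectangle, so the
    partial derivatives are bounded along them independently of \<open>n\<close>; this yields the
    dominating function.\<close>
  let ?S = "{a..b} \<times> {P a - K * (b - a)..P a + K * (b - a)}"
  have "bounded ((\<lambda>q. Gx (fst q) (snd q)) ` ?S)" "bounded ((\<lambda>q. Gy (fst q) (snd q)) ` ?S)"
    using Gx Gy by (auto intro!: compact_imp_bounded compact_continuous_image compact_Times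
        intro: continuous_on_subset)
  then obtain C D where C: "\<And>q. q \<in> ?S \<Longrightarrow> \<bar>Gx (fst q) (snd q)\<bar> \<le> C"
    and D: "\<And>q. q \<in> ?S \<Longrightarrow> \<bar>Gy (fst q) (snd q)\<bar> \<le> D"
    unfolding bounded_iff real_norm_def ball_simps by metis
  have Qc: "continuous_on {a..b} (Q n)" for n
    using Qd by (meson continuous_on_eq_continuous_within has_vector_derivative_continuous)
  have FTC: "(LBINT z. indicator {a..b} z *\<^sub>R (Gx z (Q n z) + Gy z (Q n z) * g n z)) =
      G b (Q n b) - G a (Q n a)" for n
  proof (rule integral_FTC_Icc[OF \<open>a \<le> b\<close>])
    fix x assume x: "a \<le> x" "x \<le> b"
    have "((\<lambda>z. (z, Q n z)) has_derivative (\<lambda>h. (h, h *\<^sub>R g n x))) (at x within {a..b})"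
      using Qd[of x n] x by (auto intro!: derivative_eq_intros simp: has_vector_derivative_def)
    from has_derivative_compose[OF this G[of x "Q n x"]]
    show "((\<lambda>z. G z (Q n z)) has_vector_derivative Gx x (Q n x) + Gy x (Q n x) * g n x) (at x within {a..b})"
      by (simp add: has_vector_derivative_def algebra_simps)
  next
    have c: "continuous_on {a..b} (\<lambda>z. (z, Q n z))" by (intro continuous_intros Qc)
    have "continuous_on {a..b} (\<lambda>z. Gx z (Q n z))" "continuous_on {a..b} (\<lambda>z. Gy z (Q n z))"
      using continuous_on_compose2[OF Gx c] continuous_on_compose2[OF Gy c] by auto
    then show "continuous_on {a..b} (\<lambda>z. Gx z (Q n z) + Gy z (Q n z) * g n z)"
      by (intro continuous_intros continuous_on_subset[OF g(1)]) auto
  qed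
  have Gc: "continuous_on UNIV (\<lambda>q. G (fst q) (snd q))"
    using G has_derivative_continuous by (force simp: continuous_on_eq_continuous_at)
  have "(\<lambda>n. G b (Q n b) - G a (Q n a)) \<longlonglongrightarrow> G b (P b) - G a (P a)"
  proof -
    have "(\<lambda>n. G x (Q n x)) \<longlonglongrightarrow> G x (P x)" if "x \<in> {a..b}" for x
      using continuous_on_tendsto_compose[OF Gc tendsto_Pair[OF tendsto_const[of x] Qlim[OF that]]] by simp
    then show ?thesis using \<open>a \<le> b\<close> by (intro tendsto_diff) auto
  qed
  moreover have "(\<lambda>n. LBINT z. indicator {a..b} z *\<^sub>R (Gx z (Q n z) + Gy z (Q n z) * g n z)) \<longlonglongrightarrow>
      (LBINT z. indicator {a..b} z * (Gx z (P z) + Gy z (P z) * p z))"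
  proof (rule integral_dominated_convergence[where w = "\<lambda>z. indicator {a..b} z * (C + D * K)"])
    have Pm: "P \<in> borel_measurable borel"
      by (intro borel_measurable_continuous_onI antideriv_continuous[OF P])
    have c: "continuous_on UNIV (\<lambda>z. (z, P z))"
      by (intro continuous_intros antideriv_continuous[OF P])
    have "(\<lambda>z. Gx z (P z)) \<in> borel_measurable borel" "(\<lambda>z. Gy z (P z)) \<in> borel_measurable borel"
      using continuous_on_compose2[OF Gx c] continuous_on_compose2[OF Gy c]
      by (auto intro!: borel_measurable_continuous_onI)
    then show "(\<lambda>z. indicator {a..b} z * (Gx z (P z) + Gy z (P z) * p z)) \<in> borel_measurable lborel"
      by simp
    show "(\<lambda>z. indicator {a..b} z *\<^sub>R (Gx z (Q n z) + Gy z (Q n z) * g n z)) \<in> borel_measurable lborel" for n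
    proof -
      have c: "continuous_on {a..b} (\<lambda>z. (z, Q n z))" by (intro continuous_intros Qc)
      have "continuous_on {a..b} (\<lambda>z. Gx z (Q n z))" "continuous_on {a..b} (\<lambda>z. Gy z (Q n z))"
        using continuous_on_compose2[OF Gx c] continuous_on_compose2[OF Gy c] by auto
      then have "continuous_on {a..b} (\<lambda>z. Gx z (Q n z) + Gy z (Q n z) * g n z)"
        by (intro continuous_intros continuous_on_subset[OF g(1)]) auto
      then have "(\<lambda>z. indicator {a..b} z *\<^sub>R (Gx z (Q n z) + Gy z (Q n z) * g n z)) \<in> borel_measurable borel"
        by (intro borel_measurable_continuous_on_indicator) auto
      then show ?thesis by simp
    qed
    show "AE z in lborel. (\<lambda>n. indicator {a..b} z *\<^sub>R (Gx z (Q n z) + Gy z (Q n z) * g n z)) \<longlonglongrightarrow>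
      indicator {a..b} z * (Gx z (P z) + Gy z (P z) * p z)"
      using g(3)
    proof eventually_elim
      case (elim z)
      show ?case
      proof (cases "z \<in> {a..b}")
        case True
        have "(\<lambda>n. Gx z (Q n z)) \<longlonglongrightarrow> Gx z (P z)" "(\<lambda>n. Gy z (Q n z)) \<longlonglongrightarrow> Gy z (P z)"
          using continuous_on_tendsto_compose[OF Gx tendsto_Pair[OF tendsto_const[of z] Qlim[OF True]]]
            continuous_on_tendsto_compose[OF Gy tendsto_Pair[OF tendsto_const[of z] Qlim[OF True]]] by auto
        then show ?thesis using elim True by (auto intro!: tendsto_intros)
      qed auto
    qed
    show "AE z in lborel. norm (indicator {a..b} z *\<^sub>R (Gx z (Q n z) + Gy z (Q n z) * g n z)) \<le>
      indicator {a..b} z * (C + D * K)" for n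
    proof (intro always_eventually allI)
      fix z
      show "norm (indicator {a..b} z *\<^sub>R (Gx z (Q n z) + Gy z (Q n z) * g n z)) \<le> indicator {a..b} z * (C + D * K)"
      proof (cases "z \<in> {a..b}")
        case True
        have "(z, Q n z) \<in> ?S" using True Qb[OF True, of n] by auto
        from C[OF this] D[OF this] g(2)[of n z]
        have "\<bar>Gx z (Q n z)\<bar> \<le> C" "\<bar>Gy z (Q n z) * g n z\<bar> \<le> D * K"
          by (auto simp: abs_mult intro!: mult_mono)
        then show ?thesis using True by auto
      qed auto
    qed
  qed auto
  ultimately show ?thesis unfolding FTC by (rule LIMSEQ_unique)
qed

section \<open>From weak inequalities to inequalities between times\<close>

lemma integrable_continuous_Icc:
  fixes g :: "real \<Rightarrow> real"
  assumes "continuous_on UNIV g" "\<And>t. t \<notin> {a..b} \<Longrightarrow> g t = 0"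
  shows "integrable lborel g"
proof -
  have "set_integrable lborel {a..b} g"
    by (intro borel_integrable_atLeastAtMost' continuous_on_subset[OF assms(1)]) auto
  moreover have "(\<lambda>t. indicator {a..b} t *\<^sub>R g t) = g"
    using assms(2) by (auto simp: fun_eq_iff indicator_def)
  ultimately show ?thesis unfolding set_integrable_def by simp
qed

text \<open>\<open>D ((t - c) / e) / e\<close> is the derivative of a step climbing from 0 to 1 on
  [c, c + e], hence a probability density there; it averages \<open>m\<close> up to the oscillation
  of \<open>m\<close>.\<close>

lemma smooth_step_integral:
  fixes m :: "real \<Rightarrow> real"
  assumes D: "\<And>x. (smooth_step has_real_derivative D x) (at x)" "continuous_on UNIV D"
    "\<And>x. 0 \<le> D x" "\<And>x. x \<notin> {0..1} \<Longrightarrow> D x = 0"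
    and "0 < e" and m: "continuous_on UNIV m" "\<And>t. t \<in> {c..c+e} \<Longrightarrow> \<bar>m t - \<mu>\<bar> \<le> d"
  shows "integrable lborel (\<lambda>t. D ((t - c) / e) / e * m t)"
    "\<bar>(LBINT t. D ((t - c) / e) / e * m t) - \<mu>\<bar> \<le> d"
proof -
  have Dc: "continuous_on UNIV (\<lambda>t. D ((t - c) / e))"
    using \<open>0 < e\<close> by (intro continuous_on_compose2[OF D(2)] continuous_intros) auto
  have out: "D ((t - c) / e) = 0" if "t \<notin> {c..c+e}" for t
    using that \<open>0 < e\<close> by (intro D(4)) (auto simp: field_simps)
  have "((\<lambda>t. smooth_step ((t - c) / e)) has_real_derivative D ((t - c) / e) / e) (at t)" for t
    by (rule DERIV_cong[OF DERIV_chain2[OF D(1) DERIV_cdivide[OF DERIV_diff[OF DERIV_ident DERIV_const]]]]) simp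
  then have "has_bochner_integral lborel (\<lambda>t. D ((t - c) / e) / e * indicator {c..c+e} t)
    (smooth_step ((c + e - c) / e) - smooth_step ((c - c) / e))"
    using \<open>0 < e\<close> Dc
    by (intro has_bochner_integral_FTC_Icc_real)
      (auto intro!: continuous_intros simp: continuous_on_eq_continuous_at)
  moreover have "D ((t - c) / e) / e * indicator {c..c+e} t = D ((t - c) / e) / e" for t
    using out[of t] by (cases "t \<in> {c..c+e}") auto
  ultimately have one: "has_bochner_integral lborel (\<lambda>t. D ((t - c) / e) / e) 1"
    using \<open>0 < e\<close> by (simp only:) (simp add: smooth_step_simps)
  have [measurable]: "(\<lambda>t. D ((t - c) / e)) \<in> borel_measurable borel" "m \<in> borel_measurable borel"
    using Dc m by (auto intro: borel_measurable_continuous_onI)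
  have diff: "norm (D ((t - c) / e) / e * (m t - \<mu>)) \<le> D ((t - c) / e) / e * d" for t
    using m(2)[of t] out[of t] D(3) \<open>0 < e\<close>
    by (cases "t \<in> {c..c+e}") (auto simp: abs_mult intro!: mult_left_mono divide_right_mono)
  have i1: "integrable lborel (\<lambda>t. D ((t - c) / e) / e)" and "(LBINT t. D ((t - c) / e) / e) = 1"
    using one by (auto simp: has_bochner_integral_iff)
  have i2: "integrable lborel (\<lambda>t. D ((t - c) / e) / e * (m t - \<mu>))"
    by (rule Bochner_Integration.integrable_bound[OF integrable_mult_left[OF i1, of d]])
      (use diff in \<open>simp, intro always_eventually allI, metis abs_ge_self diff order_trans real_norm_def\<close>)
  have eq: "D ((t - c) / e) / e * m t = D ((t - c) / e) / e * (m t - \<mu>) + D ((t - c) / e) / e * \<mu>" for t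
    by (simp only: distrib_left[symmetric] diff_add_cancel)
  show "integrable lborel (\<lambda>t. D ((t - c) / e) / e * m t)"
    unfolding eq by (intro Bochner_Integration.integrable_add i2 integrable_mult_left i1)
  have "(LBINT t. D ((t - c) / e) / e * m t) - \<mu> = (LBINT t. D ((t - c) / e) / e * (m t - \<mu>))"
    unfolding eq using i1 i2 \<open>(LBINT t. D ((t - c) / e) / e) = 1\<close>
    by (simp only: Bochner_Integration.integral_add[OF i2 integrable_mult_left[OF i1]]) simp
  moreover have "norm (LBINT t. D ((t - c) / e) / e * (m t - \<mu>)) \<le> (LBINT t. D ((t - c) / e) / e * d)"
    by (intro Bochner_Integration.integral_norm_bound_integral i2 integrable_mult_left i1 diff)
  ultimately show "\<bar>(LBINT t. D ((t - c) / e) / e * m t) - \<mu>\<bar> \<le> d"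
    using \<open>(LBINT t. D ((t - c) / e) / e) = 1\<close> by simp
qed

text \<open>\<open>weak\<close> says m' \<le> n in the sense of distributions for t > 0. It is
  tested with a smoothed indicator of the time interval, whose derivative is the difference of two
  averaging kernels near the end points.\<close>

lemma weak_derivative_le:
  fixes m n :: "real \<Rightarrow> real"
  assumes m: "continuous_on UNIV m" and n: "continuous_on UNIV n"
    and weak: "\<And>a a' \<alpha> \<beta>. (\<And>k. Ck1 k a) \<Longrightarrow> (\<And>t. (a has_real_derivative a' t) (at t)) \<Longrightarrow>
      continuous_on UNIV a' \<Longrightarrow> (\<And>t. 0 \<le> a t) \<Longrightarrow>
      0 < \<alpha> \<Longrightarrow> (\<And>t. t \<notin> {\<alpha>..\<beta>} \<Longrightarrow> a t = 0) \<Longrightarrow> (\<And>t. t \<notin> {\<alpha>..\<beta>} \<Longrightarrow> a' t = 0) \<Longrightarrow>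
      0 \<le> (LBINT t. a' t * m t + a t * n t)"
    and "0 \<le> t1" "t1 \<le> t2" and N: "\<And>t. t \<in> {t1..t2} \<Longrightarrow> n t \<le> N"
  shows "m t2 - m t1 \<le> N * (t2 - t1)"
proof -
  obtain D C where D: "\<And>x. (smooth_step has_real_derivative D x) (at x)" "continuous_on UNIV D"
    "\<And>x. 0 \<le> D x" "\<And>x. x \<notin> {0..1} \<Longrightarrow> D x = 0"
    using smooth_step_deriv by metis
  \<comment> \<open>Test functions vanish near t = 0, so the left end is kept positive; t1 = 0 is
    reached afterwards by continuity of \<open>m\<close>.\<close>
  have main: "m t2 - m s \<le> N * (t2 - s)" if s: "0 < s" "t1 \<le> s" "s < t2" for s
  proof (rule field_le_epsilon)
    fix d :: real assume "0 < d"
    define M where "M t = m t - N * t" for t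
    have Mc: "continuous_on UNIV M" unfolding M_def by (intro continuous_intros m)
    then have "isCont M s" "isCont M t2" by (auto simp: continuous_on_eq_continuous_at)
    then obtain e1 e2 where e1: "0 < e1" "\<And>t. \<bar>t - s\<bar> < e1 \<Longrightarrow> \<bar>M t - M s\<bar> < d / 2"
      and e2: "0 < e2" "\<And>t. \<bar>t - t2\<bar> < e2 \<Longrightarrow> \<bar>M t - M t2\<bar> < d / 2"
      unfolding continuous_at_eps_delta dist_real_def using \<open>0 < d\<close> by (metis half_gt_zero)
    \<comment> \<open>The halving keeps the rise on [s, s + e] and the fall on [t2 - e, t2] from
      overlapping.\<close>
    define e where "e = min (min e1 e2) (t2 - s) / 2"
    have e: "0 < e" "e < e1" "e < e2" "s + e \<le> t2 - e"
      using e1 e2 s by (auto simp: e_def min_def)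
    have A1: "\<bar>M t - M s\<bar> \<le> d / 2" if "t \<in> {s..s + e}" for t
      using e1(2)[of t] that e by auto
    have A2: "\<bar>M t - M t2\<bar> \<le> d / 2" if "t \<in> {t2 - e..t2 - e + e}" for t
      using e2(2)[of t] that e by auto
    define a where "a t = smooth_step ((t - s) / e) + (- 1) * smooth_step ((t - (t2 - e)) / e)" for t
    define a' where "a' t = D ((t - s) / e) / e - D ((t - (t2 - e)) / e) / e" for t
    have a_Ck: "Ck1 k a" for k
    proof -
      have "a = (\<lambda>t. smooth_step (1 / e * t + - s / e) + (- 1) * smooth_step (1 / e * t + - (t2 - e) / e))"
      proof
        fix t
        have "(t - c) / e = 1 / e * t + - c / e" for c by (simp add: diff_divide_distrib)
        then show "a t = smooth_step (1 / e * t + - s / e) + (- 1) * smooth_step (1 / e * t + - (t2 - e) / e)"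
          unfolding a_def by metis
      qed
      then show ?thesis
        by (simp only:) (intro Ck1_add Ck1_mult Ck1_const Ck1_affine Ck1_smooth_step)
    qed
    have a_d: "(a has_real_derivative a' t) (at t)" for t
      unfolding a_def a'_def
      by (rule DERIV_cong[OF DERIV_add[OF
            DERIV_chain2[OF D(1) DERIV_cdivide[OF DERIV_diff[OF DERIV_ident DERIV_const]]]
            DERIV_cmult[OF DERIV_chain2[OF D(1) DERIV_cdivide[OF DERIV_diff[OF DERIV_ident DERIV_const]]]]]]) simp
    have a'_c: "continuous_on UNIV a'"
      unfolding a'_def using e
      by (intro continuous_intros continuous_on_compose2[OF D(2)]) auto
    have a_pos: "0 \<le> a t" for t
    proof -
      have "(t - (t2 - e)) / e \<le> (t - s) / e" using e s by (intro divide_right_mono) auto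
      then show ?thesis using smooth_step_mono by (simp add: a_def)
    qed
    have a_out: "a t = 0" "a' t = 0" if "t \<notin> {s..t2}" for t
    proof -
      consider "t < s" | "t2 < t" using \<open>t \<notin> {s..t2}\<close> by force
      then have "a t = 0 \<and> a' t = 0"
      proof cases
        case 1
        then have "(t - s) / e < 0" "(t - (t2 - e)) / e < 0" using e by (auto simp: divide_simps)
        then show ?thesis by (auto simp: a_def a'_def smooth_step_simps D(4))
      next
        case 2
        then have "(t - s) / e > 1" "(t - (t2 - e)) / e > 1" using e by (auto simp: divide_simps)
        then show ?thesis by (auto simp: a_def a'_def smooth_step_simps D(4))
      qed
      then show "a t = 0" "a' t = 0" by auto
    qed
    have ac: "continuous_on UNIV a" using a_Ck[of 0] by simp
    note int = integrable_continuous_Icc[where a = s and b = t2]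
    \<comment> \<open>The derivative of a(t) t integrates to 0, so N t may be subtracted from
      \<open>m\<close> and N from \<open>n\<close> at no cost; the second term of the weak
      inequality then becomes nonpositive.\<close>
    have "has_bochner_integral lborel (\<lambda>t. (a' t * t + a t) * indicator {s..t2} t) (a t2 * t2 - a s * s)"
      using s a_d a'_c ac
      by (intro has_bochner_integral_FTC_Icc_real)
        (auto intro!: derivative_eq_intros continuous_intros simp: continuous_on_eq_continuous_at)
    moreover have "a t2 = 0" "a s = 0"
    proof -
      have "(s - (t2 - e)) / e \<le> 0" "1 \<le> (t2 - s) / e" using e by (auto simp: divide_simps)
      then show "a t2 = 0" "a s = 0" using e by (auto simp: a_def smooth_step_simps)
    qed
    moreover have "(a' t * t + a t) * indicator {s..t2} t = a' t * t + a t" for t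
      using a_out[of t] by (cases "t \<in> {s..t2}") auto
    ultimately have z: "(LBINT t. a' t * t + a t) = 0" by (simp add: has_bochner_integral_iff)
    have "0 \<le> (LBINT t. a' t * m t + a t * n t)"
      by (rule weak[of a a' s t2]) (use a_Ck a_d a'_c a_pos s a_out in auto)
    also have "\<dots> = (LBINT t. (a' t * M t + a t * (n t - N)) + (a' t * t + a t) * N)"
      by (intro Bochner_Integration.integral_cong) (auto simp: M_def algebra_simps)
    also have "\<dots> = (LBINT t. a' t * M t + a t * (n t - N)) + (LBINT t. a' t * t + a t) * N"
      using a_out a'_c ac Mc n
      by (subst Bochner_Integration.integral_add)
        (auto intro!: int integrable_mult_left continuous_intros)
    also have "\<dots> \<le> (LBINT t. a' t * M t)"
      unfolding z using a_out a'_c ac Mc n N a_pos s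
    proof (simp, intro integral_mono int)
      fix t show "a' t * M t + a t * (n t - N) \<le> a' t * M t"
        using N[of t] a_out[of t] a_pos[of t] s
        by (cases "t \<in> {s..t2}") (auto intro: mult_nonneg_nonpos)
    qed (auto intro!: continuous_intros)
    also have "\<dots> = (LBINT t. D ((t - s) / e) / e * M t - D ((t - (t2 - e)) / e) / e * M t)"
      by (simp add: a'_def left_diff_distrib)
    also have "\<dots> = (LBINT t. D ((t - s) / e) / e * M t) - (LBINT t. D ((t - (t2 - e)) / e) / e * M t)"
    proof (intro Bochner_Integration.integral_diff)
      show "integrable lborel (\<lambda>t. D ((t - s) / e) / e * M t)"
        by (rule smooth_step_integral(1)[OF D e(1) Mc, of s "M s" "d/2"]) (assumption, erule A1)
      show "integrable lborel (\<lambda>t. D ((t - (t2 - e)) / e) / e * M t)"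
        by (rule smooth_step_integral(1)[OF D e(1) Mc, of "t2 - e" "M t2" "d/2"]) (assumption, erule A2)
    qed
    also have "\<dots> \<le> (M s + d / 2) - (M t2 - d / 2)"
    proof (intro diff_mono)
      show "(LBINT t. D ((t - s) / e) / e * M t) \<le> M s + d / 2"
      proof -
        have "\<bar>(LBINT t. D ((t - s) / e) / e * M t) - M s\<bar> \<le> d / 2"
          by (rule smooth_step_integral(2)[OF D e(1) Mc]) (assumption, erule A1)
        then show ?thesis by linarith
      qed
      show "M t2 - d / 2 \<le> (LBINT t. D ((t - (t2 - e)) / e) / e * M t)"
      proof -
        have "\<bar>(LBINT t. D ((t - (t2 - e)) / e) / e * M t) - M t2\<bar> \<le> d / 2"
          by (rule smooth_step_integral(2)[OF D e(1) Mc]) (assumption, erule A2)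
        then show ?thesis by linarith
      qed
    qed
    finally show "m t2 - m s \<le> N * (t2 - s) + d" by (simp add: M_def algebra_simps)
  qed
  consider "t1 = t2" | "0 < t1" "t1 < t2" | "t1 = 0" "0 < t2" using assms(4,5) by linarith
  then show ?thesis
  proof cases
    case 3
    have "isCont m 0" using m by (auto simp: continuous_on_eq_continuous_at)
    then have "(m \<longlongrightarrow> m 0) (at_right 0)" by (simp add: continuous_within filterlim_at_split)
    then have "((\<lambda>s. N * (t2 - s) + m s) \<longlongrightarrow> N * (t2 - 0) + m 0) (at_right 0)" by (intro tendsto_intros)
    moreover have "\<forall>\<^sub>F s in at_right 0. m t2 \<le> N * (t2 - s) + m s"
      using eventually_at_right_real[OF \<open>0 < t2\<close>]
    proof eventually_elim
      case (elim s)
      then show ?case using main[of s] 3 by auto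
    qed
    ultimately have "m t2 \<le> N * (t2 - 0) + m 0" by (rule tendsto_lowerbound) simp
    then show ?thesis using 3 by simp
  qed (use main in auto)
qed

section \<open>Curves of bounded functions, continuous in \<open>L\<^sup>1\<close>\<close>

locale L1_curve =
  fixes u :: "real \<Rightarrow> real \<Rightarrow> real" and B :: real
  assumes meas [measurable]: "u t \<in> borel_measurable borel"
    and int: "integrable lborel (u t)"
    and bound: "\<bar>u t x\<bar> \<le> B"
    and cont: "((\<lambda>s. LBINT x. \<bar>u s x - u t x\<bar>) \<longlongrightarrow> 0) (at t)"
begin

lemma B_nonneg: "0 \<le> B" using bound[of 0 0] by linarith

definition dst :: "real \<Rightarrow> real \<Rightarrow> real" where "dst s t = (LBINT x. \<bar>u s x - u t x\<bar>)"

definition mass :: "real \<Rightarrow> real" where "mass t = (LBINT x. \<bar>u t x\<bar>)"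

lemma dst_integrable: "integrable lborel (\<lambda>x. \<bar>u s x - u t x\<bar>)"
  by (intro integrable_abs Bochner_Integration.integrable_diff int)

lemma mass_integrable: "integrable lborel (\<lambda>x. \<bar>u t x\<bar>)"
  by (intro integrable_abs int)

lemma mass_nonneg: "0 \<le> mass s" by (simp add: mass_def)

lemma dst_self: "dst s s = 0" by (simp add: dst_def)

lemma dst_sym: "dst s t = dst t s" by (simp add: dst_def abs_minus_commute)

lemma dst_triangle: "dst s t \<le> dst s r + dst r t"
proof -
  have "dst s t \<le> (LBINT x. \<bar>u s x - u r x\<bar> + \<bar>u r x - u t x\<bar>)"
    unfolding dst_def by (intro integral_mono Bochner_Integration.integrable_add dst_integrable) auto
  then show ?thesis unfolding dst_def
    by (subst (asm) Bochner_Integration.integral_add) (auto intro!: dst_integrable)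
qed

lemma dst_tendsto: "((\<lambda>s. dst s t) \<longlongrightarrow> 0) (at t)"
  using cont by (simp add: dst_def)

lemma dst_small: "0 < e \<Longrightarrow> \<exists>d>0. \<forall>s. \<bar>s - t\<bar> < d \<longrightarrow> dst s t < e"
proof -
  assume "0 < e"
  from tendstoD[OF dst_tendsto this, of t]
  obtain d where d: "d > 0" "\<forall>s. s \<noteq> t \<and> \<bar>s - t\<bar> < d \<longrightarrow> \<bar>dst s t\<bar> < e"
    by (auto simp: eventually_at dist_real_def)
  have "dst s t < e" if "\<bar>s - t\<bar> < d" for s
    using d(2)[rule_format, of s] that dst_self[of t] \<open>0 < e\<close> by (cases "s = t") auto
  then show ?thesis using d(1) by blast
qed

text \<open>A Lebesgue number of the cover by continuity balls gives a modulus of continuity uniform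
  in time, from which the time-stepping arguments draw their step size.\<close>

lemma dst_uniform:
  assumes "0 < e"
  shows "\<exists>d>0. \<forall>s\<in>{a..b}. \<forall>t\<in>{a..b}. \<bar>s - t\<bar> < d \<longrightarrow> dst s t < e"
proof -
  have "\<forall>t. \<exists>d>0. \<forall>s. \<bar>s - t\<bar> < d \<longrightarrow> dst s t < e / 2"
    using assms by (intro allI dst_small) auto
  then obtain d where d: "\<And>t. d t > 0" "\<And>s t. \<bar>s - t\<bar> < d t \<Longrightarrow> dst s t < e / 2" by metis
  have "compact {a..b}" by (rule compact_Icc)
  moreover have "{a..b} \<subseteq> \<Union>((\<lambda>t. ball t (d t)) ` {a..b})" using d(1) by force
  ultimately obtain \<epsilon> where \<epsilon>: "0 < \<epsilon>" "\<And>t. t \<in> {a..b} \<Longrightarrow> \<exists>G\<in>(\<lambda>t. ball t (d t)) ` {a..b}. ball t \<epsilon> \<subseteq> G"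
    by (rule Heine_Borel_lemma) auto
  have "dst s t < e" if "s \<in> {a..b}" "t \<in> {a..b}" "\<bar>s - t\<bar> < \<epsilon>" for s t
  proof -
    obtain r where "ball t \<epsilon> \<subseteq> ball r (d r)" using \<epsilon>(2)[OF \<open>t \<in> {a..b}\<close>] by blast
    moreover have "s \<in> ball t \<epsilon>" "t \<in> ball t \<epsilon>" using that \<epsilon> by (auto simp: dist_real_def abs_minus_commute)
    ultimately have "s \<in> ball r (d r)" "t \<in> ball r (d r)" by blast+
    then have "\<bar>s - r\<bar> < d r" "\<bar>t - r\<bar> < d r" by (auto simp: dist_real_def abs_minus_commute)
    from d(2)[OF this(1)] d(2)[OF this(2)] dst_triangle[of s t r] dst_sym[of r t] show ?thesis by linarith
  qed
  then show ?thesis using \<epsilon>(1) by blast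
qed

lemma mass_dst: "mass s \<le> mass t + dst s t"
proof -
  have "mass s \<le> (LBINT x. \<bar>u t x\<bar> + \<bar>u s x - u t x\<bar>)"
    unfolding mass_def
    by (intro integral_mono Bochner_Integration.integrable_add dst_integrable mass_integrable) auto
  then show ?thesis unfolding dst_def mass_def
    by (subst (asm) Bochner_Integration.integral_add) (auto intro!: dst_integrable mass_integrable)
qed

lemma mass_bounded: "\<exists>V. \<forall>t\<in>{a..b}. mass t \<le> V"
proof -
  have "isCont mass t" for t
    unfolding isCont_def
  proof (rule tendsto_sandwich)
    show "\<forall>\<^sub>F s in at t. mass s \<le> mass t + dst s t"
      by (intro always_eventually allI mass_dst)
    show "\<forall>\<^sub>F s in at t. mass t - dst s t \<le> mass s"
    proof (intro always_eventually allI)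
      fix s show "mass t - dst s t \<le> mass s" using mass_dst[of t s] dst_sym[of s t] by linarith
    qed
    show "((\<lambda>s. mass t - dst s t) \<longlongrightarrow> mass t) (at t)" "((\<lambda>s. mass t + dst s t) \<longlongrightarrow> mass t) (at t)"
      using tendsto_diff[OF tendsto_const dst_tendsto, of "mass t"]
        tendsto_add[OF tendsto_const dst_tendsto, of "mass t"] by auto
  qed
  then have "bounded (mass ` {a..b})"
    by (intro compact_imp_bounded compact_continuous_image continuous_at_imp_continuous_on) auto
  then show ?thesis unfolding bounded_iff by (metis abs_le_D1 image_eqI real_norm_def)
qed

text \<open>Vanishing at 0 gives |\<eta>(u)| \<le> \<Lambda> |u|, so \<eta>(u) is integrable on the
  whole line against bounded weights. The Lipschitz bound is asked on the range [-B, B] of the curve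
  because fluxes are only locally Lipschitz.\<close>

definition lip0 :: "real \<Rightarrow> (real \<Rightarrow> real) \<Rightarrow> bool" where
  "lip0 \<Lambda> \<eta> \<longleftrightarrow> \<eta> \<in> borel_measurable borel \<and> \<eta> 0 = 0 \<and>
     (\<forall>a\<in>{-B..B}. \<forall>b\<in>{-B..B}. \<bar>\<eta> a - \<eta> b\<bar> \<le> \<Lambda> * \<bar>a - b\<bar>)"

lemma lip0_measurable: "lip0 \<Lambda> \<eta> \<Longrightarrow> \<eta> \<in> borel_measurable borel"
  by (simp add: lip0_def)

lemma u_range: "u t x \<in> {-B..B}"
  using bound[of t x] by auto

lemma lip0_abs: "lip0 \<Lambda> \<eta> \<Longrightarrow> \<bar>\<eta> (u t x)\<bar> \<le> \<Lambda> * \<bar>u t x\<bar>"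
  using u_range[of t x] B_nonneg unfolding lip0_def
  by (metis atLeastAtMost_iff diff_zero neg_le_0_iff_le)

lemma lip0_diff: "lip0 \<Lambda> \<eta> \<Longrightarrow> \<bar>\<eta> (u s x) - \<eta> (u t x)\<bar> \<le> \<Lambda> * \<bar>u s x - u t x\<bar>"
  using u_range unfolding lip0_def by blast

lemma lip0_integrable:
  assumes "lip0 \<Lambda> \<eta>" and [measurable]: "w \<in> borel_measurable borel" and "\<And>x. \<bar>w x\<bar> \<le> C"
  shows "integrable lborel (\<lambda>x. \<eta> (u t x) * w x)"
proof (rule Bochner_Integration.integrable_bound)
  note [measurable] = lip0_measurable[OF assms(1)]
  show "(\<lambda>x. \<eta> (u t x) * w x) \<in> borel_measurable lborel" by simp
  show "integrable lborel (\<lambda>x. \<bar>u t x\<bar> * (\<Lambda> * C))" by (auto intro!: int)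
  show "AE x in lborel. norm (\<eta> (u t x) * w x) \<le> norm (\<bar>u t x\<bar> * (\<Lambda> * C))"
  proof (intro always_eventually allI)
    fix x
    have "\<bar>\<eta> (u t x) * w x\<bar> \<le> (\<Lambda> * \<bar>u t x\<bar>) * C"
      unfolding abs_mult using lip0_abs[OF assms(1), of t x] assms(3)[of x]
      by (intro mult_mono) (auto intro: order_trans[OF abs_ge_zero])
    then show "norm (\<eta> (u t x) * w x) \<le> norm (\<bar>u t x\<bar> * (\<Lambda> * C))"
      by (simp add: mult_ac)
  qed
qed

lemma lip0_integral_diff:
  assumes "lip0 \<Lambda> \<eta>" and [measurable]: "w \<in> borel_measurable borel" and "\<And>x. \<bar>w x\<bar> \<le> C"
  shows "\<bar>(LBINT x. \<eta> (u s x) * w x) - (LBINT x. \<eta> (u t x) * w x)\<bar> \<le> \<Lambda> * C * dst s t"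
proof -
  have *: "\<bar>\<eta> (u s x) * w x - \<eta> (u t x) * w x\<bar> \<le> \<bar>u s x - u t x\<bar> * (\<Lambda> * C)" for x
  proof -
    have "\<bar>(\<eta> (u s x) - \<eta> (u t x)) * w x\<bar> \<le> (\<Lambda> * \<bar>u s x - u t x\<bar>) * C"
      unfolding abs_mult using lip0_diff[OF assms(1), of s x t] assms(3)[of x]
      by (intro mult_mono) (auto intro: order_trans[OF abs_ge_zero])
    then show ?thesis by (simp add: algebra_simps)
  qed
  have "norm (LBINT x. \<eta> (u s x) * w x - \<eta> (u t x) * w x) \<le> (LBINT x. \<bar>u s x - u t x\<bar> * (\<Lambda> * C))"
    by (intro Bochner_Integration.integral_norm_bound_integral Bochner_Integration.integrable_diff
        lip0_integrable[OF assms])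
      (use * in \<open>auto intro!: int\<close>)
  then show ?thesis
    unfolding Bochner_Integration.integral_diff[OF lip0_integrable[OF assms] lip0_integrable[OF assms]]
    by (simp add: dst_def mult_ac)
qed

lemma lip0_integral_continuous:
  assumes "lip0 \<Lambda> \<eta>" "w \<in> borel_measurable borel" "\<And>x. \<bar>w x\<bar> \<le> C"
  shows "continuous_on UNIV (\<lambda>t. LBINT x. \<eta> (u t x) * w x)"
proof -
  have "((\<lambda>s. LBINT x. \<eta> (u s x) * w x) \<longlongrightarrow> (LBINT x. \<eta> (u t x) * w x)) (at t)" for t
  proof (rule LIM_zero_cancel, rule Lim_null_comparison)
    show "\<forall>\<^sub>F s in at t. norm ((LBINT x. \<eta> (u s x) * w x) - (LBINT x. \<eta> (u t x) * w x)) \<le> \<Lambda> * C * dst s t"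
      using lip0_integral_diff[OF assms] by (intro always_eventually) auto
    show "((\<lambda>s. \<Lambda> * C * dst s t) \<longlongrightarrow> 0) (at t)"
      using tendsto_mult_left[OF dst_tendsto, of "\<Lambda> * C" t] by simp
  qed
  then show ?thesis by (simp add: continuous_on_eq_continuous_at isCont_def)
qed

lemma tail_small:
  assumes "0 < e" shows "\<exists>n0. \<forall>n\<ge>n0. (LBINT x. \<bar>u t x\<bar> * indicator {x. n < \<bar>x\<bar>} x) \<le> e"
proof -
  have "((\<lambda>n. LBINT x. \<bar>u t x\<bar> * indicator {x. n < \<bar>x\<bar>} x) \<longlongrightarrow> integral\<^sup>L lborel (\<lambda>x::real. 0::real)) at_top"
  proof (rule integral_dominated_convergence_at_top[where w = "\<lambda>x. \<bar>u t x\<bar>"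
        and f = "\<lambda>x. 0" and s = "\<lambda>n x. \<bar>u t x\<bar> * indicator {x. n < \<bar>x\<bar>} x"])
    show "AE x in lborel. ((\<lambda>n. \<bar>u t x\<bar> * indicator {x. n < \<bar>x\<bar>} x) \<longlongrightarrow> 0) at_top"
    proof (rule always_eventually, rule allI, rule tendsto_eventually)
      fix x show "\<forall>\<^sub>F n in at_top. \<bar>u t x\<bar> * indicator {x. n < \<bar>x\<bar>} x = 0"
        using eventually_ge_at_top[of "\<bar>x\<bar>"] by eventually_elim auto
    qed
    show "\<forall>\<^sub>F n in at_top. AE x in lborel. norm (\<bar>u t x\<bar> * indicator {x. n < \<bar>x\<bar>} x) \<le> \<bar>u t x\<bar>"
      by (intro always_eventually allI) (auto simp: indicator_def)
  qed (auto intro!: int)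
  then have "\<forall>\<^sub>F n in at_top. (LBINT x. \<bar>u t x\<bar> * indicator {x. n < \<bar>x\<bar>} x) < e"
    using assms by (intro order_tendstoD) auto
  then show ?thesis by (force simp: eventually_at_top_linorder)
qed

end

text \<open>The point is that \<open>C\<close> is independent of \<open>n\<close>: a plateau of
  half-width \<open>n\<close> with flanks of width \<open>n\<close> has derivative O(1/n), so the
  flux produced by the cutoff vanishes in the limit.\<close>

lemma smooth_cutoff:
  obtains C where "0 \<le> C" "\<And>n. 1 \<le> n \<Longrightarrow> \<exists>X X'. (\<forall>k. Ck1 k X) \<and> (\<forall>x. (X has_real_derivative X' x) (at x)) \<and>
    continuous_on UNIV X' \<and> (\<forall>x. 0 \<le> X x \<and> X x \<le> 1) \<and> (\<forall>x. \<bar>x\<bar> \<le> n \<longrightarrow> X x = 1) \<and>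
    (\<forall>x. 2 * n < \<bar>x\<bar> \<longrightarrow> X x = 0 \<and> X' x = 0) \<and> (\<forall>x. \<bar>X' x\<bar> \<le> C / n)"
proof -
  obtain D C where D: "\<And>x. (smooth_step has_real_derivative D x) (at x)" "continuous_on UNIV D"
    "\<And>x. 0 \<le> D x" "\<And>x. D x \<le> C" "\<And>x. x \<notin> {0..1} \<Longrightarrow> D x = 0"
    using smooth_step_deriv by metis
  have C: "0 \<le> C" using D(3)[of 0] D(4)[of 0] by linarith
  show ?thesis
  proof (rule that[of "2 * C"])
    show "0 \<le> 2 * C" using C by simp
    fix n :: real assume n: "1 \<le> n"
    define X where "X x = smooth_step ((- 1 / n) * x + 2) * smooth_step ((1 / n) * x + 2)" for x
    define X' where "X' x = D ((- 1 / n) * x + 2) * (- 1 / n) * smooth_step ((1 / n) * x + 2)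
      + D ((1 / n) * x + 2) * (1 / n) * smooth_step ((- 1 / n) * x + 2)" for x
    have d: "((\<lambda>x. smooth_step (c * x + 2)) has_real_derivative D (c * x + 2) * c) (at x)" for c x
      by (rule DERIV_chain2[OF D(1)]) (auto intro!: derivative_eq_intros)
    have "Ck1 k X" for k unfolding X_def by (intro Ck1_mult Ck1_affine Ck1_smooth_step)
    moreover have "(X has_real_derivative X' x) (at x)" for x
      unfolding X_def X'_def by (rule DERIV_mult[OF d d])
    moreover have "continuous_on UNIV X'"
    proof -
      have s: "continuous_on UNIV smooth_step" using Ck1_smooth_step[of 0] by simp
      show ?thesis unfolding X'_def
        by (intro continuous_intros continuous_on_compose2[OF D(2)] continuous_on_compose2[OF s]) auto
    qed
    moreover have "0 \<le> X x \<and> X x \<le> 1" for x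
      using smooth_step_bounds by (auto simp: X_def intro!: mult_le_one)
    moreover have "X x = 1" if "\<bar>x\<bar> \<le> n" for x
    proof -
      have "1 \<le> (- 1 / n) * x + 2" "1 \<le> (1 / n) * x + 2" using that n by (auto simp: field_simps)
      then show ?thesis unfolding X_def by (simp only: smooth_step_simps)
    qed
    moreover have "X x = 0 \<and> X' x = 0" if "2 * n < \<bar>x\<bar>" for x
    proof (cases "0 < x")
      case True
      then have "(- 1 / n) * x + 2 < 0" using that n by (auto simp: field_simps)
      then have "smooth_step ((- 1 / n) * x + 2) = 0" "D ((- 1 / n) * x + 2) = 0"
        by (auto intro!: smooth_step_simps D(5))
      then show ?thesis unfolding X_def X'_def by (simp only: mult_zero_left mult_zero_right) simp
    next
      case False
      then have "(1 / n) * x + 2 < 0" using that n by (auto simp: field_simps)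
      then have "smooth_step ((1 / n) * x + 2) = 0" "D ((1 / n) * x + 2) = 0"
        by (auto intro!: smooth_step_simps D(5))
      then show ?thesis unfolding X_def X'_def by (simp only: mult_zero_left mult_zero_right) simp
    qed
    moreover have "\<bar>X' x\<bar> \<le> 2 * C / n" for x
    proof -
      have *: "\<bar>D y * c * smooth_step z\<bar> \<le> C * (1 / n) * 1" if "\<bar>c\<bar> = 1 / n" for y z c
        unfolding abs_mult that using D(3,4) smooth_step_bounds n C by (intro mult_mono) auto
      have "\<bar>X' x\<bar> \<le> C * (1 / n) * 1 + C * (1 / n) * 1"
        unfolding X'_def by (intro order_trans[OF abs_triangle_ineq] add_mono *) (use n in auto)
      then show ?thesis by simp
    qed
    ultimately show "\<exists>X X'. (\<forall>k. Ck1 k X) \<and> (\<forall>x. (X has_real_derivative X' x) (at x)) \<and>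
      continuous_on UNIV X' \<and> (\<forall>x. 0 \<le> X x \<and> X x \<le> 1) \<and> (\<forall>x. \<bar>x\<bar> \<le> n \<longrightarrow> X x = 1) \<and>
      (\<forall>x. 2 * n < \<bar>x\<bar> \<longrightarrow> X x = 0 \<and> X' x = 0) \<and> (\<forall>x. \<bar>X' x\<bar> \<le> 2 * C / n)" by blast
  qed
qed

lemma antideriv_bounded:
  assumes P: "antideriv P p" and p: "\<And>x. R < \<bar>x\<bar> \<Longrightarrow> p x = 0"
  obtains C where "0 \<le> C" "\<And>x. \<bar>P x\<bar> \<le> C"
proof -
  define r where "r = \<bar>R\<bar> + 1"
  obtain K where K: "\<And>x. \<bar>p x\<bar> \<le> K" using P by (auto simp: antideriv_def)
  have c: "P y = P x" if "x \<le> y" "r \<le> x \<or> y \<le> - r" for x y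
  proof -
    have "(\<lambda>z. indicator {x..y} z * p z) = (\<lambda>z. 0)"
      using that p by (fastforce simp: r_def indicator_def)
    then show ?thesis using antiderivD(2)[OF P that(1)] by (simp only:) simp
  qed
  have "\<bar>P x\<bar> \<le> \<bar>P 0\<bar> + K * r" for x
  proof -
    have in_r: "\<bar>P z\<bar> \<le> \<bar>P 0\<bar> + K * r" if "\<bar>z\<bar> \<le> r" for z
    proof -
      have "\<bar>P z - P 0\<bar> \<le> K * \<bar>z - 0\<bar>" by (rule antideriv_lipschitz[OF P K])
      also have "\<dots> \<le> K * r" using that K[of 0] by (intro mult_left_mono) auto
      finally show ?thesis by linarith
    qed
    consider "\<bar>x\<bar> \<le> r" | "r < x" | "x < - r" by linarith
    then show ?thesis
    proof cases
      case 2 then show ?thesis using c[of r x] in_r[of r] by (auto simp: r_def)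
    next
      case 3 then show ?thesis using c[of x "- r"] in_r[of "- r"] by (auto simp: r_def)
    qed (rule in_r)
  qed
  moreover have "0 \<le> \<bar>P 0\<bar> + K * r" using K[of 0] by (auto simp: r_def)
  ultimately show ?thesis using that by blast
qed

section \<open>Weak inequalities tested with Lipschitz weights\<close>

context L1_curve begin

text \<open>This is \<eta>(u)_t + q(u)_x \<le> 0 in the sense of distributions for t > 0, tested
  with products a(t) b(x) and with the space integrals taken first.\<close>

definition weak_ineq :: "(real \<Rightarrow> real) \<Rightarrow> (real \<Rightarrow> real) \<Rightarrow> bool" where
  "weak_ineq \<eta> q \<longleftrightarrow> (\<forall>a a' b b' \<alpha> \<beta> R.
     (\<forall>k. Ck1 k a) \<longrightarrow> (\<forall>k. Ck1 k b) \<longrightarrow>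
     (\<forall>t. (a has_real_derivative a' t) (at t)) \<longrightarrow> (\<forall>x. (b has_real_derivative b' x) (at x)) \<longrightarrow>
     continuous_on UNIV a' \<longrightarrow> continuous_on UNIV b' \<longrightarrow> (\<forall>t. 0 \<le> a t) \<longrightarrow> (\<forall>x. 0 \<le> b x) \<longrightarrow>
     0 < \<alpha> \<longrightarrow> (\<forall>t. t \<notin> {\<alpha>..\<beta>} \<longrightarrow> a t = 0 \<and> a' t = 0) \<longrightarrow> (\<forall>x. R < \<bar>x\<bar> \<longrightarrow> b x = 0 \<and> b' x = 0) \<longrightarrow>
     0 \<le> (LBINT t. a' t * (LBINT x. \<eta> (u t x) * b x) + a t * (LBINT x. q (u t x) * b' x)))"

text \<open>An upper bound \<open>N\<close> of the flux term takes the place of its integral over \<open>[t1, t2]\<close>.\<close>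

definition ent_pair :: "(real \<Rightarrow> real) \<Rightarrow> (real \<Rightarrow> real) \<Rightarrow> bool" where
  "ent_pair \<eta> q \<longleftrightarrow> (\<forall>\<psi> \<rho> R t1 t2 N. antideriv \<psi> \<rho> \<longrightarrow> (\<forall>x. R < \<bar>x\<bar> \<longrightarrow> \<rho> x = 0) \<longrightarrow>
     (\<forall>x. 0 \<le> \<psi> x) \<longrightarrow> 0 \<le> t1 \<longrightarrow> t1 \<le> t2 \<longrightarrow> (\<forall>t\<in>{t1..t2}. (LBINT x. q (u t x) * \<rho> x) \<le> N) \<longrightarrow>
     (LBINT x. \<eta> (u t2 x) * \<psi> x) - (LBINT x. \<eta> (u t1 x) * \<psi> x) \<le> N * (t2 - t1))"

text \<open>A Lipschitz weight \<psi> that is constant far out on either side is approximated by (F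
  + e) X, with \<open>F\<close> a polynomial near \<psi> on [-2n, 2n] and \<open>X\<close> a cutoff.
  The derivative of \<open>F\<close> is close to \<rho> in L1 while q(u) is bounded; the derivative
  of \<open>X\<close> is uniformly small while q(u) is bounded in L1.\<close>

lemma weak_ineq_imp_ent_pair:
  assumes \<eta>: "lip0 \<Lambda> \<eta>" and q: "lip0 \<Lambda> q" and weak: "weak_ineq \<eta> q" and \<Lambda>: "0 \<le> \<Lambda>"
  shows "ent_pair \<eta> q"
  unfolding ent_pair_def
proof (intro allI impI)
  fix \<psi> \<rho> R t1 t2 N
  assume \<psi>: "antideriv \<psi> \<rho>" and out: "\<forall>x. R < \<bar>x\<bar> \<longrightarrow> \<rho> x = 0" and pos: "\<forall>x. 0 \<le> \<psi> x"
    and t: "0 \<le> t1" "t1 \<le> t2" and N: "\<forall>t\<in>{t1..t2}. (LBINT x. q (u t x) * \<rho> x) \<le> N"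
  note [measurable] = antiderivD(1)[OF \<psi>] lip0_measurable[OF \<eta>] lip0_measurable[OF q]
  have [measurable]: "\<psi> \<in> borel_measurable borel"
    by (intro borel_measurable_continuous_onI antideriv_continuous[OF \<psi>])
  obtain K where K: "\<And>x. \<bar>\<rho> x\<bar> \<le> K" using \<psi> by (auto simp: antideriv_def)
  obtain Y where Y: "0 \<le> Y" "\<And>x. \<bar>\<psi> x\<bar> \<le> Y" using antideriv_bounded[OF \<psi>] out by metis
  obtain V where V: "\<And>s. s \<in> {t1..t2} \<Longrightarrow> mass s \<le> V" using mass_bounded by metis
  have V0: "0 \<le> V" using V[of t1] mass_nonneg[of t1] t by auto
  obtain C where C: "0 \<le> C" "\<And>n. 1 \<le> n \<Longrightarrow> \<exists>X X'. (\<forall>k. Ck1 k X) \<and> (\<forall>x. (X has_real_derivative X' x) (at x)) \<and>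
    continuous_on UNIV X' \<and> (\<forall>x. 0 \<le> X x \<and> X x \<le> 1) \<and> (\<forall>x. \<bar>x\<bar> \<le> n \<longrightarrow> X x = 1) \<and>
    (\<forall>x. 2 * n < \<bar>x\<bar> \<longrightarrow> X x = 0 \<and> X' x = 0) \<and> (\<forall>x. \<bar>X' x\<bar> \<le> C / n)"
    using smooth_cutoff by metis
  \<comment> \<open>\<open>C1\<close> collects the flux errors: the L1 error of the derivative of
    \<open>F\<close> against the bound \<Lambda> B of q(u), and the slope of the cutoff, at most C
    e, against the mass bound \<open>V\<close>. \<open>C2\<close> collects the errors of the weight:
    2 e everywhere, and \<open>Y\<close> more on the tails, where the curve has mass at most
    \<open>e\<close>.\<close>
  define C1 where "C1 = \<Lambda> * B + \<Lambda> * ((Y + 2) * C) * V"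
  define C2 where "C2 = \<Lambda> * 2 * V + \<Lambda> * Y"
  have approx: "(LBINT x. \<eta> (u t2 x) * \<psi> x) - (LBINT x. \<eta> (u t1 x) * \<psi> x)
      \<le> (N + C1 * e) * (t2 - t1) + 2 * C2 * e" if e: "0 < e" "e < 1" for e
  proof -
    obtain n1 n2 where n1: "\<And>n. n1 \<le> n \<Longrightarrow> (LBINT x. \<bar>u t1 x\<bar> * indicator {x. n < \<bar>x\<bar>} x) \<le> e"
      and n2: "\<And>n. n2 \<le> n \<Longrightarrow> (LBINT x. \<bar>u t2 x\<bar> * indicator {x. n < \<bar>x\<bar>} x) \<le> e"
      using tail_small[OF e(1)] by metis
    \<comment> \<open>\<open>n1\<close> and \<open>n2\<close> make the tails small at the two end
      times, \<open>R\<close> puts the support of \<rho> under the plateau of the cutoff, and 1/e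
      makes the slope of the cutoff O(e).\<close>
    define n where "n = Max {n1, n2, R, 1 / e, 1}"
    have n: "n1 \<le> n" "n2 \<le> n" "R \<le> n" "1 / e \<le> n" "1 \<le> n" by (auto simp: n_def)
    obtain X X' where X: "\<And>k. Ck1 k X" "\<And>x. (X has_real_derivative X' x) (at x)"
      "continuous_on UNIV X'" "\<And>x. 0 \<le> X x \<and> X x \<le> 1" "\<And>x. \<bar>x\<bar> \<le> n \<Longrightarrow> X x = 1"
      "\<And>x. 2 * n < \<bar>x\<bar> \<Longrightarrow> X x = 0 \<and> X' x = 0" "\<And>x. \<bar>X' x\<bar> \<le> C / n"
      using C(2)[OF n(5)] by metis
    obtain F r where F: "\<And>k. Ck1 k F" "\<And>x. (F has_real_derivative r x) (at x)"
      "continuous_on UNIV r" "F (- 2 * n) = \<psi> (- 2 * n)"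
      "(LBINT x. indicator {- 2 * n..2 * n} x * \<bar>r x - \<rho> x\<bar>) \<le> e"
      using L1_approx_polynomial[OF antiderivD(1)[OF \<psi>] K e(1), of "- 2 * n" "2 * n"] n by auto
    have [measurable]: "r \<in> borel_measurable borel" "X' \<in> borel_measurable borel"
      by (intro borel_measurable_continuous_onI F X)+
    have cont: "continuous_on UNIV F" "continuous_on UNIV X" using F(1)[of 0] X(1)[of 0] by auto
    then have [measurable]: "F \<in> borel_measurable borel" "X \<in> borel_measurable borel"
      by (intro borel_measurable_continuous_onI; simp)+
    obtain Kr where Kr: "\<And>x. x \<in> {- 2 * n..2 * n} \<Longrightarrow> \<bar>r x\<bar> \<le> Kr"
    proof -
      have "bounded (r ` {- 2 * n..2 * n})"
        using F(3) by (intro compact_imp_bounded compact_continuous_image) (auto intro: continuous_on_subset)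
      then show ?thesis using that unfolding bounded_iff real_norm_def ball_simps by metis
    qed
    have irr: "integrable lborel (\<lambda>x. indicator {- 2 * n..2 * n} x * \<bar>r x - \<rho> x\<bar>)"
    proof (rule integrable_indicator_bounded[where K = "Kr + K"])
      fix x assume "x \<in> {- 2 * n..2 * n}"
      from Kr[OF this] K[of x] show "\<bar>\<bar>r x - \<rho> x\<bar>\<bar> \<le> Kr + K" by linarith
    qed simp
    have Fe: "\<bar>F x - \<psi> x\<bar> \<le> e" if x: "\<bar>x\<bar> \<le> 2 * n" for x
    proof -
      have le: "- 2 * n \<le> x" "x \<le> 2 * n" using x by auto
      have "(LBINT z. indicator {- 2 * n..x} z *\<^sub>R r z) = F x - F (- 2 * n)"
        using F(2,3) le
        by (intro integral_FTC_Icc)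
          (auto intro: continuous_on_subset has_field_derivative_at_within
            simp: has_real_derivative_iff_has_vector_derivative[symmetric])
      moreover have "(LBINT z. indicator {- 2 * n..x} z * \<rho> z) = \<psi> x - \<psi> (- 2 * n)"
        using antiderivD(2)[OF \<psi> le(1)] by simp
      ultimately have "F x - \<psi> x = (LBINT z. indicator {- 2 * n..x} z * r z) - (LBINT z. indicator {- 2 * n..x} z * \<rho> z)"
        using F(4) by simp
      also have "\<dots> = (LBINT z. indicator {- 2 * n..x} z * r z - indicator {- 2 * n..x} z * \<rho> z)"
        by (rule Bochner_Integration.integral_diff[symmetric])
          (rule integrable_indicator_bounded[where K = Kr] integrable_indicator_bounded[where K = K];
            use Kr K le in auto)+
      finally have "\<bar>F x - \<psi> x\<bar> \<le> (LBINT z. \<bar>indicator {- 2 * n..x} z * r z - indicator {- 2 * n..x} z * \<rho> z\<bar>)"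
        using integral_norm_bound[of lborel "\<lambda>z. indicator {- 2 * n..x} z * r z - indicator {- 2 * n..x} z * \<rho> z"]
        by simp
      also have "\<dots> \<le> (LBINT z. indicator {- 2 * n..2 * n} z * \<bar>r z - \<rho> z\<bar>)"
      proof (rule integral_mono')
        show "\<bar>indicator {- 2 * n..x} z * r z - indicator {- 2 * n..x} z * \<rho> z\<bar> \<le> indicator {- 2 * n..2 * n} z * \<bar>r z - \<rho> z\<bar>" for z
          using le by (auto simp: indicator_def)
      qed (use irr in auto)
      finally show ?thesis using F(5) by linarith
    qed
    \<comment> \<open>Adding \<open>e\<close> keeps the first factor nonnegative on the support of
      \<open>X\<close>, since \<open>F\<close> may lie below \<psi> by as much as
      \<open>e\<close>.\<close>
    define b where "b x = (F x + e) * X x" for x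
    define b' where "b' x = r x * X x + X' x * (F x + e)" for x
    have b_Ck: "Ck1 k b" for k unfolding b_def by (intro Ck1_mult Ck1_add Ck1_const F X)
    have b_d: "(b has_real_derivative b' x) (at x)" for x
      unfolding b_def b'_def
      using DERIV_mult[OF DERIV_add[OF F(2) DERIV_const] X(2), of e x] by simp
    have b'_c: "continuous_on UNIV b'" unfolding b'_def by (intro continuous_intros F X cont)
    have b_pos: "0 \<le> b x" for x
    proof (cases "\<bar>x\<bar> \<le> 2 * n")
      case True
      then have "0 \<le> F x + e" using Fe[of x] pos[rule_format, of x] by linarith
      then show ?thesis using X(4)[of x] by (simp add: b_def)
    qed (use X(6)[of x] in \<open>simp add: b_def\<close>)
    have b_out: "b x = 0 \<and> b' x = 0" if "2 * n < \<bar>x\<bar>" for x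
      using X(6)[OF that] by (simp add: b_def b'_def)
    have [measurable]: "b \<in> borel_measurable borel" "b' \<in> borel_measurable borel"
      unfolding b_def b'_def by measurable
    have Fb: "\<bar>F x + e\<bar> \<le> Y + 2" if "\<bar>x\<bar> \<le> 2 * n" for x
      using Fe[OF that] Y(2)[of x] e by linarith
    have bb: "\<bar>b x - \<psi> x\<bar> \<le> 2 * e + Y * indicator {x. n < \<bar>x\<bar>} x" for x
    proof (cases "\<bar>x\<bar> \<le> n")
      case True
      then show ?thesis using Fe[of x] X(5)[OF True] n(5) e by (auto simp: b_def)
    next
      case False
      show ?thesis
      proof (cases "\<bar>x\<bar> \<le> 2 * n")
        case True
        have "b x - \<psi> x = (F x + e - \<psi> x) * X x - \<psi> x * (1 - X x)" by (simp add: b_def algebra_simps)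
        moreover have "\<bar>(F x + e - \<psi> x) * X x\<bar> \<le> (2 * e) * 1"
          unfolding abs_mult using Fe[OF True] X(4)[of x] e by (intro mult_mono) auto
        moreover have "\<bar>\<psi> x * (1 - X x)\<bar> \<le> Y * 1"
          unfolding abs_mult using Y X(4)[of x] by (intro mult_mono) auto
        ultimately show ?thesis using False by auto
      next
        case F2: False
        then show ?thesis using b_out[of x] Y(2)[of x] False e by auto
      qed
    qed
    have b'b: "\<bar>b' x - \<rho> x\<bar> \<le> indicator {- 2 * n..2 * n} x * \<bar>r x - \<rho> x\<bar> + (Y + 2) * C * e" for x
    proof (cases "\<bar>x\<bar> \<le> 2 * n")
      case True
      have "\<rho> x * (X x - 1) = 0" using X(5)[of x] out[rule_format, of x] n(3) by (cases "\<bar>x\<bar> \<le> n") auto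
      then have "b' x - \<rho> x = (r x - \<rho> x) * X x + X' x * (F x + e)" by (simp add: b'_def algebra_simps)
      moreover have "\<bar>(r x - \<rho> x) * X x\<bar> \<le> \<bar>r x - \<rho> x\<bar> * 1"
        unfolding abs_mult using X(4)[of x] by (intro mult_left_mono) auto
      moreover have "\<bar>X' x * (F x + e)\<bar> \<le> (C * e) * (Y + 2)"
      proof -
        have "C / n \<le> C * e"
        proof -
          have "1 / n \<le> e" using n(4,5) e(1) by (simp add: field_simps)
          then have "C * (1 / n) \<le> C * e" using C(1) by (intro mult_left_mono)
          then show ?thesis by simp
        qed
        then have "\<bar>X' x\<bar> \<le> C * e" using X(7)[of x] by linarith
        then show ?thesis unfolding abs_mult using Fb[OF True] C(1) e by (intro mult_mono) auto
      qed
      ultimately show ?thesis using True by (auto simp: indicator_def mult_ac)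
    next
      case False
      moreover from False have "\<rho> x = 0" using out n(3,5) by auto
      ultimately show ?thesis using b_out[of x] Y(1) C(1) e by auto
    qed
    have b_bd: "\<bar>b x\<bar> \<le> 2 * e + 2 * Y" for x
      using bb[of x] Y(2)[of x] Y(1) by (cases "n < \<bar>x\<bar>") auto
    have b'_bd: "\<bar>b' x\<bar> \<le> Kr + 2 * K + (Y + 2) * C * e" for x
    proof -
      have "indicator {- 2 * n..2 * n} x * \<bar>r x - \<rho> x\<bar> \<le> Kr + K"
        using Kr[of x] Kr[of 0] K[of x] n(5) by (auto simp: indicator_def)
      then show ?thesis using b'b[of x] K[of x] by linarith
    qed
    have n_bound: "(LBINT x. q (u s x) * b' x) \<le> N + C1 * e" if s: "s \<in> {t1..t2}" for s
    proof -
      have "norm (LBINT x. q (u s x) * b' x - q (u s x) * \<rho> x) \<le>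
        (LBINT x. (\<Lambda> * B) * (indicator {- 2 * n..2 * n} x * \<bar>r x - \<rho> x\<bar>) + \<Lambda> * ((Y + 2) * C * e) * \<bar>u s x\<bar>)"
      proof (rule Bochner_Integration.integral_norm_bound_integral)
        show "integrable lborel (\<lambda>x. q (u s x) * b' x - q (u s x) * \<rho> x)"
          by (intro Bochner_Integration.integrable_diff lip0_integrable[OF q _ b'_bd] lip0_integrable[OF q _ K]) auto
        show "integrable lborel (\<lambda>x. (\<Lambda> * B) * (indicator {- 2 * n..2 * n} x * \<bar>r x - \<rho> x\<bar>) + \<Lambda> * ((Y + 2) * C * e) * \<bar>u s x\<bar>)"
          by (intro Bochner_Integration.integrable_add integrable_mult_right irr mass_integrable)
        fix x
        have q1: "\<bar>q (u s x)\<bar> \<le> \<Lambda> * B"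
          using lip0_abs[OF q, of s x] bound[of s x] \<Lambda> by (meson mult_left_mono order_trans)
        have "norm (q (u s x) * b' x - q (u s x) * \<rho> x) = \<bar>q (u s x)\<bar> * \<bar>b' x - \<rho> x\<bar>"
          by (simp add: abs_mult[symmetric] right_diff_distrib)
        also have "\<dots> \<le> \<bar>q (u s x)\<bar> * (indicator {- 2 * n..2 * n} x * \<bar>r x - \<rho> x\<bar>) + \<bar>q (u s x)\<bar> * ((Y + 2) * C * e)"
          unfolding distrib_left[symmetric] by (intro mult_left_mono b'b) simp
        also have "\<dots> \<le> (\<Lambda> * B) * (indicator {- 2 * n..2 * n} x * \<bar>r x - \<rho> x\<bar>) + (\<Lambda> * \<bar>u s x\<bar>) * ((Y + 2) * C * e)"
          using Y(1) C(1) e q1 lip0_abs[OF q, of s x] by (intro add_mono mult_right_mono) auto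
        finally show "norm (q (u s x) * b' x - q (u s x) * \<rho> x) \<le>
          (\<Lambda> * B) * (indicator {- 2 * n..2 * n} x * \<bar>r x - \<rho> x\<bar>) + \<Lambda> * ((Y + 2) * C * e) * \<bar>u s x\<bar>"
          by (simp add: mult_ac)
      qed
      also have "\<dots> = (\<Lambda> * B) * (LBINT x. indicator {- 2 * n..2 * n} x * \<bar>r x - \<rho> x\<bar>) + \<Lambda> * ((Y + 2) * C * e) * mass s"
        by (subst Bochner_Integration.integral_add)
          (use irr in \<open>auto intro!: mass_integrable simp: mass_def\<close>)
      also have "\<dots> \<le> (\<Lambda> * B) * e + \<Lambda> * ((Y + 2) * C * e) * V"
        using F(5) V[OF s] \<Lambda> B_nonneg Y(1) C(1) e
        by (intro add_mono mult_left_mono) auto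
      also have "\<dots> = C1 * e" by (simp add: C1_def algebra_simps)
      finally have "(LBINT x. q (u s x) * b' x - q (u s x) * \<rho> x) \<le> C1 * e" by simp
      moreover have "(LBINT x. q (u s x) * b' x - q (u s x) * \<rho> x) = (LBINT x. q (u s x) * b' x) - (LBINT x. q (u s x) * \<rho> x)"
        by (intro Bochner_Integration.integral_diff lip0_integrable[OF q _ b'_bd] lip0_integrable[OF q _ K]) auto
      ultimately show ?thesis using N[rule_format, OF s] by linarith
    qed
    have m_bound: "\<bar>(LBINT x. \<eta> (u s x) * b x) - (LBINT x. \<eta> (u s x) * \<psi> x)\<bar> \<le> C2 * e"
      if s: "s \<in> {t1..t2}" and tail: "(LBINT x. \<bar>u s x\<bar> * indicator {x. n < \<bar>x\<bar>} x) \<le> e" for s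
    proof -
      have i: "integrable lborel (\<lambda>x. \<bar>u s x\<bar> * indicator {x. n < \<bar>x\<bar>} x)"
        by (rule Bochner_Integration.integrable_bound[OF mass_integrable[of s]]) (auto simp: indicator_def)
      have "norm (LBINT x. \<eta> (u s x) * b x - \<eta> (u s x) * \<psi> x) \<le>
        (LBINT x. \<Lambda> * (2 * e) * \<bar>u s x\<bar> + \<Lambda> * Y * (\<bar>u s x\<bar> * indicator {x. n < \<bar>x\<bar>} x))"
      proof (rule Bochner_Integration.integral_norm_bound_integral)
        show "integrable lborel (\<lambda>x. \<eta> (u s x) * b x - \<eta> (u s x) * \<psi> x)"
          by (intro Bochner_Integration.integrable_diff lip0_integrable[OF \<eta> _ b_bd] lip0_integrable[OF \<eta> _ Y(2)]) auto
        show "integrable lborel (\<lambda>x. \<Lambda> * (2 * e) * \<bar>u s x\<bar> + \<Lambda> * Y * (\<bar>u s x\<bar> * indicator {x. n < \<bar>x\<bar>} x))"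
          by (intro Bochner_Integration.integrable_add integrable_mult_right i mass_integrable)
        fix x
        have "norm (\<eta> (u s x) * b x - \<eta> (u s x) * \<psi> x) = \<bar>\<eta> (u s x)\<bar> * \<bar>b x - \<psi> x\<bar>"
          by (simp add: abs_mult[symmetric] right_diff_distrib)
        also have "\<dots> \<le> (\<Lambda> * \<bar>u s x\<bar>) * (2 * e + Y * indicator {x. n < \<bar>x\<bar>} x)"
          using lip0_abs[OF \<eta>, of s x] bb[of x] \<Lambda> by (intro mult_mono) auto
        finally show "norm (\<eta> (u s x) * b x - \<eta> (u s x) * \<psi> x) \<le>
          \<Lambda> * (2 * e) * \<bar>u s x\<bar> + \<Lambda> * Y * (\<bar>u s x\<bar> * indicator {x. n < \<bar>x\<bar>} x)"
          by (simp add: algebra_simps)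
      qed
      also have "\<dots> = \<Lambda> * (2 * e) * mass s + \<Lambda> * Y * (LBINT x. \<bar>u s x\<bar> * indicator {x. n < \<bar>x\<bar>} x)"
        by (subst Bochner_Integration.integral_add) (auto intro!: i mass_integrable simp: mass_def)
      also have "\<dots> \<le> \<Lambda> * (2 * e) * V + \<Lambda> * Y * e"
        using tail V[OF s] \<Lambda> Y(1) e by (intro add_mono mult_left_mono) auto
      also have "\<dots> = C2 * e" by (simp add: C2_def algebra_simps)
      finally have "\<bar>LBINT x. \<eta> (u s x) * b x - \<eta> (u s x) * \<psi> x\<bar> \<le> C2 * e" by simp
      moreover have "(LBINT x. \<eta> (u s x) * b x - \<eta> (u s x) * \<psi> x) = (LBINT x. \<eta> (u s x) * b x) - (LBINT x. \<eta> (u s x) * \<psi> x)"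
        by (intro Bochner_Integration.integral_diff lip0_integrable[OF \<eta> _ b_bd] lip0_integrable[OF \<eta> _ Y(2)]) auto
      ultimately show ?thesis by simp
    qed
    have "(LBINT x. \<eta> (u t2 x) * b x) - (LBINT x. \<eta> (u t1 x) * b x) \<le> (N + C1 * e) * (t2 - t1)"
    proof (rule weak_derivative_le[where n = "\<lambda>t. LBINT x. q (u t x) * b' x"])
      show "continuous_on UNIV (\<lambda>t. LBINT x. \<eta> (u t x) * b x)"
        by (rule lip0_integral_continuous[OF \<eta> _ b_bd]) simp
      show "continuous_on UNIV (\<lambda>t. LBINT x. q (u t x) * b' x)"
        by (rule lip0_integral_continuous[OF q _ b'_bd]) simp
      show "0 \<le> (LBINT t. a' t * (LBINT x. \<eta> (u t x) * b x) + a t * (LBINT x. q (u t x) * b' x))"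
        if "\<And>k. Ck1 k a" "\<And>t. (a has_real_derivative a' t) (at t)" "continuous_on UNIV a'"
          "\<And>t. 0 \<le> a t" "0 < \<alpha>" "\<And>t. t \<notin> {\<alpha>..\<beta>} \<Longrightarrow> a t = 0" "\<And>t. t \<notin> {\<alpha>..\<beta>} \<Longrightarrow> a' t = 0"
        for a a' \<alpha> \<beta>
        by (rule weak[unfolded weak_ineq_def, rule_format, of a b a' b' \<alpha> \<beta> "2 * n"])
          (use that b_Ck b_d b'_c b_pos b_out in auto)
    qed (use t n_bound in auto)
    moreover have "\<bar>(LBINT x. \<eta> (u t1 x) * b x) - (LBINT x. \<eta> (u t1 x) * \<psi> x)\<bar> \<le> C2 * e"
      by (rule m_bound) (use t n1[OF n(1)] in auto)
    moreover have "\<bar>(LBINT x. \<eta> (u t2 x) * b x) - (LBINT x. \<eta> (u t2 x) * \<psi> x)\<bar> \<le> C2 * e"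
      by (rule m_bound) (use t n2[OF n(2)] in auto)
    ultimately show ?thesis by linarith
  qed
  have "((\<lambda>e. (N + C1 * e) * (t2 - t1) + 2 * C2 * e) \<longlongrightarrow> (N + C1 * 0) * (t2 - t1) + 2 * C2 * 0) (at_right 0)"
    by (intro tendsto_intros)
  moreover have "\<forall>\<^sub>F e in at_right 0. (LBINT x. \<eta> (u t2 x) * \<psi> x) - (LBINT x. \<eta> (u t1 x) * \<psi> x)
      \<le> (N + C1 * e) * (t2 - t1) + 2 * C2 * e"
    using eventually_at_right_real[OF zero_less_one] by eventually_elim (use approx in auto)
  ultimately have "(LBINT x. \<eta> (u t2 x) * \<psi> x) - (LBINT x. \<eta> (u t1 x) * \<psi> x)
      \<le> (N + C1 * 0) * (t2 - t1) + 2 * C2 * 0"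
    by (rule tendsto_lowerbound) simp
  then show "(LBINT x. \<eta> (u t2 x) * \<psi> x) - (LBINT x. \<eta> (u t1 x) * \<psi> x) \<le> N * (t2 - t1)" by simp
qed

end

section \<open>Curves with the Kruzkov inequalities\<close>

text \<open>Kruzkov entropy pairs, normalised to vanish at \<open>0\<close>: composed with an integrable function they
  are integrable on the whole line.\<close>

definition kru_eta :: "real \<Rightarrow> real \<Rightarrow> real" where "kru_eta k v = \<bar>v - k\<bar> - \<bar>k\<bar>"

definition kru_flux :: "(real \<Rightarrow> real) \<Rightarrow> real \<Rightarrow> real \<Rightarrow> real" where
  "kru_flux f k v = sgn (v - k) * (f v - f k) - sgn (- k) * (f 0 - f k)"

lemma integrable_indicator_mult_abs:
  fixes g :: "real \<Rightarrow> real"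
  assumes "integrable lborel g" "A \<in> sets borel"
  shows "integrable lborel (\<lambda>x. indicator A x * g x)"
  by (rule Bochner_Integration.integrable_bound[OF assms(1)])
    (use assms borel_measurable_integrable[OF assms(1)] in \<open>auto simp: indicator_def\<close>)

lemma integrable_compact_support:
  fixes g :: "real \<Rightarrow> real"
  assumes "g \<in> borel_measurable borel" "\<And>x. \<bar>g x\<bar> \<le> K" "\<And>x. R < \<bar>x\<bar> \<Longrightarrow> g x = 0"
  shows "integrable lborel g"
proof -
  have "integrable lborel (\<lambda>x. indicator {-R..R} x * g x)"
    by (rule integrable_indicator_bounded[OF assms(1,2)])
  moreover have "indicator {-R..R} x * g x = g x" for x
    using assms(3)[of x] by (cases "R < \<bar>x\<bar>") (auto simp: indicator_def)
  ultimately show ?thesis by simp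
qed

section \<open>The primitive of a curve\<close>

context L1_curve begin

definition U :: "real \<Rightarrow> real \<Rightarrow> real" where
  "U t x = (LBINT z. indicator {..x} z * u t z)"

lemma antideriv_U: "antideriv (U t) (u t)"
  unfolding antideriv_def
proof (intro conjI allI impI exI[of _ B])
  fix x y :: real assume "x \<le> y"
  have "(LBINT z. indicator {..y} z * u t z) - (LBINT z. indicator {..x} z * u t z) =
    (LBINT z. indicator {..y} z * u t z - indicator {..x} z * u t z)"
    by (intro Bochner_Integration.integral_diff[symmetric] integrable_indicator_mult_abs int) auto
  also have "\<dots> = (LBINT z. indicator {x..y} z * u t z)"
  proof (rule integral_cong_AE)
    show "AE z in lborel. indicator {..y} z * u t z - indicator {..x} z * u t z = indicator {x..y} z * u t z"
      using AE_lborel_singleton[of x] by eventually_elim (use \<open>x \<le> y\<close> in \<open>auto simp: indicator_def\<close>)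
  qed auto
  finally show "U t y - U t x = (LBINT z. indicator {x..y} z * u t z)" by (simp add: U_def)
qed (use bound in auto)

lemma U_continuous: "continuous_on UNIV (U t)"
  by (rule antideriv_continuous[OF antideriv_U])

lemma U_measurable [measurable]: "U t \<in> borel_measurable borel"
  by (rule borel_measurable_continuous_onI[OF U_continuous])

lemma U_bounded: "\<bar>U t x\<bar> \<le> mass t"
proof -
  have "norm (LBINT z. indicator {..x} z * u t z) \<le> (LBINT z. \<bar>u t z\<bar>)"
    by (intro Bochner_Integration.integral_norm_bound_integral mass_integrable integrable_indicator_mult_abs int)
      (auto simp: indicator_def)
  then show ?thesis by (simp add: U_def mass_def)
qed

text \<open>Fubini in the role of integration by parts: testing \<open>U\<close> with \<rho> is
  testing \<open>u\<close> with the tail integral of \<rho>, a Lipschitz weight with density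
  -\<rho>.\<close>

lemma integral_mult_U:
  assumes [measurable]: "\<rho> \<in> borel_measurable borel" and K: "\<And>x. \<bar>\<rho> x\<bar> \<le> K" and R: "\<And>x. R < \<bar>x\<bar> \<Longrightarrow> \<rho> x = 0"
  shows "(LBINT x. U t x * \<rho> x) = (LBINT y. u t y * (LBINT x. indicator {y..} x * \<rho> x))"
proof -
  have i\<rho>: "integrable lborel \<rho>"
    by (rule integrable_compact_support[OF assms])
  have dom: "integrable (lborel \<Otimes>\<^sub>M lborel) (\<lambda>p. \<bar>\<rho> (fst p)\<bar> * \<bar>u t (snd p)\<bar>)"
  proof (rule lborel_pair.Fubini_integrable)
    show "(\<lambda>p. \<bar>\<rho> (fst p)\<bar> * \<bar>u t (snd p)\<bar>) \<in> borel_measurable (lborel \<Otimes>\<^sub>M lborel)" by measurable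
    show "integrable lborel (\<lambda>x. LBINT y. norm (\<bar>\<rho> (fst (x, y))\<bar> * \<bar>u t (snd (x, y))\<bar>))"
      using i\<rho> by (auto simp: abs_mult)
    show "AE x in lborel. integrable lborel (\<lambda>y. \<bar>\<rho> (fst (x, y))\<bar> * \<bar>u t (snd (x, y))\<bar>)"
      by (auto intro!: mass_integrable)
  qed
  have meas2: "(\<lambda>p. \<rho> (fst p) * (if snd p \<le> fst p then u t (snd p) else 0)) \<in> borel_measurable (lborel \<Otimes>\<^sub>M lborel)"
    by measurable
  have "integrable (lborel \<Otimes>\<^sub>M lborel) (\<lambda>p. \<rho> (fst p) * (if snd p \<le> fst p then u t (snd p) else 0))"
    by (rule Bochner_Integration.integrable_bound[OF dom meas2]) (auto simp: abs_mult)
  then have int2: "integrable (lborel \<Otimes>\<^sub>M lborel) (\<lambda>(x, y). \<rho> x * (if y \<le> x then u t y else 0))"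
    by (simp add: case_prod_beta')
  have "(LBINT x. U t x * \<rho> x) = (LBINT x. LBINT y. \<rho> x * (if y \<le> x then u t y else 0))"
  proof (intro Bochner_Integration.integral_cong refl)
    fix x
    have "(if y \<le> x then u t y else 0) = indicator {..x} y * u t y" for y by auto
    then show "U t x * \<rho> x = (LBINT y. \<rho> x * (if y \<le> x then u t y else 0))"
      by (simp only: integral_mult_right_zero U_def mult.commute)
  qed
  also have "\<dots> = (LBINT y. LBINT x. \<rho> x * (if y \<le> x then u t y else 0))"
    by (rule lborel_pair.Fubini_integral[OF int2, symmetric])
  also have "\<dots> = (LBINT y. u t y * (LBINT x. indicator {y..} x * \<rho> x))"
  proof (intro Bochner_Integration.integral_cong refl)
    fix y
    have "\<rho> x * (if y \<le> x then u t y else 0) = u t y * (indicator {y..} x * \<rho> x)" for x by auto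
    then show "(LBINT x. \<rho> x * (if y \<le> x then u t y else 0)) = u t y * (LBINT x. indicator {y..} x * \<rho> x)"
      by (simp only: integral_mult_right_zero)
  qed
  finally show ?thesis .
qed

lemma antideriv_tail:
  assumes [measurable]: "\<rho> \<in> borel_measurable borel" and K: "\<And>x. \<bar>\<rho> x\<bar> \<le> K" and R: "\<And>x. R < \<bar>x\<bar> \<Longrightarrow> \<rho> x = 0"
  shows "antideriv (\<lambda>y. LBINT x. indicator {y..} x * \<rho> x) (\<lambda>x. - \<rho> x)"
  unfolding antideriv_def
proof (intro conjI allI impI exI[of _ K])
  have i: "integrable lborel \<rho>" by (rule integrable_compact_support[OF assms])
  fix x y :: real assume "x \<le> y"
  have "(LBINT z. indicator {y..} z * \<rho> z) - (LBINT z. indicator {x..} z * \<rho> z) =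
    (LBINT z. indicator {y..} z * \<rho> z - indicator {x..} z * \<rho> z)"
    by (intro Bochner_Integration.integral_diff[symmetric] integrable_indicator_mult_abs i) auto
  also have "\<dots> = (LBINT z. indicator {x..y} z * - \<rho> z)"
  proof (rule integral_cong_AE)
    show "AE z in lborel. indicator {y..} z * \<rho> z - indicator {x..} z * \<rho> z = indicator {x..y} z * - \<rho> z"
      using AE_lborel_singleton[of y] by eventually_elim (use \<open>x \<le> y\<close> in \<open>auto simp: indicator_def\<close>)
  qed auto
  finally show "(LBINT z. indicator {y..} z * \<rho> z) - (LBINT z. indicator {x..} z * \<rho> z) = (LBINT z. indicator {x..y} z * - \<rho> z)" .
qed (use K in auto)

end

section \<open>Consequences of the Kruzkov inequalities\<close>

locale entropy_curve = L1_curve +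
  fixes f :: "real \<Rightarrow> real" and L :: real
  assumes f_cont: "continuous_on UNIV f" and f_0: "f 0 = 0" and B_pos: "0 < B" and L_pos: "0 < L"
    and f_lip: "\<And>a b. a \<in> {-B..B} \<Longrightarrow> b \<in> {-B..B} \<Longrightarrow> \<bar>f a - f b\<bar> \<le> L * \<bar>a - b\<bar>"
    and kruzkov: "\<And>k. k \<in> {-B..B} \<Longrightarrow> weak_ineq (kru_eta k) (kru_flux f k)"
begin

lemma f_measurable [measurable]: "f \<in> borel_measurable borel"
  by (rule borel_measurable_continuous_onI[OF f_cont])

lemma kru_flux_lip:
  assumes "k \<in> {-B..B}" "a \<in> {-B..B}" "b \<in> {-B..B}"
  shows "\<bar>kru_flux f k a - kru_flux f k b\<bar> \<le> L * \<bar>a - b\<bar>"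
proof -
  have *: "\<bar>kru_flux f k a - kru_flux f k b\<bar> \<le> L * \<bar>a - b\<bar>" if "a \<le> b" "a \<in> {-B..B}" "b \<in> {-B..B}" for a b
  proof -
    consider "k < a" | "b < k" | "a \<le> k" "k \<le> b" by linarith
    then show ?thesis
    proof cases
      case 3
      \<comment> \<open>When \<open>k\<close> separates the arguments, the two values are estimated
        separately by their distances to \<open>k\<close>; these add up to b - a, so the constant
        stays \<open>L\<close>.\<close>
      have "\<bar>f b - f k\<bar> \<le> L * (b - k)" "\<bar>f a - f k\<bar> \<le> L * (k - a)"
        using f_lip[of b k] f_lip[of a k] that assms(1) 3 by auto
      moreover have "kru_flux f k b - kru_flux f k a = sgn (b - k) * (f b - f k) - sgn (a - k) * (f a - f k)"
        by (simp add: kru_flux_def)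
      moreover have "\<bar>sgn (b - k) * (f b - f k)\<bar> \<le> \<bar>f b - f k\<bar>" "\<bar>sgn (a - k) * (f a - f k)\<bar> \<le> \<bar>f a - f k\<bar>"
        by (auto simp: abs_mult sgn_real_def)
      ultimately have "\<bar>kru_flux f k a - kru_flux f k b\<bar> \<le> L * (b - k) + L * (k - a)" by linarith
      then show ?thesis using that by (simp add: algebra_simps)
    qed (use f_lip[of a b] that in \<open>auto simp: kru_flux_def sgn_real_def abs_minus_commute\<close>)
  qed
  show ?thesis
  proof (cases "a \<le> b")
    case False
    then show ?thesis using *[of b a] assms by (simp add: abs_minus_commute)
  qed (use * assms in auto)
qed

lemma lip0_kru:
  assumes "k \<in> {-B..B}" shows "lip0 (1 + L) (kru_eta k)" "lip0 (1 + L) (kru_flux f k)"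
proof -
  have "\<bar>kru_eta k a - kru_eta k b\<bar> \<le> (1 + L) * \<bar>a - b\<bar>" for a b
  proof -
    have "\<bar>kru_eta k a - kru_eta k b\<bar> \<le> 1 * \<bar>a - b\<bar>" by (auto simp: kru_eta_def)
    also have "\<dots> \<le> (1 + L) * \<bar>a - b\<bar>" using L_pos by (intro mult_right_mono) auto
    finally show ?thesis .
  qed
  then show "lip0 (1 + L) (kru_eta k)"
    unfolding lip0_def by (auto simp: kru_eta_def[abs_def])
  have "\<bar>kru_flux f k a - kru_flux f k b\<bar> \<le> (1 + L) * \<bar>a - b\<bar>" if "a \<in> {-B..B}" "b \<in> {-B..B}" for a b
  proof -
    note kru_flux_lip[OF assms that]
    also have "L * \<bar>a - b\<bar> \<le> (1 + L) * \<bar>a - b\<bar>" by (intro mult_right_mono) auto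
    finally show ?thesis .
  qed
  then show "lip0 (1 + L) (kru_flux f k)"
    unfolding lip0_def by (auto simp: kru_flux_def[abs_def])
qed

lemma lip0_f: "lip0 L f"
  using f_lip f_0 by (auto simp: lip0_def)

lemma lip0_id: "lip0 1 (\<lambda>v. v)"
  by (auto simp: lip0_def)

lemma ent_pair_kru: "k \<in> {-B..B} \<Longrightarrow> ent_pair (kru_eta k) (kru_flux f k)"
  using L_pos by (intro weak_ineq_imp_ent_pair[OF lip0_kru] kruzkov) auto

lemma ent_pairD:
  assumes "ent_pair \<eta> q" "antideriv \<psi> \<rho>" "\<And>x. R < \<bar>x\<bar> \<Longrightarrow> \<rho> x = 0" "\<And>x. 0 \<le> \<psi> x" "0 \<le> t1" "t1 \<le> t2"
    "\<And>t. t \<in> {t1..t2} \<Longrightarrow> (LBINT x. q (u t x) * \<rho> x) \<le> N"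
  shows "(LBINT x. \<eta> (u t2 x) * \<psi> x) - (LBINT x. \<eta> (u t1 x) * \<psi> x) \<le> N * (t2 - t1)"
  using assms unfolding ent_pair_def by blast

text \<open>At k = B and k = -B the sign of u - k is fixed, so the entropy inequalities become the
  two halves of the weak equation u_t + f(u)_x = 0; the normalisation and f 0 = 0 remove the
  constants.\<close>

lemma kru_linear:
  "kru_eta B (u t x) = - u t x" "kru_flux f B (u t x) = - f (u t x)"
  "kru_eta (- B) (u t x) = u t x" "kru_flux f (- B) (u t x) = f (u t x)"
  using u_range[of t x] B_pos f_0
  by (cases "u t x = B"; cases "u t x = - B"; auto simp: kru_eta_def kru_flux_def sgn_real_def)+

text \<open>The weight is frozen over the step and the flux term is replaced by its value at
  \<open>t1\<close>; along the curve that term varies by at most (1 + L) K times the L1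
  displacement.\<close>

lemma kru_step:
  assumes k: "k \<in> {-B..B}" and \<psi>: "antideriv \<psi> \<rho>" "\<And>x. R < \<bar>x\<bar> \<Longrightarrow> \<rho> x = 0" "\<And>x. 0 \<le> \<psi> x" "\<And>x. \<bar>\<rho> x\<bar> \<le> K"
    and t: "0 \<le> t1" "t1 \<le> t2" and \<omega>: "\<And>t. t \<in> {t1..t2} \<Longrightarrow> dst t t1 \<le> \<omega>"
  shows "(LBINT x. kru_eta k (u t2 x) * \<psi> x) - (LBINT x. kru_eta k (u t1 x) * \<psi> x)
    \<le> ((LBINT x. kru_flux f k (u t1 x) * \<rho> x) + (1 + L) * K * \<omega>) * (t2 - t1)"
proof (rule ent_pairD[OF ent_pair_kru[OF k] \<psi>(1,2,3) t])
  fix t assume "t \<in> {t1..t2}"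
  have K: "0 \<le> K" using \<psi>(4)[of 0] by linarith
  have "\<bar>(LBINT x. kru_flux f k (u t x) * \<rho> x) - (LBINT x. kru_flux f k (u t1 x) * \<rho> x)\<bar> \<le> (1 + L) * K * dst t t1"
    by (rule lip0_integral_diff[OF lip0_kru(2)[OF k] antiderivD(1)[OF \<psi>(1)] \<psi>(4)])
  also have "\<dots> \<le> (1 + L) * K * \<omega>"
    using \<omega>[OF \<open>t \<in> _\<close>] K L_pos by (intro mult_left_mono) auto
  finally show "(LBINT x. kru_flux f k (u t x) * \<rho> x) \<le> (LBINT x. kru_flux f k (u t1 x) * \<rho> x) + (1 + L) * K * \<omega>"
    by linarith
qed

text \<open>The constant weight 1 is admissible, since it is the density that must have bounded
  support, and it removes the flux; k = B and k = -B give the two inequalities.\<close>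

lemma mass_conservation:
  assumes "0 \<le> t" shows "(LBINT x. u t x) = (LBINT x. u 0 x)"
proof -
  have a: "antideriv (\<lambda>x. 1) (\<lambda>x. 0)" by (auto simp: antideriv_def)
  have "(LBINT x. kru_eta k (u t x) * 1) - (LBINT x. kru_eta k (u 0 x) * 1) \<le> 0 * (t - 0)" if "k \<in> {-B..B}" for k
    by (rule ent_pairD[OF ent_pair_kru[OF that] a]) (use assms in auto)
  from this[of B] this[of "- B"] B_pos show ?thesis by (auto simp: kru_linear)
qed

lemma kru_decrease:
  assumes "0 \<le> t" "k \<in> {-B..B}"
  shows "(LBINT x. kru_eta k (u t x)) \<le> (LBINT x. kru_eta k (u 0 x))"
proof -
  have a: "antideriv (\<lambda>x. 1) (\<lambda>x. 0)" by (auto simp: antideriv_def)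
  have "(LBINT x. kru_eta k (u t x) * 1) - (LBINT x. kru_eta k (u 0 x) * 1) \<le> 0 * (t - 0)"
    by (rule ent_pairD[OF ent_pair_kru[OF assms(2)] a]) (use assms in auto)
  then show ?thesis by simp
qed

text \<open>|v| - v is twice the negative part of v, and |v - M| - M + v is twice the excess of v
  over \<open>M\<close>. Both are Kruzkov entropies up to a linear term, so by conservation of mass
  their integrals do not grow; they are nonnegative and start at 0.\<close>

lemma max_principle:
  assumes "AE x in lborel. 0 \<le> u 0 x \<and> u 0 x \<le> M" "0 \<le> M" "M \<le> B" "0 \<le> t"
  shows "AE x in lborel. 0 \<le> u t x \<and> u t x \<le> M"
proof -
  have main: "AE x in lborel. kru_eta k (u t x) + s * u t x = 0"
    if k: "k \<in> {-B..B}" and pos: "\<And>v. 0 \<le> kru_eta k v + s * v"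
      and 0: "AE x in lborel. kru_eta k (u 0 x) + s * u 0 x = 0" for k s
  proof -
    have i: "integrable lborel (\<lambda>x. kru_eta k (u r x))" for r
      using lip0_integrable[OF lip0_kru(1)[OF k], of "\<lambda>x. 1" 1 r] by simp
    have i2: "integrable lborel (\<lambda>x. kru_eta k (u r x) + s * u r x)" for r
      by (intro Bochner_Integration.integrable_add i integrable_mult_right int)
    have eq: "(LBINT x. kru_eta k (u r x) + s * u r x) = (LBINT x. kru_eta k (u r x)) + s * (LBINT x. u r x)" for r
      by (subst Bochner_Integration.integral_add) (auto intro!: i int)
    have "(LBINT x. kru_eta k (u t x) + s * u t x) \<le> (LBINT x. kru_eta k (u 0 x) + s * u 0 x)"
      unfolding eq using kru_decrease[OF assms(4) k] mass_conservation[OF assms(4)] by simp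
    also have "\<dots> = integral\<^sup>L lborel (\<lambda>x::real. 0::real)"
      using 0 borel_measurable_integrable[OF i2] by (intro integral_cong_AE) auto
    finally have "(LBINT x. kru_eta k (u t x) + s * u t x) = 0"
      using pos by (intro antisym) (auto intro!: integral_nonneg_AE)
    then show ?thesis using integral_nonneg_eq_0_iff_AE[OF i2] pos by auto
  qed
  have "AE x in lborel. kru_eta 0 (u t x) + (- 1) * u t x = 0"
    by (rule main) (use assms B_pos in \<open>auto simp: kru_eta_def\<close>)
  moreover have "AE x in lborel. kru_eta M (u t x) + 1 * u t x = 0"
    by (rule main) (use assms B_pos in \<open>auto simp: kru_eta_def\<close>)
  ultimately show ?thesis by eventually_elim (use assms in \<open>auto simp: kru_eta_def\<close>)
qed

text \<open>A weight of either sign is made nonnegative by adding a constant, which contributes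
  equally at both times by conservation of mass; k = -B and k = B then give the upper and the lower
  bound.\<close>

lemma linear_step:
  assumes \<psi>: "antideriv \<psi> \<rho>" "\<And>x. R < \<bar>x\<bar> \<Longrightarrow> \<rho> x = 0" "\<And>x. \<bar>\<rho> x\<bar> \<le> K"
    and t: "0 \<le> t1" "t1 \<le> t2"
    and N: "\<And>t. t \<in> {t1..t2} \<Longrightarrow> \<bar>(LBINT x. f (u t x) * \<rho> x) - N\<bar> \<le> d"
  shows "\<bar>(LBINT x. u t2 x * \<psi> x) - (LBINT x. u t1 x * \<psi> x) - (t2 - t1) * N\<bar> \<le> (t2 - t1) * d"
proof -
  obtain C where C: "0 \<le> C" "\<And>x. \<bar>\<psi> x\<bar> \<le> C" using antideriv_bounded[OF \<psi>(1,2)] by blast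
  have [measurable]: "\<psi> \<in> borel_measurable borel"
    by (intro borel_measurable_continuous_onI antideriv_continuous[OF \<psi>(1)])
  have a: "antideriv (\<lambda>x. \<psi> x + C) \<rho>" using \<psi>(1) by (auto simp: antideriv_def)
  have pos: "0 \<le> \<psi> x + C" for x using C(2)[of x] by linarith
  have i: "integrable lborel (\<lambda>x. u t x * \<psi> x)" for t
    using lip0_integrable[OF lip0_id, of \<psi> C] C by auto
  have shift: "(LBINT x. u t x * (\<psi> x + C)) = (LBINT x. u t x * \<psi> x) + C * (LBINT x. u 0 x)" if "0 \<le> t" for t
    unfolding distrib_left using mass_conservation[OF that]
    by (subst Bochner_Integration.integral_add) (auto intro!: i int)
  have "(LBINT x. kru_eta (-B) (u t2 x) * (\<psi> x + C)) - (LBINT x. kru_eta (-B) (u t1 x) * (\<psi> x + C)) \<le> (N + d) * (t2 - t1)"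
  proof (rule ent_pairD[OF ent_pair_kru a \<psi>(2) pos t])
    show "(LBINT x. kru_flux f (- B) (u t x) * \<rho> x) \<le> N + d" if "t \<in> {t1..t2}" for t
      using N[OF that] by (simp add: kru_linear)
  qed (use B_pos in auto)
  then have "(LBINT x. u t2 x * \<psi> x) - (LBINT x. u t1 x * \<psi> x) \<le> (N + d) * (t2 - t1)"
    using t by (simp add: kru_linear shift)
  moreover have "(LBINT x. kru_eta B (u t2 x) * (\<psi> x + C)) - (LBINT x. kru_eta B (u t1 x) * (\<psi> x + C)) \<le> (d - N) * (t2 - t1)"
  proof (rule ent_pairD[OF ent_pair_kru a \<psi>(2) pos t])
    show "(LBINT x. kru_flux f B (u t x) * \<rho> x) \<le> d - N" if "t \<in> {t1..t2}" for t
      using N[OF that] by (simp add: kru_linear)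
  qed (use B_pos in auto)
  then have "(LBINT x. u t1 x * \<psi> x) - (LBINT x. u t2 x * \<psi> x) \<le> (d - N) * (t2 - t1)"
    unfolding kru_linear mult_minus_left integral_minus using t by (simp add: shift)
  ultimately show ?thesis by (simp add: abs_le_iff algebra_simps)
qed

text \<open>The tested, time-integrated form of U_t + f(U_x) = 0. The tail integral of \<rho> has
  density -\<rho>, so the flux \<open>N\<close> of the conservation law appears here with the
  opposite sign.\<close>

lemma U_step:
  assumes \<rho>: "\<rho> \<in> borel_measurable borel" "\<And>x. \<bar>\<rho> x\<bar> \<le> K" "\<And>x. R < \<bar>x\<bar> \<Longrightarrow> \<rho> x = 0"
    and t: "0 \<le> t1" "t1 \<le> t2"
    and N: "\<And>t. t \<in> {t1..t2} \<Longrightarrow> \<bar>(LBINT x. f (u t x) * \<rho> x) - N\<bar> \<le> d"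
  shows "\<bar>(LBINT x. (U t2 x - U t1 x) * \<rho> x) + (t2 - t1) * N\<bar> \<le> (t2 - t1) * d"
proof -
  note [measurable] = \<rho>(1)
  have i: "integrable lborel (\<lambda>x. U t x * \<rho> x)" for t
  proof -
    have "\<bar>U t x * \<rho> x\<bar> \<le> mass t * K" for x
      unfolding abs_mult using U_bounded[of t x] \<rho>(2)[of x] mass_nonneg[of t] by (intro mult_mono) auto
    then show ?thesis
      using \<rho>(3) by (intro integrable_compact_support[where K = "mass t * K" and R = R]) auto
  qed
  have "\<bar>(LBINT x. u t2 x * (LBINT z. indicator {x..} z * \<rho> z)) - (LBINT x. u t1 x * (LBINT z. indicator {x..} z * \<rho> z))
     - (t2 - t1) * (- N)\<bar> \<le> (t2 - t1) * d"
  proof (rule linear_step[OF antideriv_tail[OF \<rho>] _ _ t, where R = R and K = K])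
    show "\<bar>(LBINT x. f (u t x) * - \<rho> x) - - N\<bar> \<le> d" if "t \<in> {t1..t2}" for t
      using N[OF that] by (simp add: abs_minus_commute)
  qed (use \<rho> in auto)
  moreover have "(LBINT x. U t x * \<rho> x) = (LBINT y. u t y * (LBINT x. indicator {y..} x * \<rho> x))" for t
    using \<rho> by (rule integral_mult_U)
  ultimately show ?thesis
    unfolding left_diff_distrib[of "U _ _"] Bochner_Integration.integral_diff[OF i i]
      mult_minus_right diff_minus_eq_add by simp
qed

end

section \<open>Comparison with affine functions\<close>

text \<open>The squared positive part is positive exactly for y > 0 and C^1 with Lipschitz
  derivative, so it detects a sign and has a Taylor remainder of at most h^2.\<close>

definition ramp2 :: "real \<Rightarrow> real" where "ramp2 y = (max 0 y)\<^sup>2"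

lemma ramp2_taylor: "\<bar>ramp2 (y + h) - ramp2 y - 2 * max 0 y * h\<bar> \<le> h\<^sup>2"
proof -
  consider "0 \<le> y" "0 \<le> y + h" | "y \<le> 0" "y + h \<le> 0" | "0 < y" "y + h < 0" | "y < 0" "0 < y + h" by linarith
  then show ?thesis
  proof cases
    case 3
    have "ramp2 (y + h) - ramp2 y - 2 * max 0 y * h = h\<^sup>2 - (y + h)\<^sup>2"
      using 3 by (simp add: ramp2_def power2_eq_square algebra_simps)
    moreover have "(y + h)\<^sup>2 \<le> h\<^sup>2" using 3 by (intro abs_le_square_iff[THEN iffD1]) auto
    ultimately show ?thesis by (simp add: abs_le_iff)
  next
    case 4
    have "(y + h)\<^sup>2 \<le> h\<^sup>2" using 4 by (intro abs_le_square_iff[THEN iffD1]) auto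
    then show ?thesis using 4 by (simp add: ramp2_def)
  qed (auto simp: ramp2_def power2_eq_square algebra_simps)
qed

lemma ramp2_deriv: "(ramp2 has_real_derivative 2 * max 0 y) (at y)"
  unfolding DERIV_def
proof (rule LIM_zero_cancel, rule Lim_null_comparison)
  show "\<forall>\<^sub>F h in at 0. norm ((ramp2 (y + h) - ramp2 y) / h - 2 * max 0 y) \<le> \<bar>h\<bar>"
    unfolding eventually_at_filter
  proof (intro always_eventually allI impI)
    fix h :: real assume "h \<noteq> 0"
    then have "(ramp2 (y + h) - ramp2 y) / h - 2 * max 0 y = (ramp2 (y + h) - ramp2 y - 2 * max 0 y * h) / h"
      by (simp add: field_simps)
    moreover have "\<bar>ramp2 (y + h) - ramp2 y - 2 * max 0 y * h\<bar> / \<bar>h\<bar> \<le> h\<^sup>2 / \<bar>h\<bar>"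
      by (intro divide_right_mono ramp2_taylor) simp
    ultimately show "norm ((ramp2 (y + h) - ramp2 y) / h - 2 * max 0 y) \<le> \<bar>h\<bar>"
      using \<open>h \<noteq> 0\<close> by (simp add: power2_eq_square divide_simps split: if_splits)
  qed
  show "((\<lambda>h. \<bar>h\<bar>) \<longlongrightarrow> 0) (at (0::real))" by (rule tendsto_eq_intros | simp)+
qed

lemma ramp2_has_derivative [derivative_intros]:
  assumes "(g has_derivative g') (at x within S)"
  shows "((\<lambda>x. ramp2 (g x)) has_derivative (\<lambda>v. 2 * max 0 (g x) * g' v)) (at x within S)"
  using has_derivative_compose[OF assms ramp2_deriv[unfolded has_field_derivative_def]] .

lemma ramp2_continuous [continuous_intros]:
  "continuous_on S g \<Longrightarrow> continuous_on S (\<lambda>x. ramp2 (g x))"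
  unfolding ramp2_def by (intro continuous_intros)

lemma ramp2_nonneg: "0 \<le> ramp2 y" by (simp add: ramp2_def)

lemma ramp2_zero: "y \<le> 0 \<Longrightarrow> ramp2 y = 0" by (simp add: ramp2_def)

lemma ramp2_pos: "0 < y \<Longrightarrow> 0 < ramp2 y" by (simp add: ramp2_def)

lemma ramp2_measurable [measurable]: "ramp2 \<in> borel_measurable borel"
  unfolding ramp2_def by measurable

lemma abs_mult_le:
  fixes x y :: real
  shows "\<bar>x\<bar> \<le> a \<Longrightarrow> \<bar>y\<bar> \<le> b \<Longrightarrow> \<bar>x * y\<bar> \<le> a * b"
  unfolding abs_mult by (intro mult_mono) auto

text \<open>The factors are replaced one at a time. With increments O(s) and remainders O(s^2), the
  three final error terms contribute 4 + 1 + 4 = 9 in units of M^3 s^2.\<close>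

lemma prod3_taylor:
  fixes a b c :: real
  assumes "\<bar>a' - a - \<alpha>\<bar> \<le> M * s\<^sup>2" "\<bar>b' - b - \<beta>\<bar> \<le> M * s\<^sup>2" "\<bar>c' - c - \<gamma>\<bar> \<le> M * s\<^sup>2"
    and "\<bar>\<alpha>\<bar> \<le> M * s" "\<bar>\<beta>\<bar> \<le> M * s" "\<bar>\<gamma>\<bar> \<le> M * s"
    and "\<bar>a\<bar> \<le> M" "\<bar>b\<bar> \<le> M" "\<bar>b'\<bar> \<le> M" "\<bar>c'\<bar> \<le> M" "0 \<le> s" "s \<le> 1"
  shows "\<bar>a' * b' * c' - a * b * c - (\<alpha> * b * c + a * \<beta> * c + a * b * \<gamma>)\<bar> \<le> 9 * M ^ 3 * s\<^sup>2"
proof -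
  have M: "0 \<le> M" using assms(7) by linarith
  have s2: "M * s\<^sup>2 \<le> M * s" using assms(11,12) M by (intro mult_left_mono) (simp_all add: power2_eq_square mult_left_le)
  have db: "\<bar>b' - b\<bar> \<le> 2 * M * s" "\<bar>c' - c\<bar> \<le> 2 * M * s" using assms(2,3,5,6) s2 by linarith+
  define X where "X = a * b"
  define \<xi> where "\<xi> = \<alpha> * b + a * \<beta>"
  have "a' * b' - X - \<xi> = (a' - a - \<alpha>) * b' + a * (b' - b - \<beta>) + \<alpha> * (b' - b)"
    by (simp add: X_def \<xi>_def algebra_simps)
  moreover have "\<bar>(a' - a - \<alpha>) * b'\<bar> \<le> (M * s\<^sup>2) * M" "\<bar>a * (b' - b - \<beta>)\<bar> \<le> M * (M * s\<^sup>2)"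
    "\<bar>\<alpha> * (b' - b)\<bar> \<le> (M * s) * (2 * M * s)"
    by (intro abs_mult_le assms db)+
  ultimately have e: "\<bar>a' * b' - X - \<xi>\<bar> \<le> 4 * M\<^sup>2 * s\<^sup>2" by (simp add: power2_eq_square algebra_simps)
  have \<xi>: "\<bar>\<xi>\<bar> \<le> 2 * M\<^sup>2 * s"
  proof -
    have "\<bar>\<alpha> * b\<bar> \<le> (M * s) * M" "\<bar>a * \<beta>\<bar> \<le> M * (M * s)"
      by (intro abs_mult_le assms)+
    then show ?thesis by (simp add: \<xi>_def power2_eq_square algebra_simps)
  qed
  have X: "\<bar>X\<bar> \<le> M\<^sup>2" unfolding X_def power2_eq_square by (intro abs_mult_le assms)
  have "a' * b' * c' - a * b * c - (\<alpha> * b * c + a * \<beta> * c + a * b * \<gamma>) =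
    (a' * b' - X - \<xi>) * c' + X * (c' - c - \<gamma>) + \<xi> * (c' - c)"
    by (simp add: X_def \<xi>_def algebra_simps)
  moreover have "\<bar>(a' * b' - X - \<xi>) * c'\<bar> \<le> (4 * M\<^sup>2 * s\<^sup>2) * M" "\<bar>X * (c' - c - \<gamma>)\<bar> \<le> M\<^sup>2 * (M * s\<^sup>2)"
    "\<bar>\<xi> * (c' - c)\<bar> \<le> (2 * M\<^sup>2 * s) * (2 * M * s)"
    by (intro abs_mult_le assms db e X \<xi>)+
  ultimately have "\<bar>a' * b' * c' - a * b * c - (\<alpha> * b * c + a * \<beta> * c + a * b * \<gamma>)\<bar> \<le>
    (4 * M\<^sup>2 * s\<^sup>2) * M + M\<^sup>2 * (M * s\<^sup>2) + (2 * M\<^sup>2 * s) * (2 * M * s)" by linarith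
  also have "\<dots> = 9 * M ^ 3 * s\<^sup>2" by (simp add: power2_eq_square power3_eq_cube algebra_simps)
  finally show ?thesis .
qed

text \<open>The second argument of \<open>Q\<close> is the error accumulated so far. An error of e s
  per step totals e (b - a) no matter how short the steps have to be.\<close>

lemma step_induct:
  fixes Q :: "real \<Rightarrow> real \<Rightarrow> bool"
  assumes "a \<le> b" "Q a c" "0 < d"
    and step: "\<And>t s c. a \<le> t \<Longrightarrow> 0 \<le> s \<Longrightarrow> s < d \<Longrightarrow> t + s \<le> b \<Longrightarrow> Q t c \<Longrightarrow> Q (t + s) (c + e * s)"
  shows "Q b (c + e * (b - a))"
proof -
  obtain n :: nat where n: "(b - a) / d < real n" using reals_Archimedean2 by blast
  define s where "s = (b - a) / real (Suc n)"
  have "b - a < d * real (Suc n)" using n assms(3) by (simp add: field_simps)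
  then have s: "0 \<le> s" "s < d" using assms(1) by (auto simp: s_def field_simps)
  have "Q (a + real i * s) (c + e * (real i * s))" if "i \<le> Suc n" for i
    using that
  proof (induction i)
    case (Suc i)
    have "real (Suc i) * s \<le> real (Suc n) * s" using Suc.prems s by (intro mult_right_mono) auto
    also have "\<dots> = b - a" by (simp add: s_def)
    finally have "a + real i * s + s \<le> b" by (simp add: algebra_simps)
    then have "Q (a + real i * s + s) (c + e * (real i * s) + e * s)"
      using Suc.IH Suc.prems s step[of "a + real i * s" s "c + e * (real i * s)"] by simp
    then show ?case by (simp add: algebra_simps)
  qed (use assms in simp)
  from this[of "Suc n"] show ?thesis by (simp add: s_def)
qed

context entropy_curve begin

lemma box_step:
  assumes e: "0 < e" and t: "0 \<le> t1" "t1 \<le> t2" and \<omega>: "\<And>t. t \<in> {t1..t2} \<Longrightarrow> dst t t1 \<le> \<omega>"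
  shows "\<bar>(LBINT z. indicator {x..x + e} z * (U t2 z - U t1 z)) + (t2 - t1) * (LBINT z. indicator {x..x + e} z * f (u t1 z))\<bar>
    \<le> (t2 - t1) * (L * \<omega>)"
proof -
  have b: "\<bar>indicator {x..x + e} z :: real\<bar> \<le> 1" for z by (simp add: indicator_def)
  have "\<bar>(LBINT z. (U t2 z - U t1 z) * indicator {x..x + e} z) + (t2 - t1) * (LBINT z. f (u t1 z) * indicator {x..x + e} z)\<bar>
    \<le> (t2 - t1) * (L * \<omega>)"
  proof (rule U_step[OF _ b _ t, where R = "\<bar>x\<bar> + \<bar>x + e\<bar>"])
    fix t assume "t \<in> {t1..t2}"
    have "\<bar>(LBINT z. f (u t z) * indicator {x..x + e} z) - (LBINT z. f (u t1 z) * indicator {x..x + e} z)\<bar> \<le> L * 1 * dst t t1"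
      by (rule lip0_integral_diff[OF lip0_f _ b]) simp
    also have "\<dots> \<le> L * \<omega>" using \<omega>[OF \<open>t \<in> _\<close>] L_pos by simp
    finally show "\<bar>(LBINT z. f (u t z) * indicator {x..x + e} z) - (LBINT z. f (u t1 z) * indicator {x..x + e} z)\<bar> \<le> L * \<omega>" .
  qed (auto simp: indicator_def)
  then show ?thesis by (simp add: mult.commute)
qed

lemma f_bound: "\<bar>f (u t x)\<bar> \<le> L * B"
  using lip0_abs[OF lip0_f, of t x] bound[of t x] L_pos by (meson less_imp_le mult_left_mono order_trans)

text \<open>The tested equation bounds the mean of the increment over [x, x + e] by L B times the
  elapsed time; as each \<open>U t\<close> is B-Lipschitz in space, shrinking the window leads to
  the point \<open>x\<close>.\<close>

lemma U_time_lipschitz: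
  assumes t: "0 \<le> t1" "t1 \<le> t2"
  shows "\<bar>U t2 x - U t1 x\<bar> \<le> L * B * (t2 - t1)"
proof (rule field_le_epsilon)
  fix d :: real assume "0 < d"
  \<comment> \<open>The increment \<open>h\<close> is 2B-Lipschitz in space, so over a window of
    this width it changes by at most \<open>d\<close>.\<close>
  define e where "e = d / (2 * B)"
  have e: "0 < e" using \<open>0 < d\<close> B_pos by (simp add: e_def)
  have b: "\<bar>indicator {x..x + e} z * (1 / e) :: real\<bar> \<le> 1 / e" for z using e by (simp add: indicator_def)
  define h where "h z = U t2 z - U t1 z" for z
  have [measurable]: "h \<in> borel_measurable borel" unfolding h_def by measurable
  have "\<bar>(LBINT z. (U t2 z - U t1 z) * (indicator {x..x + e} z * (1 / e))) + (t2 - t1) * 0\<bar> \<le> (t2 - t1) * (L * B)"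
  proof (rule U_step[OF _ b _ t, where R = "\<bar>x\<bar> + \<bar>x + e\<bar>"])
    fix t
    have "\<bar>LBINT z. indicator {x..x + e} z * (f (u t z) / e)\<bar> \<le> (L * B / e) * (x + e - x)"
      by (rule indicator_integral_bound) (use e f_bound in \<open>auto intro!: divide_right_mono\<close>)
    then show "\<bar>(LBINT z. f (u t z) * (indicator {x..x + e} z * (1 / e))) - 0\<bar> \<le> L * B"
      using e by (simp add: mult_ac)
  qed (auto simp: indicator_def)
  then have 1: "\<bar>LBINT z. indicator {x..x + e} z * (h z / e)\<bar> \<le> L * B * (t2 - t1)"
    by (simp add: h_def mult_ac)
  have hx: "\<bar>h z - h x\<bar> \<le> d" if "z \<in> {x..x + e}" for z
  proof -
    have "\<bar>U t2 z - U t2 x\<bar> \<le> B * \<bar>z - x\<bar>" "\<bar>U t1 z - U t1 x\<bar> \<le> B * \<bar>z - x\<bar>"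
      by (intro antideriv_lipschitz[OF antideriv_U] bound)+
    moreover have "B * \<bar>z - x\<bar> \<le> B * e" using that B_pos by (intro mult_left_mono) auto
    moreover have "B * e = d / 2" using B_pos by (simp add: e_def)
    ultimately show ?thesis by (simp add: h_def)
  qed
  have 2: "\<bar>LBINT z. indicator {x..x + e} z * ((h z - h x) / e)\<bar> \<le> (d / e) * (x + e - x)"
    by (rule indicator_integral_bound) (use e hx in \<open>auto intro!: divide_right_mono\<close>)
  have 3: "(LBINT z. indicator {x..x + e} z * ((h z - h x) / e)) = (LBINT z. indicator {x..x + e} z * (h z / e)) - h x"
  proof -
    have i1: "integrable lborel (\<lambda>z. indicator {x..x + e} z * (h z / e))"
    proof (rule integrable_indicator_bounded[where K = "(mass t2 + mass t1) / e"])
      have "\<bar>h z\<bar> \<le> mass t2 + mass t1" for z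
        using U_bounded[of t2 z] U_bounded[of t1 z] by (simp add: h_def)
      then show "\<bar>h z / e\<bar> \<le> (mass t2 + mass t1) / e" for z using e by (simp add: divide_right_mono)
    qed simp
    have i2: "integrable lborel (\<lambda>z. indicator {x..x + e} z * (h x / e))" by simp
    have "(\<lambda>z. indicator {x..x + e} z * ((h z - h x) / e)) =
        (\<lambda>z. indicator {x..x + e} z * (h z / e) - indicator {x..x + e} z * (h x / e))"
      by (rule ext) (simp only: diff_divide_distrib right_diff_distrib)
    then have "(LBINT z. indicator {x..x + e} z * ((h z - h x) / e)) =
        (LBINT z. indicator {x..x + e} z * (h z / e)) - (LBINT z. indicator {x..x + e} z * (h x / e))"
      by (simp only: Bochner_Integration.integral_diff[OF i1 i2])
    moreover have "(LBINT z. indicator {x..x + e} z * (h x / e)) = h x" using e by simp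
    ultimately show ?thesis by (simp only:)
  qed
  have 4: "(d / e) * (x + e - x) = d" using e by simp
  have "\<bar>h x\<bar> \<le> L * B * (t2 - t1) + d" using 1 2 3 4 by linarith
  then show "\<bar>U t2 x - U t1 x\<bar> \<le> L * B * (t2 - t1) + d" by (simp only: h_def)
qed

end

lemma antideriv_integral_zero:
  assumes "antideriv P p" "\<And>x. R < \<bar>x\<bar> \<Longrightarrow> P x = 0" "\<And>x. R < \<bar>x\<bar> \<Longrightarrow> p x = 0"
  shows "(LBINT x. p x) = 0"
proof -
  define r where "r = \<bar>R\<bar> + 1"
  have "P r - P (- r) = (LBINT z. indicator {- r..r} z * p z)"
    by (rule antiderivD(2)[OF assms(1)]) (simp add: r_def)
  moreover have "indicator {- r..r} z * p z = p z" for z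
    using assms(3)[of z] by (cases "R < \<bar>z\<bar>") (auto simp: r_def indicator_def)
  moreover have "P r = 0" "P (- r) = 0" by (auto intro!: assms(2) simp: r_def)
  ultimately show ?thesis by simp
qed

section \<open>The weight on the cone of dependence\<close>

locale affine_barrier = entropy_curve +
  fixes k A x0 R t1 T :: real
  assumes k: "k \<in> {-B..B}" and t1: "0 \<le> t1" and T: "0 \<le> T" and R: "0 < R"
begin

text \<open>\<open>ya\<close> and \<open>yb\<close> are both positive exactly on the cone of dependence \<open>\<bar>x - x0\<bar> < R - L (t - t1)\<close>; \<open>P\<close> is the
  primitive minus the affine solution, and \<open>ramp2 (A - P)\<close> is the weight \<open>\<beta>(D)\<close>.\<close>

definition "ya t x = R - L * (t - t1) - (x - x0)"
definition "yb t x = R - L * (t - t1) + (x - x0)"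
definition "P t x = U t x - k * x + f k * (t - t1)"
definition "G t x y = ramp2 (ya t x) * ramp2 (yb t x) * ramp2 (A - y)"
definition "Gx t x y = (2 * max 0 (ya t x) * (- 1) * ramp2 (yb t x) + ramp2 (ya t x) * (2 * max 0 (yb t x))) * ramp2 (A - y)"
definition "Gy t x y = ramp2 (ya t x) * ramp2 (yb t x) * (2 * max 0 (A - y) * (- 1))"
definition "Gt t x y = (2 * max 0 (ya t x) * (- L) * ramp2 (yb t x) + ramp2 (ya t x) * (2 * max 0 (yb t x) * (- L))) * ramp2 (A - y)"
definition "psi t x = G t x (P t x)"
definition "rho t x = Gx t x (P t x) + Gy t x (P t x) * (u t x - k)"

lemma antideriv_P: "antideriv (P t) (\<lambda>x. u t x - k)"
  unfolding antideriv_def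
proof (intro conjI allI impI exI[of _ "B + \<bar>k\<bar>"])
  fix x y :: real assume "x \<le> y"
  have "integrable lborel (\<lambda>z. indicator {x..y} z * u t z)"
    by (rule integrable_indicator_mult_abs[OF int]) simp
  moreover have "indicator {x..y} z * (u t z - k) = indicator {x..y} z * u t z - indicator {x..y} z * k" for z
    by (simp add: right_diff_distrib)
  ultimately have "(LBINT z. indicator {x..y} z * (u t z - k)) = (LBINT z. indicator {x..y} z * u t z) - (y - x) * k"
    using \<open>x \<le> y\<close> by (simp add: Bochner_Integration.integral_diff)
  then show "P t y - P t x = (LBINT z. indicator {x..y} z * (u t z - k))"
    using antiderivD(2)[OF antideriv_U \<open>x \<le> y\<close>, of t] by (simp add: P_def algebra_simps)
next
  fix x show "\<bar>u t x - k\<bar> \<le> B + \<bar>k\<bar>" using bound[of t x] by linarith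
qed auto

lemma P_continuous: "continuous_on UNIV (P t)" by (rule antideriv_continuous[OF antideriv_P])

lemma P_measurable [measurable]: "P t \<in> borel_measurable borel"
  by (rule borel_measurable_continuous_onI[OF P_continuous])

lemma y_measurable [measurable]: "ya t \<in> borel_measurable borel" "yb t \<in> borel_measurable borel"
  unfolding ya_def yb_def by measurable

lemma G_measurable [measurable]:
  "(\<lambda>x. G t x (P t x)) \<in> borel_measurable borel" "(\<lambda>x. Gx t x (P t x)) \<in> borel_measurable borel"
  "(\<lambda>x. Gy t x (P t x)) \<in> borel_measurable borel" "(\<lambda>x. Gt t x (P t x)) \<in> borel_measurable borel"
  unfolding G_def Gx_def Gy_def Gt_def by measurable

lemma G_derivative:
  "((\<lambda>q. G t (fst q) (snd q)) has_derivative (\<lambda>v. fst v * Gx t x y + snd v * Gy t x y)) (at (x, y))"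
  unfolding G_def Gx_def Gy_def ya_def yb_def
  by (auto intro!: derivative_eq_intros simp: algebra_simps)

lemma zero_outside:
  assumes "t1 \<le> t" "R \<le> \<bar>x - x0\<bar>"
  shows "G t x y = 0" "Gx t x y = 0" "Gy t x y = 0" "Gt t x y = 0"
proof -
  have "0 \<le> L * (t - t1)" using assms L_pos by simp
  then have "ya t x \<le> 0 \<or> yb t x \<le> 0" using assms(2) by (auto simp: ya_def yb_def abs_if split: if_splits)
  then show "G t x y = 0" "Gx t x y = 0" "Gy t x y = 0" "Gt t x y = 0"
    by (auto simp: G_def Gx_def Gy_def Gt_def ramp2_zero)
qed

lemma ramp_bounds:
  obtains N where "0 \<le> N" "\<And>t x. t \<in> {t1..t1 + T} \<Longrightarrow> \<bar>x - x0\<bar> \<le> R \<Longrightarrow>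
    \<bar>max 0 (ya t x)\<bar> \<le> N \<and> \<bar>max 0 (yb t x)\<bar> \<le> N \<and> \<bar>max 0 (A - P t x)\<bar> \<le> N"
proof -
  obtain V where V: "\<And>t. t \<in> {t1..t1 + T} \<Longrightarrow> mass t \<le> V" using mass_bounded by metis
  define N where "N = max (2 * R) (\<bar>A\<bar> + V + \<bar>k\<bar> * (\<bar>x0\<bar> + R) + \<bar>f k\<bar> * T)"
  have N: "2 * R \<le> N" "\<bar>A\<bar> + V + \<bar>k\<bar> * (\<bar>x0\<bar> + R) + \<bar>f k\<bar> * T \<le> N" by (auto simp: N_def)
  show ?thesis
  proof (rule that[of N])
    show "0 \<le> N" using N R by linarith
    fix t x assume t: "t \<in> {t1..t1 + T}" and x: "\<bar>x - x0\<bar> \<le> R"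
    have "0 \<le> L * (t - t1)" using t L_pos by simp
    then have "ya t x \<le> N" "yb t x \<le> N" using x N by (auto simp: ya_def yb_def)
    moreover have "A - P t x \<le> N"
    proof -
      have "\<bar>k * x\<bar> \<le> \<bar>k\<bar> * (\<bar>x0\<bar> + R)" unfolding abs_mult using x by (intro mult_left_mono) auto
      moreover have "\<bar>f k * (t - t1)\<bar> \<le> \<bar>f k\<bar> * T" unfolding abs_mult using t by (intro mult_left_mono) auto
      ultimately show ?thesis unfolding P_def using U_bounded[of t x] V[OF t] N(2) by linarith
    qed
    ultimately show "\<bar>max 0 (ya t x)\<bar> \<le> N \<and> \<bar>max 0 (yb t x)\<bar> \<le> N \<and> \<bar>max 0 (A - P t x)\<bar> \<le> N"
      using \<open>0 \<le> N\<close> by auto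
  qed
qed

lemma ramp2_le: "\<bar>max 0 y\<bar> \<le> N \<Longrightarrow> \<bar>ramp2 y\<bar> \<le> N\<^sup>2"
  unfolding ramp2_def power_abs by (rule power_mono) auto

lemma G_bounds:
  obtains H where "0 \<le> H" "\<And>t x. t \<in> {t1..t1 + T} \<Longrightarrow>
    \<bar>psi t x\<bar> \<le> H \<and> \<bar>Gx t x (P t x)\<bar> \<le> H \<and> \<bar>Gy t x (P t x)\<bar> \<le> H \<and> \<bar>Gt t x (P t x)\<bar> \<le> H"
proof -
  obtain N where N: "0 \<le> N" "\<And>t x. t \<in> {t1..t1 + T} \<Longrightarrow> \<bar>x - x0\<bar> \<le> R \<Longrightarrow>
    \<bar>max 0 (ya t x)\<bar> \<le> N \<and> \<bar>max 0 (yb t x)\<bar> \<le> N \<and> \<bar>max 0 (A - P t x)\<bar> \<le> N"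
    using ramp_bounds by blast
  define h1 where "h1 = N\<^sup>2 * N\<^sup>2 * N\<^sup>2"
  define h2 where "h2 = (2 * N * 1 * N\<^sup>2 + N\<^sup>2 * (2 * N)) * N\<^sup>2"
  define h3 where "h3 = N\<^sup>2 * N\<^sup>2 * (2 * N * 1)"
  define h4 where "h4 = (2 * N * L * N\<^sup>2 + N\<^sup>2 * (2 * N * L)) * N\<^sup>2"
  have nonneg: "0 \<le> h1" "0 \<le> h2" "0 \<le> h3" "0 \<le> h4"
    unfolding h1_def h2_def h3_def h4_def using N(1) L_pos by auto
  show ?thesis
  proof (rule that[of "h1 + h2 + h3 + h4"])
    show "0 \<le> h1 + h2 + h3 + h4" using nonneg by linarith
    fix t x assume t: "t \<in> {t1..t1 + T}"
    show "\<bar>psi t x\<bar> \<le> h1 + h2 + h3 + h4 \<and> \<bar>Gx t x (P t x)\<bar> \<le> h1 + h2 + h3 + h4 \<and>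
        \<bar>Gy t x (P t x)\<bar> \<le> h1 + h2 + h3 + h4 \<and> \<bar>Gt t x (P t x)\<bar> \<le> h1 + h2 + h3 + h4"
    proof (cases "\<bar>x - x0\<bar> \<le> R")
      case True
      have m: "\<bar>max 0 (ya t x)\<bar> \<le> N" "\<bar>max 0 (yb t x)\<bar> \<le> N" "\<bar>max 0 (A - P t x)\<bar> \<le> N"
        using N(2)[OF t True] by auto
      note r = m[THEN ramp2_le]
      have c: "\<bar>2::real\<bar> \<le> 2" "\<bar>- 1::real\<bar> \<le> 1" "\<bar>- L\<bar> \<le> L" using L_pos by auto
      have "\<bar>psi t x\<bar> \<le> h1" unfolding psi_def G_def h1_def by (intro abs_mult_le r)
      moreover have "\<bar>Gx t x (P t x)\<bar> \<le> h2" unfolding Gx_def h2_def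
        by (intro abs_mult_le r m c order_trans[OF abs_triangle_ineq] add_mono)
      moreover have "\<bar>Gy t x (P t x)\<bar> \<le> h3" unfolding Gy_def h3_def by (intro abs_mult_le r m c)
      moreover have "\<bar>Gt t x (P t x)\<bar> \<le> h4" unfolding Gt_def h4_def
        by (intro abs_mult_le r m c order_trans[OF abs_triangle_ineq] add_mono)
      ultimately show ?thesis using nonneg by auto
    next
      case False
      then show ?thesis using zero_outside[of t x "P t x"] t nonneg by (auto simp: psi_def)
    qed
  qed
qed

lemma antideriv_psi:
  assumes t: "t \<in> {t1..t1 + T}" shows "antideriv (psi t) (rho t)"
proof -
  have chain: "psi t b - psi t a = (LBINT z. indicator {a..b} z * rho t z)" if "a \<le> b" for a b
    unfolding psi_def rho_def
  proof (rule antideriv_chain[OF antideriv_P G_derivative _ _ that])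
    show "continuous_on UNIV (\<lambda>q. Gx t (fst q) (snd q))" "continuous_on UNIV (\<lambda>q. Gy t (fst q) (snd q))"
      unfolding Gx_def Gy_def ya_def yb_def by (intro continuous_intros)+
  qed
  obtain H where H: "0 \<le> H" "\<And>x. \<bar>Gx t x (P t x)\<bar> \<le> H \<and> \<bar>Gy t x (P t x)\<bar> \<le> H"
    using G_bounds t by metis
  have "\<bar>rho t x\<bar> \<le> H + H * (2 * B)" for x
  proof -
    have "\<bar>u t x - k\<bar> \<le> 2 * B" using u_range[of t x] k by auto
    then show ?thesis unfolding rho_def using H(2)[of x]
      by (intro order_trans[OF abs_triangle_ineq] add_mono abs_mult_le) auto
  qed
  moreover have "rho t \<in> borel_measurable borel" unfolding rho_def by measurable
  ultimately show ?thesis using chain unfolding antideriv_def by blast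
qed

lemma rho_outside: "t1 \<le> t \<Longrightarrow> \<bar>x0\<bar> + R < \<bar>x\<bar> \<Longrightarrow> rho t x = 0"
  using zero_outside[of t x] by (auto simp: rho_def)

lemma psi_outside: "t1 \<le> t \<Longrightarrow> \<bar>x0\<bar> + R < \<bar>x\<bar> \<Longrightarrow> psi t x = 0"
  using zero_outside[of t x] by (auto simp: psi_def)

lemma psi_nonneg: "0 \<le> psi t x"
  by (simp add: psi_def G_def ramp2_nonneg)

lemma fk_bound: "\<bar>f k\<bar> \<le> L * B"
proof -
  have "\<bar>f k - f 0\<bar> \<le> L * \<bar>k - 0\<bar>" using k B_pos by (intro f_lip) auto
  also have "\<dots> \<le> L * B" using k L_pos by (intro mult_left_mono) auto
  finally show ?thesis by (simp add: f_0)
qed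

text \<open>At a fixed \<open>x\<close> the arguments of the three ramps move by -L s, -L s and
  minus the increment of \<open>P\<close>, which is O(s) by the time-Lipschitz bound on
  \<open>U\<close>. The increment of \<open>U\<close> is kept as it stands instead of being replaced
  by a derivative, because the equation for \<open>U\<close> is available only in tested
  form.\<close>

lemma psi_taylor:
  obtains C where "0 \<le> C" "\<And>t s x. t1 \<le> t \<Longrightarrow> 0 \<le> s \<Longrightarrow> s \<le> 1 \<Longrightarrow> t + s \<le> t1 + T \<Longrightarrow>
    \<bar>psi (t + s) x - psi t x - (s * Gt t x (P t x) + Gy t x (P t x) * (U (t + s) x - U t x + s * f k))\<bar>
    \<le> C * s\<^sup>2 * indicator {x0 - R..x0 + R} x"
proof -
  obtain N where N: "0 \<le> N" "\<And>t x. t \<in> {t1..t1 + T} \<Longrightarrow> \<bar>x - x0\<bar> \<le> R \<Longrightarrow>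
    \<bar>max 0 (ya t x)\<bar> \<le> N \<and> \<bar>max 0 (yb t x)\<bar> \<le> N \<and> \<bar>max 0 (A - P t x)\<bar> \<le> N"
    using ramp_bounds by blast
  \<comment> \<open>\<open>W\<close> bounds the speeds of all three ramp arguments; \<open>M\<close>
    bounds at once the values N^2, the first-order terms 2 N W and the Taylor remainders
    W^2.\<close>
  define W where "W = L + 2 * L * B"
  define M where "M = N\<^sup>2 + 2 * N * W + W\<^sup>2"
  have W: "0 \<le> W" "L \<le> W" "2 * L * B \<le> W" using L_pos B_pos by (auto simp: W_def)
  have M: "N\<^sup>2 \<le> M" "2 * N * W \<le> M" "W\<^sup>2 \<le> M" "0 \<le> M" using N(1) W(1) by (auto simp: M_def)
  show ?thesis
  proof (rule that[of "9 * M ^ 3"])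
    show "0 \<le> 9 * M ^ 3" using M by simp
    fix t s x assume t: "t1 \<le> t" "0 \<le> s" "s \<le> 1" "t + s \<le> t1 + T"
    show "\<bar>psi (t + s) x - psi t x - (s * Gt t x (P t x) + Gy t x (P t x) * (U (t + s) x - U t x + s * f k))\<bar>
      \<le> 9 * M ^ 3 * s\<^sup>2 * indicator {x0 - R..x0 + R} x"
    proof (cases "\<bar>x - x0\<bar> \<le> R")
      case True
      define D where "D = U (t + s) x - U t x + s * f k"
      have D: "\<bar>D\<bar> \<le> W * s"
      proof -
        have "\<bar>U (t + s) x - U t x\<bar> \<le> L * B * (t + s - t)" using t t1 by (intro U_time_lipschitz) auto
        moreover have "\<bar>s * f k\<bar> \<le> s * (L * B)" unfolding abs_mult using fk_bound t by (intro mult_mono) auto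
        moreover have "(2 * L * B) * s = L * B * (t + s - t) + s * (L * B)" by (simp add: algebra_simps)
        ultimately have "\<bar>D\<bar> \<le> (2 * L * B) * s" unfolding D_def by linarith
        also have "\<dots> \<le> W * s" using W t by (intro mult_right_mono) auto
        finally show ?thesis .
      qed
      have Ls: "\<bar>- (L * s)\<bar> \<le> W * s" using W t L_pos by (simp add: abs_mult mult_right_mono)
      have tt: "t \<in> {t1..t1 + T}" "t + s \<in> {t1..t1 + T}" using t by auto
      note m = N(2)[OF tt(1) True, THEN conjunct1] N(2)[OF tt(1) True, THEN conjunct2, THEN conjunct1]
        N(2)[OF tt(1) True, THEN conjunct2, THEN conjunct2]
      note m' = N(2)[OF tt(2) True, THEN conjunct2, THEN conjunct1]
        N(2)[OF tt(2) True, THEN conjunct2, THEN conjunct2]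
      have sq: "h\<^sup>2 \<le> M * s\<^sup>2" if "\<bar>h\<bar> \<le> W * s" for h
      proof -
        have "h\<^sup>2 \<le> (W * s)\<^sup>2" using that W t by (intro abs_le_square_iff[THEN iffD1]) auto
        also have "\<dots> \<le> M * s\<^sup>2" using M by (simp add: power_mult_distrib mult_right_mono)
        finally show ?thesis .
      qed
      have ln: "\<bar>2 * max 0 y * h\<bar> \<le> M * s" if "\<bar>max 0 y\<bar> \<le> N" "\<bar>h\<bar> \<le> W * s" for y h
      proof -
        have "\<bar>2 * max 0 y * h\<bar> \<le> 2 * N * (W * s)" by (intro abs_mult_le that) simp
        also have "\<dots> \<le> M * s" using M t by (simp add: mult.assoc[symmetric] mult_right_mono)
        finally show ?thesis .
      qed
      have ty: "\<bar>ramp2 (y + h) - ramp2 y - 2 * max 0 y * h\<bar> \<le> M * s\<^sup>2" if "\<bar>h\<bar> \<le> W * s" for y h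
        using ramp2_taylor sq[OF that] by (rule order_trans)
      have rb: "\<bar>ramp2 y\<bar> \<le> M" if "\<bar>max 0 y\<bar> \<le> N" for y
        using ramp2_le[OF that] M(1) by (rule order_trans)
      have e: "ya (t + s) x = ya t x + - (L * s)" "yb (t + s) x = yb t x + - (L * s)"
        "A - P (t + s) x = (A - P t x) + - D"
        by (auto simp: ya_def yb_def P_def D_def algebra_simps)
      have "\<bar>ramp2 (ya (t + s) x) * ramp2 (yb (t + s) x) * ramp2 (A - P (t + s) x)
          - ramp2 (ya t x) * ramp2 (yb t x) * ramp2 (A - P t x)
          - ((2 * max 0 (ya t x) * - (L * s)) * ramp2 (yb t x) * ramp2 (A - P t x)
            + ramp2 (ya t x) * (2 * max 0 (yb t x) * - (L * s)) * ramp2 (A - P t x)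
            + ramp2 (ya t x) * ramp2 (yb t x) * (2 * max 0 (A - P t x) * - D))\<bar> \<le> 9 * M ^ 3 * s\<^sup>2"
      proof (rule prod3_taylor)
        show "\<bar>ramp2 (ya (t + s) x) - ramp2 (ya t x) - 2 * max 0 (ya t x) * - (L * s)\<bar> \<le> M * s\<^sup>2"
          unfolding e by (rule ty[OF Ls])
        show "\<bar>ramp2 (yb (t + s) x) - ramp2 (yb t x) - 2 * max 0 (yb t x) * - (L * s)\<bar> \<le> M * s\<^sup>2"
          unfolding e by (rule ty[OF Ls])
        show "\<bar>ramp2 (A - P (t + s) x) - ramp2 (A - P t x) - 2 * max 0 (A - P t x) * - D\<bar> \<le> M * s\<^sup>2"
          unfolding e(3) by (rule ty) (use D in simp)
        show "\<bar>2 * max 0 (ya t x) * - (L * s)\<bar> \<le> M * s" by (rule ln[OF m(1) Ls])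
        show "\<bar>2 * max 0 (yb t x) * - (L * s)\<bar> \<le> M * s" by (rule ln[OF m(2) Ls])
        show "\<bar>2 * max 0 (A - P t x) * - D\<bar> \<le> M * s" by (rule ln[OF m(3)]) (use D in simp)
        show "\<bar>ramp2 (ya t x)\<bar> \<le> M" by (rule rb[OF m(1)])
        show "\<bar>ramp2 (yb t x)\<bar> \<le> M" by (rule rb[OF m(2)])
        show "\<bar>ramp2 (yb (t + s) x)\<bar> \<le> M" by (rule rb[OF m'(1)])
        show "\<bar>ramp2 (A - P (t + s) x)\<bar> \<le> M" by (rule rb[OF m'(2)])
      qed (use t in auto)
      moreover have "(2 * max 0 (ya t x) * - (L * s)) * ramp2 (yb t x) * ramp2 (A - P t x)
            + ramp2 (ya t x) * (2 * max 0 (yb t x) * - (L * s)) * ramp2 (A - P t x)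
            + ramp2 (ya t x) * ramp2 (yb t x) * (2 * max 0 (A - P t x) * - D)
          = s * Gt t x (P t x) + Gy t x (P t x) * D"
        by (simp add: Gt_def Gy_def algebra_simps)
      moreover have "indicator {x0 - R..x0 + R} x = (1::real)" using True by (auto simp: abs_le_iff)
      ultimately show ?thesis by (simp add: psi_def G_def D_def)
    next
      case False
      then show ?thesis using zero_outside[of t x] zero_outside[of "t + s" x] t M
        by (auto simp: psi_def indicator_def)
    qed
  qed
qed

end

definition bcs :: "(real \<Rightarrow> real) \<Rightarrow> bool" where
  "bcs g \<longleftrightarrow> g \<in> borel_measurable borel \<and> (\<exists>K. \<forall>x. \<bar>g x\<bar> \<le> K) \<and> (\<exists>R. \<forall>x. R < \<bar>x\<bar> \<longrightarrow> g x = 0)"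

lemma bcs_integrable: "bcs g \<Longrightarrow> integrable lborel g"
  unfolding bcs_def using integrable_compact_support by blast

lemma bcs_mult:
  assumes "bcs g" "h \<in> borel_measurable borel" "\<And>x. \<bar>h x\<bar> \<le> C"
  shows "bcs (\<lambda>x. h x * g x)"
proof -
  obtain K R where g: "g \<in> borel_measurable borel" "\<And>x. \<bar>g x\<bar> \<le> K" "\<And>x. R < \<bar>x\<bar> \<Longrightarrow> g x = 0"
    using assms(1) unfolding bcs_def by blast
  have "\<bar>h x * g x\<bar> \<le> C * K" for x by (intro abs_mult_le assms g)
  moreover have "R < \<bar>x\<bar> \<Longrightarrow> h x * g x = 0" for x using g(3) by simp
  ultimately show ?thesis unfolding bcs_def using g(1) assms(2) by (auto intro!: borel_measurable_times)
qed

lemma continuous_nonneg_integral_zero: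
  fixes g :: "real \<Rightarrow> real"
  assumes "continuous_on UNIV g" "\<And>x. 0 \<le> g x" "integrable lborel g" "(LBINT x. g x) \<le> 0"
  shows "g x = 0"
proof (rule ccontr)
  assume "g x \<noteq> 0"
  have "(LBINT x. g x) = 0" using assms(2,4) by (intro antisym) (auto intro: integral_nonneg_AE)
  then have "AE x in lborel. g x = 0"
    using integral_nonneg_eq_0_iff_AE[OF assms(3)] assms(2) by auto
  then have "AE x in lebesgue. g x = 0" by (rule AE_completion)
  moreover have op: "open {x. g x \<noteq> 0}"
    by (rule open_Collect_neq[OF assms(1) continuous_on_const])
  ultimately have "negligible {x. g x \<noteq> 0}"
    using AE_iff_null[of lebesgue "\<lambda>x. g x = 0"] by (simp add: negligible_iff_null_sets borel_open)
  then show False using op \<open>g x \<noteq> 0\<close> open_not_negligible by blast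
qed

text \<open>A one-sided derivative bound which is uniform in \<open>t\<close>, since \<open>\<omega>\<close> can be taken to be the modulus of
  continuity of the curve on \<open>[a, b]\<close>.\<close>

lemma (in L1_curve) dini_nonincreasing:
  fixes F :: "real \<Rightarrow> real"
  assumes "0 \<le> C" "a \<le> b"
    and step: "\<And>t s \<omega>. a \<le> t \<Longrightarrow> 0 \<le> s \<Longrightarrow> s \<le> 1 \<Longrightarrow> t + s \<le> b \<Longrightarrow> 0 \<le> \<omega> \<Longrightarrow>
      (\<And>r. r \<in> {t..t + s} \<Longrightarrow> dst r t \<le> \<omega>) \<Longrightarrow> F (t + s) - F t \<le> C * s * (\<omega> + s)"
  shows "F b \<le> F a"
proof -
  have "F b \<le> F a + e * (b - a)" if "0 < e" for e
  proof -
    \<comment> \<open>Steps shorter than \<omega> satisfy \<omega> + s \<le> 2 \<omega>, and 2 C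
      \<omega> \<le> e, so the error accumulates at rate at most \<open>e\<close>.\<close>
    define \<omega> where "\<omega> = e / (2 * (C + 1))"
    have \<omega>: "0 < \<omega>" using assms(1) that by (simp add: \<omega>_def)
    obtain d where d: "0 < d" "\<forall>s\<in>{a..b}. \<forall>t\<in>{a..b}. \<bar>s - t\<bar> < d \<longrightarrow> dst s t < \<omega>"
      using dst_uniform[OF \<omega>] by blast
    show ?thesis
    proof (rule step_induct[where Q = "\<lambda>t c. F t \<le> c" and d = "min d (min 1 \<omega>)"])
      fix t s c assume t: "a \<le> t" "0 \<le> s" "s < min d (min 1 \<omega>)" "t + s \<le> b" "F t \<le> c"
      have "F (t + s) - F t \<le> C * s * (\<omega> + s)"
      proof (rule step)
        fix r assume "r \<in> {t..t + s}"
        then have "dst r t < \<omega>" using d(2) t by auto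
        then show "dst r t \<le> \<omega>" by simp
      qed (use t \<omega> in auto)
      also have "\<dots> \<le> C * s * (2 * \<omega>)" using t assms(1) by (intro mult_left_mono) auto
      also have "\<dots> = (C * (2 * \<omega>)) * s" by simp
      also have "\<dots> \<le> e * s"
      proof (rule mult_right_mono)
        show "C * (2 * \<omega>) \<le> e" using assms(1) that by (simp add: \<omega>_def field_simps)
      qed (use t in auto)
      finally show "F (t + s) \<le> c + e * s" using t by linarith
    qed (use assms(2) d \<omega> in auto)
  qed
  then have "\<forall>\<^sub>F e in at_right 0. F b \<le> F a + e * (b - a)"
    by (auto simp: eventually_at_right_field intro: exI[of _ 1])
  moreover have "((\<lambda>e. F a + e * (b - a)) \<longlongrightarrow> F a + 0 * (b - a)) (at_right 0)"
    by (intro tendsto_intros)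
  ultimately have "F b \<le> F a + 0 * (b - a)" by (intro tendsto_lowerbound) auto
  then show ?thesis by simp
qed

section \<open>The weighted integrals do not increase\<close>

context affine_barrier begin

text \<open>\<open>Phi = 0\<close> gives \<open>u = k\<close> wherever \<open>P < A\<close> in the cone; there \<open>P\<close> does not move, so that \<open>Psi\<close> does not
  increase either.\<close>

definition "Phi t = (LBINT x. \<bar>u t x - k\<bar> * psi t x)"
definition "Psi t = (LBINT x. psi t x)"

lemma uk_bound: "\<bar>\<bar>u t x - k\<bar>\<bar> \<le> 2 * B" using u_range[of t x] k by auto

lemma psi_measurable [measurable]: "psi t \<in> borel_measurable borel"
  unfolding psi_def by measurable

lemma rho_measurable [measurable]: "rho t \<in> borel_measurable borel"
  unfolding rho_def by measurable

lemma bcs_all: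
  assumes t: "t \<in> {t1..t1 + T}"
  shows "bcs (psi t)" "bcs (\<lambda>x. Gy t x (P t x))" "bcs (rho t)"
proof -
  obtain H where H: "\<And>x. \<bar>psi t x\<bar> \<le> H" "\<And>x. \<bar>Gy t x (P t x)\<bar> \<le> H" using G_bounds t by metis
  have z: "\<bar>x0\<bar> + R < \<bar>x\<bar> \<Longrightarrow> Gy t x y = 0" for x y using zero_outside[of t x] t by auto
  have zp: "\<bar>x0\<bar> + R < \<bar>x\<bar> \<Longrightarrow> psi t x = 0" "\<bar>x0\<bar> + R < \<bar>x\<bar> \<Longrightarrow> rho t x = 0" for x
    using psi_outside[of t x] rho_outside[of t x] t by auto
  show "bcs (psi t)" unfolding bcs_def using H(1) zp(1) by auto
  show "bcs (\<lambda>x. Gy t x (P t x))" unfolding bcs_def using H(2) z by auto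
  show "bcs (rho t)" unfolding bcs_def using antideriv_psi[OF t] zp(2) unfolding antideriv_def by blast
qed

text \<open>Both sides of the cone move inwards at speed \<open>L\<close>, so the time derivative of
  each side ramp is -L times the modulus of its space derivative. This is finite speed of
  propagation: whatever flows through the sides is paid for by the shrinking of the cone.\<close>

lemma Gx_le: "L * \<bar>Gx t x y\<bar> \<le> - Gt t x y"
proof -
  have "\<bar>Gx t x y\<bar> \<le> (2 * max 0 (ya t x) * ramp2 (yb t x) + ramp2 (ya t x) * (2 * max 0 (yb t x))) * ramp2 (A - y)"
  proof -
    have nn: "0 \<le> 2 * max 0 (ya t x) * ramp2 (yb t x)" "0 \<le> ramp2 (ya t x) * (2 * max 0 (yb t x))"
      using ramp2_nonneg by auto
    have "Gx t x y = (ramp2 (ya t x) * (2 * max 0 (yb t x)) - 2 * max 0 (ya t x) * ramp2 (yb t x)) * ramp2 (A - y)"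
      by (simp add: Gx_def)
    moreover have "\<bar>q - p\<bar> \<le> p + q" if "0 \<le> p" "0 \<le> q" for p q :: real using that by linarith
    from abs_mult_le[OF this[OF nn], of "ramp2 (A - y)" "ramp2 (A - y)"]
    have "\<bar>(ramp2 (ya t x) * (2 * max 0 (yb t x)) - 2 * max 0 (ya t x) * ramp2 (yb t x)) * ramp2 (A - y)\<bar>
      \<le> (2 * max 0 (ya t x) * ramp2 (yb t x) + ramp2 (ya t x) * (2 * max 0 (yb t x))) * ramp2 (A - y)"
      using ramp2_nonneg[of "A - y"] by simp
    ultimately show ?thesis by (simp only:)
  qed
  then have "L * \<bar>Gx t x y\<bar> \<le> L * ((2 * max 0 (ya t x) * ramp2 (yb t x) + ramp2 (ya t x) * (2 * max 0 (yb t x))) * ramp2 (A - y))"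
    using L_pos by (intro mult_left_mono) auto
  also have "\<dots> = - Gt t x y" by (simp add: Gt_def algebra_simps)
  finally show ?thesis .
qed

text \<open>\<open>a\<close> and \<open>c\<close> are the values of the curve at the old and the new
  time. The \<open>gy\<close> part of the entropy flux is |a - k| (f a - f k) gy. The motion of the
  weight contributes |c - k| (f k - f a) gy once the increment of \<open>U\<close> is traded for -s
  f(a). The two cancel up to |c - a|, and the remaining main terms, flux through the sides and
  shrinking of the cone, have a nonpositive sum.\<close>

lemma barrier_pointwise:
  fixes a c gx gy gt d\<psi> dU \<epsilon> H s :: real
  assumes "\<bar>d\<psi> - (s * gt + gy * (dU + s * f k))\<bar> \<le> \<epsilon>" "\<bar>c - k\<bar> \<le> 2 * B" "a \<in> {-B..B}" "0 \<le> s"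
    "L * \<bar>gx\<bar> \<le> - gt" "\<bar>gt\<bar> \<le> H" "\<bar>gy\<bar> \<le> H"
  shows "s * (sgn (a - k) * (f a - f k) * (gx + gy * (a - k))) + \<bar>c - k\<bar> * d\<psi> - dU * (\<bar>c - k\<bar> * gy) - s * (f a * (\<bar>c - k\<bar> * gy))
    \<le> s * (H + H * (2 * L * B)) * \<bar>c - a\<bar> + 2 * B * \<epsilon>"
proof -
  have H: "0 \<le> H" using assms(6) by linarith
  have fa: "\<bar>f a - f k\<bar> \<le> L * \<bar>a - k\<bar>" using f_lip[OF assms(3) k] .
  have fa2: "\<bar>f k - f a\<bar> \<le> 2 * L * B"
  proof -
    have "\<bar>a - k\<bar> \<le> 2 * B" using assms(3) k by auto
    then have "L * \<bar>a - k\<bar> \<le> L * (2 * B)" using L_pos by (intro mult_left_mono) auto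
    then show ?thesis using fa by (simp add: abs_minus_commute)
  qed
  have e0: "\<bar>c - k\<bar> * (d\<psi> - (s * gt + gy * (dU + s * f k))) \<le> (2 * B) * \<epsilon>"
    using abs_mult_le[of "\<bar>c - k\<bar>" "2 * B" "d\<psi> - (s * gt + gy * (dU + s * f k))" \<epsilon>] assms(1,2) by auto
  have e1: "sgn (a - k) * (f a - f k) * gx + \<bar>a - k\<bar> * gt \<le> 0"
  proof -
    have "\<bar>(sgn (a - k) * (f a - f k)) * gx\<bar> \<le> (L * \<bar>a - k\<bar>) * \<bar>gx\<bar>"
    proof (rule abs_mult_le)
      show "\<bar>sgn (a - k) * (f a - f k)\<bar> \<le> L * \<bar>a - k\<bar>"
        using fa by (cases "a = k") (auto simp: abs_mult sgn_real_def)
    qed simp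
    also have "\<dots> \<le> \<bar>a - k\<bar> * (- gt)"
      using mult_left_mono[OF assms(5), of "\<bar>a - k\<bar>"] by (simp add: mult_ac)
    finally show ?thesis by linarith
  qed
  have e2: "(\<bar>c - k\<bar> - \<bar>a - k\<bar>) * (gt + gy * (f k - f a)) \<le> \<bar>c - a\<bar> * (H + H * (2 * L * B))"
  proof -
    have "\<bar>gt + gy * (f k - f a)\<bar> \<le> H + H * (2 * L * B)"
      by (intro order_trans[OF abs_triangle_ineq] add_mono assms abs_mult_le fa2)
    moreover have "\<bar>\<bar>c - k\<bar> - \<bar>a - k\<bar>\<bar> \<le> \<bar>c - a\<bar>" by linarith
    ultimately show ?thesis using abs_mult_le abs_le_D1 by blast
  qed
  have sg: "sgn (a - k) * (a - k) = \<bar>a - k\<bar>" by (simp add: sgn_real_def)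
  have "s * (sgn (a - k) * (f a - f k) * (gx + gy * (a - k))) + \<bar>c - k\<bar> * d\<psi> - dU * (\<bar>c - k\<bar> * gy) - s * (f a * (\<bar>c - k\<bar> * gy))
    = \<bar>c - k\<bar> * (d\<psi> - (s * gt + gy * (dU + s * f k)))
      + s * (sgn (a - k) * (f a - f k) * gx + (sgn (a - k) * (a - k)) * (f a - f k) * gy + \<bar>c - k\<bar> * (gt + gy * (f k - f a)))"
    by (simp add: algebra_simps)
  also have "\<dots> = \<bar>c - k\<bar> * (d\<psi> - (s * gt + gy * (dU + s * f k)))
      + s * ((sgn (a - k) * (f a - f k) * gx + \<bar>a - k\<bar> * gt) + (\<bar>c - k\<bar> - \<bar>a - k\<bar>) * (gt + gy * (f k - f a)))"
    unfolding sg by (simp add: algebra_simps)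
  also have "\<dots> \<le> 2 * B * \<epsilon> + s * (\<bar>c - a\<bar> * (H + H * (2 * L * B)))"
    using e0 e1 e2 assms(4) by (intro add_mono mult_left_mono) auto
  finally show ?thesis by (simp add: algebra_simps)
qed

lemma Phi_step:
  obtains C where "0 \<le> C" "\<And>t s \<omega>. t1 \<le> t \<Longrightarrow> 0 \<le> s \<Longrightarrow> s \<le> 1 \<Longrightarrow> t + s \<le> t1 + T \<Longrightarrow> 0 \<le> \<omega> \<Longrightarrow>
    (\<And>r. r \<in> {t..t + s} \<Longrightarrow> dst r t \<le> \<omega>) \<Longrightarrow> Phi (t + s) - Phi t \<le> C * s * (\<omega> + s)"
proof -
  obtain H where H: "0 \<le> H" "\<And>t x. t \<in> {t1..t1 + T} \<Longrightarrow>
    \<bar>psi t x\<bar> \<le> H \<and> \<bar>Gx t x (P t x)\<bar> \<le> H \<and> \<bar>Gy t x (P t x)\<bar> \<le> H \<and> \<bar>Gt t x (P t x)\<bar> \<le> H"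
    using G_bounds by blast
  obtain C0 where C0: "0 \<le> C0" "\<And>t s x. t1 \<le> t \<Longrightarrow> 0 \<le> s \<Longrightarrow> s \<le> 1 \<Longrightarrow> t + s \<le> t1 + T \<Longrightarrow>
    \<bar>psi (t + s) x - psi t x - (s * Gt t x (P t x) + Gy t x (P t x) * (U (t + s) x - U t x + s * f k))\<bar>
    \<le> C0 * s\<^sup>2 * indicator {x0 - R..x0 + R} x"
    using psi_taylor by blast
  \<comment> \<open>\<open>Kr\<close> bounds \<open>rho\<close>. \<open>J\<close> gathers the
    coefficients of s \<omega>: from freezing the entropy flux, from freezing the equation for
    \<open>U\<close>, and from exchanging the new value of the curve for the old one. The last
    summand of \<open>C\<close> is the Taylor error on an interval of length 2 R, weighted by |u -
    k| \<le> 2 B.\<close>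
  define Kr where "Kr = H + H * (2 * B)"
  define J where "J = (1 + L) * Kr + L * (2 * B * H) + (H + H * (2 * L * B))"
  define C where "C = J + 4 * B * C0 * R"
  have Kr: "0 \<le> Kr" using H(1) B_pos by (simp add: Kr_def)
  have J: "0 \<le> J" using Kr H(1) L_pos B_pos by (auto simp: J_def)
  have C: "0 \<le> C" "J \<le> C" "4 * B * C0 * R \<le> C" using J C0(1) B_pos R by (auto simp: C_def)
  show ?thesis
  proof (rule that[OF C(1)])
    fix t s \<omega> assume t: "t1 \<le> t" "0 \<le> s" "s \<le> 1" "t + s \<le> t1 + T" and \<omega>: "0 \<le> \<omega>"
      "\<And>r. r \<in> {t..t + s} \<Longrightarrow> dst r t \<le> \<omega>"
    have tt: "t \<in> {t1..t1 + T}" "t + s \<in> {t1..t1 + T}" "0 \<le> t" "t \<le> t + s" using t t1 by auto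
    note b = bcs_all[OF tt(1)] bcs_all[OF tt(2)]
    define c where "c x = \<bar>u (t + s) x - k\<bar>" for x
    define a where "a x = \<bar>u t x - k\<bar>" for x
    define Q where "Q x = sgn (u t x - k) * (f (u t x) - f k)" for x
    define gy where "gy x = Gy t x (P t x)" for x
    define dU where "dU x = U (t + s) x - U t x" for x
    have [measurable]: "c \<in> borel_measurable borel" "a \<in> borel_measurable borel" "Q \<in> borel_measurable borel"
      "gy \<in> borel_measurable borel" "dU \<in> borel_measurable borel"
      unfolding c_def a_def Q_def gy_def dU_def by measurable
    have cb: "\<bar>c x\<bar> \<le> 2 * B" "\<bar>a x\<bar> \<le> 2 * B" for x unfolding c_def a_def by (rule uk_bound)+
    have Qb: "\<bar>Q x\<bar> \<le> 2 * (L * B)" for x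
      using f_bound[of t x] fk_bound by (auto simp: Q_def abs_mult sgn_real_def)
    have fb: "\<bar>f (u t x)\<bar> \<le> L * B" for x by (rule f_bound)
    have dUb: "\<bar>dU x\<bar> \<le> mass (t + s) + mass t" for x
      using U_bounded[of "t + s" x] U_bounded[of t x] by (simp add: dU_def)
    have bgy: "bcs gy" using b(2) by (simp add: gy_def[abs_def])
    have b1: "bcs (\<lambda>x. c x * psi t x)" "bcs (\<lambda>x. a x * psi t x)" "bcs (\<lambda>x. c x * psi (t + s) x)"
      "bcs (\<lambda>x. Q x * rho t x)" "bcs (\<lambda>x. c x * gy x)"
      by (rule bcs_mult[OF b(1) _ cb(1)] bcs_mult[OF b(1) _ cb(2)] bcs_mult[OF b(4) _ cb(1)]
          bcs_mult[OF b(3) _ Qb] bcs_mult[OF bgy _ cb(1)]; simp)+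
    have b2: "bcs (\<lambda>x. dU x * (c x * gy x))" "bcs (\<lambda>x. f (u t x) * (c x * gy x))"
      by (rule bcs_mult[OF b1(5) _ dUb] bcs_mult[OF b1(5) _ fb]; simp)+
    note i = b1[THEN bcs_integrable] b2[THEN bcs_integrable]
    have bk: "bcs (\<lambda>x. \<bar>k\<bar> * psi t x)" by (intro bcs_mult[where C = "\<bar>k\<bar>"] b) auto
    have bk': "bcs (\<lambda>x. (sgn (- k) * (f 0 - f k)) * rho t x)" by (intro bcs_mult b) auto
    have rb: "\<bar>rho t x\<bar> \<le> Kr" for x
      unfolding rho_def Kr_def using H(2)[OF tt(1), of x] uk_bound[of t x]
      by (intro order_trans[OF abs_triangle_ineq] add_mono abs_mult_le) auto
    have E1: "(LBINT x. kru_eta k (u (t + s) x) * psi t x) - (LBINT x. kru_eta k (u t x) * psi t x)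
      \<le> ((LBINT x. kru_flux f k (u t x) * rho t x) + (1 + L) * Kr * \<omega>) * (t + s - t)"
      by (rule kru_step[OF k antideriv_psi[OF tt(1)] rho_outside[OF t(1)] psi_nonneg rb tt(3,4) \<omega>(2)])
    have e1: "(LBINT x. kru_eta k (u r x) * psi t x) = (LBINT x. \<bar>u r x - k\<bar> * psi t x) - (LBINT x. \<bar>k\<bar> * psi t x)"
      if "bcs (\<lambda>x. \<bar>u r x - k\<bar> * psi t x)" for r
      unfolding kru_eta_def left_diff_distrib
      by (rule Bochner_Integration.integral_diff[OF bcs_integrable[OF that] bcs_integrable[OF bk]])
    have e2: "(LBINT x. kru_flux f k (u t x) * rho t x) = (LBINT x. Q x * rho t x)"
    proof -
      have "(LBINT x. kru_flux f k (u t x) * rho t x) = (LBINT x. Q x * rho t x) - (LBINT x. (sgn (- k) * (f 0 - f k)) * rho t x)"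
        unfolding kru_flux_def Q_def left_diff_distrib[of "sgn (u t _ - k) * _"]
        by (rule Bochner_Integration.integral_diff)
          (use i(4) bcs_integrable[OF bk'] in \<open>simp_all add: Q_def\<close>)
      \<comment> \<open>The constant that normalises \<open>kru_flux\<close> drops out because
        \<open>rho\<close> is the derivative of a compactly supported function.\<close>
      moreover have "(LBINT x. rho t x) = 0"
        by (rule antideriv_integral_zero[OF antideriv_psi[OF tt(1)] psi_outside[OF t(1)] rho_outside[OF t(1)]])
      ultimately show ?thesis by simp
    qed
    have E1': "(LBINT x. c x * psi t x) - (LBINT x. a x * psi t x) \<le> s * (LBINT x. Q x * rho t x) + s * ((1 + L) * Kr * \<omega>)"
      using E1 e1[of "t + s"] e1[of t] b1(1,2) unfolding e2 c_def a_def by (simp add: algebra_simps)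
    \<comment> \<open>The weight contains the curve at the later time t + s, because the increment
      of \<open>psi\<close> is multiplied by |u(t + s) - k|. \<open>U_step\<close> accepts this: for
      it the weight is just a fixed bounded Borel function of \<open>x\<close> with bounded
      support.\<close>
    have E2: "\<bar>(LBINT x. dU x * (c x * gy x)) + s * (LBINT x. f (u t x) * (c x * gy x))\<bar> \<le> s * (L * (2 * B * H) * \<omega>)"
    proof -
      have cg: "\<bar>c x * gy x\<bar> \<le> 2 * B * H" for x
        unfolding gy_def using H(2)[OF tt(1), of x] by (intro abs_mult_le cb) auto
      have cg0: "\<bar>x0\<bar> + R < \<bar>x\<bar> \<Longrightarrow> c x * gy x = 0" for x
        unfolding gy_def using zero_outside(3)[OF t(1), of x] by auto
      have "\<bar>(LBINT x. (U (t + s) x - U t x) * (c x * gy x)) + (t + s - t) * (LBINT x. f (u t x) * (c x * gy x))\<bar>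
        \<le> (t + s - t) * (L * (2 * B * H) * \<omega>)"
      proof (rule U_step[OF _ cg cg0 tt(3,4)])
        fix r assume r: "r \<in> {t..t + s}"
        have "\<bar>(LBINT x. f (u r x) * (c x * gy x)) - (LBINT x. f (u t x) * (c x * gy x))\<bar> \<le> L * (2 * B * H) * dst r t"
          by (rule lip0_integral_diff[OF lip0_f _ cg]) simp
        also have "\<dots> \<le> L * (2 * B * H) * \<omega>"
          using \<omega>(2)[OF r] L_pos B_pos H(1) by (intro mult_left_mono) auto
        finally show "\<bar>(LBINT x. f (u r x) * (c x * gy x)) - (LBINT x. f (u t x) * (c x * gy x))\<bar> \<le> L * (2 * B * H) * \<omega>" .
      qed simp
      then show ?thesis by (simp add: dU_def)
    qed
    have main: "s * (LBINT x. Q x * rho t x) + ((LBINT x. c x * psi (t + s) x) - (LBINT x. c x * psi t x))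
        - (LBINT x. dU x * (c x * gy x)) - s * (LBINT x. f (u t x) * (c x * gy x))
      \<le> s * (H + H * (2 * L * B)) * dst (t + s) t + 2 * B * (C0 * s\<^sup>2) * (2 * R)"
    proof -
      have "(LBINT x. s * (Q x * rho t x) + (c x * psi (t + s) x - c x * psi t x) - dU x * (c x * gy x) - s * (f (u t x) * (c x * gy x)))
        \<le> (LBINT x. s * (H + H * (2 * L * B)) * \<bar>u (t + s) x - u t x\<bar> + 2 * B * (C0 * s\<^sup>2) * indicator {x0 - R..x0 + R} x)"
      proof (rule integral_mono)
        fix x
        have "s * (sgn (u t x - k) * (f (u t x) - f k) * (Gx t x (P t x) + Gy t x (P t x) * (u t x - k)))
            + \<bar>u (t + s) x - k\<bar> * (psi (t + s) x - psi t x)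
            - (U (t + s) x - U t x) * (\<bar>u (t + s) x - k\<bar> * Gy t x (P t x))
            - s * (f (u t x) * (\<bar>u (t + s) x - k\<bar> * Gy t x (P t x)))
          \<le> s * (H + H * (2 * L * B)) * \<bar>u (t + s) x - u t x\<bar> + 2 * B * (C0 * s\<^sup>2 * indicator {x0 - R..x0 + R} x)"
          by (rule barrier_pointwise[OF C0(2)[OF t]])
            (use uk_bound[of "t + s" x] u_range[of t x] t Gx_le H(2)[OF tt(1), of x] in auto)
        then show "s * (Q x * rho t x) + (c x * psi (t + s) x - c x * psi t x) - dU x * (c x * gy x) - s * (f (u t x) * (c x * gy x))
          \<le> s * (H + H * (2 * L * B)) * \<bar>u (t + s) x - u t x\<bar> + 2 * B * (C0 * s\<^sup>2) * indicator {x0 - R..x0 + R} x"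
          unfolding Q_def rho_def c_def dU_def gy_def by (simp only: right_diff_distrib mult.assoc)
      qed (use i in \<open>intro Bochner_Integration.integrable_add Bochner_Integration.integrable_diff
            integrable_mult_right dst_integrable integrable_indicator_Icc; simp\<close>)+
      also have "\<dots> = s * (H + H * (2 * L * B)) * dst (t + s) t + 2 * B * (C0 * s\<^sup>2) * (2 * R)"
        using R by (subst Bochner_Integration.integral_add) (auto intro!: dst_integrable simp: dst_def)
      also have "(LBINT x. s * (Q x * rho t x) + (c x * psi (t + s) x - c x * psi t x) - dU x * (c x * gy x) - s * (f (u t x) * (c x * gy x)))
        = s * (LBINT x. Q x * rho t x) + ((LBINT x. c x * psi (t + s) x) - (LBINT x. c x * psi t x))
        - (LBINT x. dU x * (c x * gy x)) - s * (LBINT x. f (u t x) * (c x * gy x))"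
        using i by simp
      finally show ?thesis .
    qed
    have "Phi (t + s) - Phi t = ((LBINT x. c x * psi (t + s) x) - (LBINT x. c x * psi t x)) + ((LBINT x. c x * psi t x) - (LBINT x. a x * psi t x))"
      by (simp add: Phi_def c_def a_def)
    also have "\<dots> \<le> s * ((1 + L) * Kr * \<omega>) + s * (L * (2 * B * H) * \<omega>) + s * (H + H * (2 * L * B)) * dst (t + s) t + 2 * B * (C0 * s\<^sup>2) * (2 * R)"
      using E1' E2 main by linarith
    also have "\<dots> \<le> s * ((1 + L) * Kr * \<omega>) + s * (L * (2 * B * H) * \<omega>) + s * (H + H * (2 * L * B)) * \<omega> + 2 * B * (C0 * s\<^sup>2) * (2 * R)"
      using \<omega>(2)[of "t + s"] t H(1) L_pos B_pos Kr C0(1) by (intro add_mono mult_left_mono) auto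
    also have "\<dots> = J * s * \<omega> + (4 * B * C0 * R) * s * s" by (simp add: J_def power2_eq_square algebra_simps)
    also have "\<dots> \<le> C * s * \<omega> + C * s * s"
      using C t \<omega>(1) by (intro add_mono mult_right_mono) auto
    finally show "Phi (t + s) - Phi t \<le> C * s * (\<omega> + s)" by (simp add: algebra_simps)
  qed
qed

lemma Phi_zero:
  assumes start: "\<And>x. psi t1 x = 0" and t: "t \<in> {t1..t1 + T}"
  shows "AE x in lborel. psi t x = 0 \<or> u t x = k"
proof -
  obtain C where C: "0 \<le> C" "\<And>t s \<omega>. t1 \<le> t \<Longrightarrow> 0 \<le> s \<Longrightarrow> s \<le> 1 \<Longrightarrow> t + s \<le> t1 + T \<Longrightarrow> 0 \<le> \<omega> \<Longrightarrow>
    (\<And>r. r \<in> {t..t + s} \<Longrightarrow> dst r t \<le> \<omega>) \<Longrightarrow> Phi (t + s) - Phi t \<le> C * s * (\<omega> + s)"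
    using Phi_step by blast
  have "Phi t \<le> Phi t1"
    by (rule dini_nonincreasing[OF C(1)]) (use t in \<open>auto intro!: C(2)\<close>)
  then have le: "Phi t \<le> 0" by (simp add: Phi_def start)
  have nn: "0 \<le> \<bar>u t x - k\<bar> * psi t x" for x using psi_nonneg by simp
  have i: "integrable lborel (\<lambda>x. \<bar>u t x - k\<bar> * psi t x)"
    by (rule bcs_integrable[OF bcs_mult[OF bcs_all(1)[OF t] _ uk_bound]]) simp
  have "(LBINT x. \<bar>u t x - k\<bar> * psi t x) = 0"
    using le nn by (intro antisym) (auto simp: Phi_def intro: integral_nonneg_AE)
  then have "AE x in lborel. \<bar>u t x - k\<bar> * psi t x = 0"
    using integral_nonneg_eq_0_iff_AE[OF i] nn by auto
  then show ?thesis by eventually_elim auto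
qed

lemma psi_zero_Gy: "psi t x = 0 \<Longrightarrow> Gy t x (P t x) = 0"
  using ramp2_pos[of "ya t x"] ramp2_pos[of "yb t x"] ramp2_pos[of "A - P t x"]
    ramp2_zero[of "ya t x"] ramp2_zero[of "yb t x"]
  by (fastforce simp: psi_def G_def Gy_def)

lemma Psi_step:
  assumes start: "\<And>x. psi t1 x = 0"
  obtains C where "0 \<le> C" "\<And>t s \<omega>. t1 \<le> t \<Longrightarrow> 0 \<le> s \<Longrightarrow> s \<le> 1 \<Longrightarrow> t + s \<le> t1 + T \<Longrightarrow> 0 \<le> \<omega> \<Longrightarrow>
    (\<And>r. r \<in> {t..t + s} \<Longrightarrow> dst r t \<le> \<omega>) \<Longrightarrow> Psi (t + s) - Psi t \<le> C * s * (\<omega> + s)"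
proof -
  obtain H where H: "0 \<le> H" "\<And>t x. t \<in> {t1..t1 + T} \<Longrightarrow>
    \<bar>psi t x\<bar> \<le> H \<and> \<bar>Gx t x (P t x)\<bar> \<le> H \<and> \<bar>Gy t x (P t x)\<bar> \<le> H \<and> \<bar>Gt t x (P t x)\<bar> \<le> H"
    using G_bounds by blast
  obtain C0 where C0: "0 \<le> C0" "\<And>t s x. t1 \<le> t \<Longrightarrow> 0 \<le> s \<Longrightarrow> s \<le> 1 \<Longrightarrow> t + s \<le> t1 + T \<Longrightarrow>
    \<bar>psi (t + s) x - psi t x - (s * Gt t x (P t x) + Gy t x (P t x) * (U (t + s) x - U t x + s * f k))\<bar>
    \<le> C0 * s\<^sup>2 * indicator {x0 - R..x0 + R} x"
    using psi_taylor by blast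
  define C where "C = L * H + C0 * (2 * R)"
  have C: "0 \<le> C" "L * H \<le> C" "C0 * (2 * R) \<le> C" using H(1) C0(1) L_pos R by (auto simp: C_def)
  show ?thesis
  proof (rule that[OF C(1)])
    fix t s \<omega> assume t: "t1 \<le> t" "0 \<le> s" "s \<le> 1" "t + s \<le> t1 + T" and \<omega>: "0 \<le> \<omega>"
      "\<And>r. r \<in> {t..t + s} \<Longrightarrow> dst r t \<le> \<omega>"
    have tt: "t \<in> {t1..t1 + T}" "t + s \<in> {t1..t1 + T}" "0 \<le> t" "t \<le> t + s" using t t1 by auto
    note b = bcs_all[OF tt(1)] bcs_all[OF tt(2)]
    define gy where "gy x = Gy t x (P t x)" for x
    define dU where "dU x = U (t + s) x - U t x" for x
    have [measurable]: "gy \<in> borel_measurable borel" "dU \<in> borel_measurable borel"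
      unfolding gy_def dU_def by measurable
    have dUb: "\<bar>dU x\<bar> \<le> mass (t + s) + mass t" for x
      using U_bounded[of "t + s" x] U_bounded[of t x] by (simp add: dU_def)
    have bgy: "bcs gy" using b(2) by (simp add: gy_def[abs_def])
    have b2: "bcs (\<lambda>x. dU x * gy x)" "bcs (\<lambda>x. f (u t x) * gy x)"
      by (rule bcs_mult[OF bgy _ dUb] bcs_mult[OF bgy _ f_bound]; simp)+
    note i = b(1,4)[THEN bcs_integrable] b2[THEN bcs_integrable]
    have E2: "\<bar>(LBINT x. dU x * gy x) + s * (LBINT x. f (u t x) * gy x)\<bar> \<le> s * (L * H * \<omega>)"
    proof -
      have cg: "\<bar>gy x\<bar> \<le> H" for x
        unfolding gy_def using H(2)[OF tt(1), of x] by auto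
      have cg0: "\<bar>x0\<bar> + R < \<bar>x\<bar> \<Longrightarrow> gy x = 0" for x
        unfolding gy_def using zero_outside(3)[OF t(1), of x] by auto
      have "\<bar>(LBINT x. (U (t + s) x - U t x) * gy x) + (t + s - t) * (LBINT x. f (u t x) * gy x)\<bar>
        \<le> (t + s - t) * (L * H * \<omega>)"
      proof (rule U_step[OF _ cg cg0 tt(3,4)])
        fix r assume r: "r \<in> {t..t + s}"
        have "\<bar>(LBINT x. f (u r x) * gy x) - (LBINT x. f (u t x) * gy x)\<bar> \<le> L * H * dst r t"
          by (rule lip0_integral_diff[OF lip0_f _ cg]) simp
        also have "\<dots> \<le> L * H * \<omega>"
          using \<omega>(2)[OF r] L_pos H(1) by (intro mult_left_mono) auto
        finally show "\<bar>(LBINT x. f (u r x) * gy x) - (LBINT x. f (u t x) * gy x)\<bar> \<le> L * H * \<omega>" .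
      qed simp
      then show ?thesis by (simp add: dU_def)
    qed
    have "(LBINT x. psi (t + s) x - psi t x - dU x * gy x - s * (f (u t x) * gy x))
        \<le> (LBINT x. C0 * s\<^sup>2 * indicator {x0 - R..x0 + R} x)"
    proof (rule integral_mono_AE)
      show "AE x in lborel. psi (t + s) x - psi t x - dU x * gy x - s * (f (u t x) * gy x)
        \<le> C0 * s\<^sup>2 * indicator {x0 - R..x0 + R} x"
        using Phi_zero[OF start tt(1)]
      proof eventually_elim
        case (elim x)
        \<comment> \<open>Where \<open>gy\<close> is nonzero so is \<open>psi\<close>, and there u =
          k by \<open>Phi_zero\<close>. The barrier speed f(k) may thus be replaced by the actual
          flux f(u), which cancels against the motion of \<open>U\<close>.\<close>
        have "gy x * (s * f k) = s * (f (u t x) * gy x)"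
          using elim psi_zero_Gy[of t x] by (auto simp: gy_def)
        moreover have "s * Gt t x (P t x) \<le> 0"
        proof -
          have "0 \<le> L * \<bar>Gx t x (P t x)\<bar>" using L_pos by simp
          then have "Gt t x (P t x) \<le> 0" using Gx_le[of t x "P t x"] by linarith
          then show ?thesis using t by (simp add: mult_nonneg_nonpos)
        qed
        moreover have "gy x * (dU x + s * f k) = dU x * gy x + gy x * (s * f k)" by (simp add: algebra_simps)
        ultimately show ?case using C0(2)[OF t, of x] unfolding gy_def dU_def by linarith
      qed
    qed (use i in \<open>intro Bochner_Integration.integrable_diff integrable_mult_right integrable_indicator_Icc; simp\<close>)+
    also have "(LBINT x. psi (t + s) x - psi t x - dU x * gy x - s * (f (u t x) * gy x))
      = Psi (t + s) - Psi t - (LBINT x. dU x * gy x) - s * (LBINT x. f (u t x) * gy x)"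
      using i by (simp add: Psi_def)
    finally have "Psi (t + s) - Psi t \<le> s * (L * H * \<omega>) + C0 * s\<^sup>2 * (2 * R)"
      using E2 R by simp
    also have "\<dots> = (L * H) * (s * \<omega>) + (C0 * (2 * R)) * (s * s)" by (simp add: power2_eq_square algebra_simps)
    also have "\<dots> \<le> C * (s * \<omega>) + C * (s * s)"
      using C t \<omega>(1) by (intro add_mono mult_right_mono) auto
    finally show "Psi (t + s) - Psi t \<le> C * s * (\<omega> + s)" by (simp add: algebra_simps)
  qed
qed

lemma affine_lower_bound:
  assumes start: "\<And>x. \<bar>x - x0\<bar> \<le> R \<Longrightarrow> A + k * x \<le> U t1 x" and x: "\<bar>x - x0\<bar> < R - L * T"
  shows "A + k * x - f k * T \<le> U (t1 + T) x"
proof -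
  have s0: "psi t1 x = 0" for x
  proof (cases "\<bar>x - x0\<bar> \<le> R")
    case True
    then have "A - P t1 x \<le> 0" using start[of x] by (simp add: P_def)
    then show ?thesis by (simp add: psi_def G_def ramp2_zero)
  qed (use zero_outside(1)[of t1 x] in \<open>auto simp: psi_def\<close>)
  obtain C where C: "0 \<le> C" "\<And>t s \<omega>. t1 \<le> t \<Longrightarrow> 0 \<le> s \<Longrightarrow> s \<le> 1 \<Longrightarrow> t + s \<le> t1 + T \<Longrightarrow> 0 \<le> \<omega> \<Longrightarrow>
    (\<And>r. r \<in> {t..t + s} \<Longrightarrow> dst r t \<le> \<omega>) \<Longrightarrow> Psi (t + s) - Psi t \<le> C * s * (\<omega> + s)"
    using Psi_step[OF s0] by blast
  have "Psi (t1 + T) \<le> Psi t1"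
    by (rule dini_nonincreasing[OF C(1)]) (use T in \<open>auto intro!: C(2)\<close>)
  then have "(LBINT x. psi (t1 + T) x) \<le> 0" by (simp add: Psi_def s0)
  moreover have tt: "t1 + T \<in> {t1..t1 + T}" using T by simp
  \<comment> \<open>Continuity in \<open>x\<close> upgrades the vanishing integral to every point;
    inside the shrunken cone the two side ramps are positive, so the third one must vanish.\<close>
  ultimately have "psi (t1 + T) x = 0"
    by (intro continuous_nonneg_integral_zero antideriv_continuous[OF antideriv_psi[OF tt]] psi_nonneg
        bcs_integrable bcs_all(1)[OF tt])
  moreover have "0 < ramp2 (ya (t1 + T) x)" "0 < ramp2 (yb (t1 + T) x)"
    using x by (auto intro!: ramp2_pos simp: ya_def yb_def)
  ultimately have "ramp2 (A - P (t1 + T) x) = 0" by (simp add: psi_def G_def)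
  then have "A - P (t1 + T) x \<le> 0" using ramp2_pos[of "A - P (t1 + T) x"] by linarith
  then show ?thesis by (simp add: P_def)
qed

end

section \<open>Comparison of primitives\<close>

lemma (in entropy_curve) affine_lower:
  assumes "k \<in> {-B..B}" "0 \<le> t1" "0 \<le> T" "0 < R"
    and "\<And>x. \<bar>x - x0\<bar> \<le> R \<Longrightarrow> A + k * x \<le> U t1 x" "\<bar>x - x0\<bar> < R - L * T"
  shows "A + k * x - f k * T \<le> U (t1 + T) x"
proof -
  interpret affine_barrier u B f L k A x0 R t1 T
    using assms by unfold_locales auto
  show ?thesis using assms by (intro affine_lower_bound)
qed

section \<open>Averaged primitives as subsolutions\<close>

locale monotone_curve = entropy_curve +
  fixes M \<epsilon> :: real
  assumes M: "0 \<le> M" "M \<le> B" and \<epsilon>: "0 < \<epsilon>"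
    and range: "\<And>t. 0 \<le> t \<Longrightarrow> AE x in lborel. 0 \<le> u t x \<and> u t x \<le> M"
begin

text \<open>The window lies to the right of \<open>x\<close>, so the average of a nondecreasing
  \<open>U\<close> lies above it and exceeds it by at most M \<epsilon>. \<open>slope\<close> is the
  derivative of \<open>avg\<close> and at the same time the mean of \<open>u\<close> over the
  window.\<close>

definition "avg t x = (1 / \<epsilon>) * (LBINT z. indicator {x..x + \<epsilon>} z * U t z)"
definition "slope t x = (U t (x + \<epsilon>) - U t x) / \<epsilon>"

lemma U_increment:
  assumes "0 \<le> t" "x \<le> y" shows "0 \<le> U t y - U t x" "U t y - U t x \<le> M * (y - x)"
proof -
  have i: "integrable lborel (\<lambda>z. indicator {x..y} z * u t z)"
    by (rule integrable_indicator_mult_abs[OF int]) simp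
  have e: "U t y - U t x = (LBINT z. indicator {x..y} z * u t z)"
    by (rule antiderivD(2)[OF antideriv_U assms(2)])
  show "0 \<le> U t y - U t x" unfolding e
    by (rule integral_nonneg_AE) (use range[OF assms(1)] in eventually_elim, auto simp: indicator_def)
  have "(LBINT z. indicator {x..y} z * u t z) \<le> (LBINT z. indicator {x..y} z * M)"
    by (rule integral_mono_AE[OF i])
      (use range[OF assms(1)] in \<open>simp, eventually_elim, auto simp: indicator_def\<close>)
  then show "U t y - U t x \<le> M * (y - x)" unfolding e using assms(2) by (simp add: mult.commute)
qed

lemma slope_range: "0 \<le> t \<Longrightarrow> 0 \<le> slope t x \<and> slope t x \<le> M"
  using U_increment[of t x "x + \<epsilon>"] \<epsilon> by (auto simp: slope_def field_simps)

lemma avg_deriv: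
  obtains V where "\<And>x. (V has_real_derivative U t x) (at x)" "\<And>x. avg t x = (V (x + \<epsilon>) - V x) / \<epsilon>"
proof -
  have "\<exists>F. \<forall>x::real. - \<infinity> < ereal x \<longrightarrow> ereal x < \<infinity> \<longrightarrow> (F has_vector_derivative U t x) (at x)"
    using U_continuous[of t]
    by (intro einterval_antiderivative) (auto simp: continuous_on_eq_continuous_at)
  then obtain V where V: "\<And>x. (V has_real_derivative U t x) (at x)"
    by (auto simp: has_real_derivative_iff_has_vector_derivative)
  have "(LBINT z. indicator {x..x + \<epsilon>} z *\<^sub>R U t z) = V (x + \<epsilon>) - V x" for x
    using V \<epsilon> continuous_on_subset[OF U_continuous, of "{x..x + \<epsilon>}" t]
    by (intro integral_FTC_Icc)
      (auto intro: has_field_derivative_at_within simp: has_real_derivative_iff_has_vector_derivative[symmetric])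
  then show ?thesis using that[OF V] by (simp add: avg_def)
qed

lemma avg_bounds: assumes "0 \<le> t" shows "U t x \<le> avg t x" "avg t x \<le> U t x + M * \<epsilon>"
proof -
  have iU: "integrable lborel (\<lambda>z. indicator {x..x + \<epsilon>} z * U t z)"
    by (rule integrable_indicator_bounded[OF _ U_bounded]) simp
  have 1: "U t x \<le> U t z" "U t z \<le> U t x + M * \<epsilon>" if "z \<in> {x..x + \<epsilon>}" for z
  proof -
    have "M * (z - x) \<le> M * \<epsilon>" using that M by (intro mult_left_mono) auto
    then show "U t x \<le> U t z" "U t z \<le> U t x + M * \<epsilon>"
      using U_increment[OF assms, of x z] that by auto
  qed
  have "(LBINT z. indicator {x..x + \<epsilon>} z * U t x) \<le> (LBINT z. indicator {x..x + \<epsilon>} z * U t z)"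
  proof (rule integral_mono[OF _ iU])
    show "indicator {x..x + \<epsilon>} z * U t x \<le> indicator {x..x + \<epsilon>} z * U t z" for z
      using 1 by (auto simp: indicator_def)
  qed simp
  then show "U t x \<le> avg t x" using \<epsilon> by (simp add: avg_def field_simps)
  have "(LBINT z. indicator {x..x + \<epsilon>} z * U t z) \<le> (LBINT z. indicator {x..x + \<epsilon>} z * (U t x + M * \<epsilon>))"
  proof (rule integral_mono[OF iU])
    show "indicator {x..x + \<epsilon>} z * U t z \<le> indicator {x..x + \<epsilon>} z * (U t x + M * \<epsilon>)" for z
      using 1 by (auto simp: indicator_def)
  qed simp
  then show "avg t x \<le> U t x + M * \<epsilon>" using \<epsilon> by (simp add: avg_def field_simps)
qed

lemma slope_lipschitz: assumes "0 \<le> t" shows "\<bar>slope t y - slope t x\<bar> \<le> M / \<epsilon> * \<bar>y - x\<bar>"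
proof -
  have *: "\<bar>slope t y - slope t x\<bar> \<le> M / \<epsilon> * (y - x)" if "x \<le> y" for x y
  proof -
    have "\<bar>(U t (y + \<epsilon>) - U t (x + \<epsilon>)) - (U t y - U t x)\<bar> \<le> M * (y - x)"
      using U_increment[OF assms, of "x + \<epsilon>" "y + \<epsilon>"] U_increment[OF assms that] that by auto
    then have "\<bar>(U t (y + \<epsilon>) - U t (x + \<epsilon>)) - (U t y - U t x)\<bar> / \<epsilon> \<le> M * (y - x) / \<epsilon>"
      using \<epsilon> by (intro divide_right_mono) auto
    moreover have "slope t y - slope t x = ((U t (y + \<epsilon>) - U t (x + \<epsilon>)) - (U t y - U t x)) / \<epsilon>"
      by (simp add: slope_def diff_divide_distrib)
    ultimately show ?thesis using \<epsilon> by simp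
  qed
  show ?thesis using *[of x y] *[of y x] by (cases "x \<le> y") (auto simp: abs_minus_commute)
qed

text \<open>The derivative of \<open>avg\<close> is a difference quotient of \<open>U\<close> over
  the fixed width \<epsilon>, hence Lipschitz with constant M / \<epsilon>; the mean value theorem
  turns this into a parabola touching from below.\<close>

lemma avg_parabola:
  assumes "0 \<le> t"
  shows "avg t x + slope t x * (y - x) - M / \<epsilon> * (y - x)\<^sup>2 \<le> avg t y"
proof -
  obtain V where V: "\<And>x. (V has_real_derivative U t x) (at x)" "\<And>x. avg t x = (V (x + \<epsilon>) - V x) / \<epsilon>"
    using avg_deriv by blast
  have d: "(avg t has_real_derivative slope t x) (at x)" for x
    unfolding V(2)[abs_def] slope_def
    by (rule DERIV_cdivide[OF DERIV_diff[OF _ V(1)]])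
      (use DERIV_shift[of V "U t (x + \<epsilon>)" x \<epsilon>] V(1) in simp)
  obtain \<xi> where \<xi>: "\<bar>\<xi> - x\<bar> \<le> \<bar>y - x\<bar>" "avg t y - avg t x = (y - x) * slope t \<xi>"
  proof (cases x y rule: linorder_cases)
    case less
    from MVT2[OF this, of "avg t" "slope t"] d show ?thesis using that by force
  next
    case greater
    from MVT2[OF this, of "avg t" "slope t"] d obtain z where "y < z" "z < x" "avg t x - avg t y = (x - y) * slope t z" by auto
    then show ?thesis using that[of z] by (simp add: algebra_simps)
  qed (use that in auto)
  have "\<bar>(y - x) * (slope t \<xi> - slope t x)\<bar> \<le> \<bar>y - x\<bar> * (M / \<epsilon> * \<bar>y - x\<bar>)"
  proof (rule abs_mult_le)
    have "\<bar>slope t \<xi> - slope t x\<bar> \<le> M / \<epsilon> * \<bar>\<xi> - x\<bar>" by (rule slope_lipschitz[OF assms])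
    also have "\<dots> \<le> M / \<epsilon> * \<bar>y - x\<bar>" using \<xi>(1) M \<epsilon> by (intro mult_left_mono) auto
    finally show "\<bar>slope t \<xi> - slope t x\<bar> \<le> M / \<epsilon> * \<bar>y - x\<bar>" .
  qed simp
  also have "\<dots> = M / \<epsilon> * (y - x)\<^sup>2" by (simp add: power2_eq_square)
  finally have "- (M / \<epsilon> * (y - x)\<^sup>2) \<le> (y - x) * (slope t \<xi> - slope t x)" by linarith
  then show ?thesis using \<xi>(2) by (simp add: algebra_simps)
qed

text \<open>Jensen's inequality turns the averaged equation for \<open>U\<close> into a differential inequality for the average.\<close>

lemma avg_subsolution:
  assumes "0 \<le> t" "0 \<le> s" and tangent: "\<And>y. y \<in> {0..M} \<Longrightarrow> g (slope t x) + q * (y - slope t x) \<le> f y"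
    and \<omega>: "\<And>r. r \<in> {t..t + s} \<Longrightarrow> dst r t \<le> \<omega>"
  shows "avg (t + s) x \<le> avg t x - s * g (slope t x) + s * (L * \<omega> / \<epsilon>)"
proof -
  let ?z = "slope t x"
  have iU: "integrable lborel (\<lambda>z. indicator {x..x + \<epsilon>} z * U r z)" for r
    by (rule integrable_indicator_bounded[OF _ U_bounded]) simp
  have iu: "integrable lborel (\<lambda>z. indicator {x..x + \<epsilon>} z * u t z)"
    by (rule integrable_indicator_mult_abs[OF int]) simp
  have if': "integrable lborel (\<lambda>z. indicator {x..x + \<epsilon>} z * f (u t z))"
    by (rule integrable_indicator_bounded[OF _ f_bound]) simp
  \<comment> \<open>\<open>slope t x\<close> is the mean of \<open>u\<close> over the window, so the
    term with \<open>q\<close> integrates to zero. An affine minorant at this one slope replaces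
    convexity, which lets \<open>g\<close> differ from the flux \<open>f\<close>.\<close>
  have "(LBINT z. indicator {x..x + \<epsilon>} z * (g ?z - q * ?z) + q * (indicator {x..x + \<epsilon>} z * u t z))
    \<le> (LBINT z. indicator {x..x + \<epsilon>} z * f (u t z))"
  proof (rule integral_mono_AE[OF _ if'])
    show "AE z in lborel. indicator {x..x + \<epsilon>} z * (g ?z - q * ?z) + q * (indicator {x..x + \<epsilon>} z * u t z)
      \<le> indicator {x..x + \<epsilon>} z * f (u t z)"
      using range[OF assms(1)]
    proof eventually_elim
      case (elim z)
      then show ?case using tangent[of "u t z"] by (auto simp: indicator_def algebra_simps)
    qed
  qed (use iu in \<open>intro Bochner_Integration.integrable_add integrable_mult_right; simp\<close>)
  also have "(LBINT z. indicator {x..x + \<epsilon>} z * (g ?z - q * ?z) + q * (indicator {x..x + \<epsilon>} z * u t z))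
    = \<epsilon> * (g ?z - q * ?z) + q * (U t (x + \<epsilon>) - U t x)"
    using iu \<epsilon> antiderivD(2)[OF antideriv_U, of x "x + \<epsilon>" t]
    by (subst Bochner_Integration.integral_add) auto
  also have "\<dots> = \<epsilon> * g ?z" using \<epsilon> by (simp add: slope_def field_simps)
  finally have jensen: "\<epsilon> * g ?z \<le> (LBINT z. indicator {x..x + \<epsilon>} z * f (u t z))" .
  have "\<bar>(LBINT z. indicator {x..x + \<epsilon>} z * (U (t + s) z - U t z)) + (t + s - t) * (LBINT z. indicator {x..x + \<epsilon>} z * f (u t z))\<bar>
    \<le> (t + s - t) * (L * \<omega>)"
    by (rule box_step[OF \<epsilon>]) (use assms in auto)
  moreover have "(LBINT z. indicator {x..x + \<epsilon>} z * (U (t + s) z - U t z)) = \<epsilon> * avg (t + s) x - \<epsilon> * avg t x"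
    unfolding right_diff_distrib using Bochner_Integration.integral_diff[OF iU iU] \<epsilon> by (simp add: avg_def)
  moreover have "s * (\<epsilon> * g ?z) \<le> s * (LBINT z. indicator {x..x + \<epsilon>} z * f (u t z))"
    using jensen assms(2) by (rule mult_left_mono)
  ultimately have "\<epsilon> * avg (t + s) x \<le> \<epsilon> * avg t x - s * (\<epsilon> * g ?z) + s * (L * \<omega>)" by simp
  also have "\<dots> = \<epsilon> * (avg t x - s * g ?z + s * (L * \<omega> / \<epsilon>))" using \<epsilon> by (simp add: field_simps)
  finally show ?thesis using \<epsilon> by simp
qed

end

text \<open>The flux \<open>f\<close> mediates: it lies below \<open>f1\<close> through affine
  minorants, which survive averaging, and \<open>f2\<close> lies below f + c z. At each point the
  average dominates an affine function with the local slope k up to a small error, and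
  \<open>affine_lower\<close> propagates that function under \<open>w\<close>. The excess c k of the
  flux is compensated by reading the affine function at a point shifted by c s, where it is larger
  by k c s.\<close>

theorem primitive_comparison:
  assumes u: "entropy_curve u B f1 L" and w: "entropy_curve w B f2 L"
    and M: "0 \<le> M" "M \<le> B" and range: "\<And>t. 0 \<le> t \<Longrightarrow> AE x in lborel. 0 \<le> u t x \<and> u t x \<le> M"
    and tangent: "\<And>z. z \<in> {0..M} \<Longrightarrow> \<exists>q. \<forall>y\<in>{0..M}. f z + q * (y - z) \<le> f1 y"
    and flux: "\<And>z. z \<in> {0..M} \<Longrightarrow> f2 z \<le> f z + c * z" and c: "0 \<le> c"
    and init: "\<And>x. L1_curve.U u 0 x \<le> L1_curve.U w 0 (x + a)" and t: "0 \<le> t"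
  shows "L1_curve.U u t x \<le> L1_curve.U w t (x + a + c * t)"
proof -
  interpret u: entropy_curve u B f1 L by (rule u)
  interpret w: entropy_curve w B f2 L by (rule w)
  have approx: "u.U t x \<le> w.U t (x + a + c * t) + (M * \<epsilon> + \<epsilon> * t)" if \<epsilon>: "0 < \<epsilon>" for \<epsilon>
  proof -
    interpret m: monotone_curve u B f1 L M \<epsilon>
      using M \<epsilon> range by unfold_locales auto
    define K where "K = M / \<epsilon> * (L + c + 1)\<^sup>2"
    have K: "0 \<le> K" using M \<epsilon> by (simp add: K_def)
    \<comment> \<open>Chosen so that the error L \<omega> / \<epsilon> of the averaged equation is
      \<epsilon> / 2. The bound on the step size makes the parabola error K s^2 at most s \<epsilon>
      / 2; together they give the rate \<epsilon> for \<open>step_induct\<close>.\<close>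
    define \<omega> where "\<omega> = \<epsilon> * \<epsilon> / (2 * L)"
    have \<omega>: "0 < \<omega>" "L * \<omega> / \<epsilon> = \<epsilon> / 2" using \<epsilon> u.L_pos by (auto simp: \<omega>_def)
    obtain d0 where d0: "0 < d0" "\<forall>s\<in>{0..t}. \<forall>r\<in>{0..t}. \<bar>s - r\<bar> < d0 \<longrightarrow> u.dst s r < \<omega>"
      using u.dst_uniform[OF \<omega>(1)] by blast
    define d where "d = min d0 (\<epsilon> / (2 * (K + 1)))"
    have d: "0 < d" using d0 \<epsilon> K by (simp add: d_def)
    have "\<forall>x. m.avg t x \<le> w.U t (x + a + c * t) + (M * \<epsilon> + \<epsilon> * (t - 0))"
    proof (rule step_induct[where Q = "\<lambda>t e. \<forall>x. m.avg t x \<le> w.U t (x + a + c * t) + e" and d = d])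
      show "\<forall>x. m.avg 0 x \<le> w.U 0 (x + a + c * 0) + M * \<epsilon>"
      proof
        fix x show "m.avg 0 x \<le> w.U 0 (x + a + c * 0) + M * \<epsilon>"
          using m.avg_bounds(2)[of 0 x] init[of x] by simp
      qed
    next
      fix r s e assume r: "0 \<le> r" "0 \<le> s" "s < d" "r + s \<le> t"
        and IH: "\<forall>x. m.avg r x \<le> w.U r (x + a + c * r) + e"
      show "\<forall>x. m.avg (r + s) x \<le> w.U (r + s) (x + a + c * (r + s)) + (e + \<epsilon> * s)"
      proof (cases "s = 0")
        case False
        then have s: "0 < s" using r by simp
        show ?thesis
        proof
          fix x
          let ?k = "m.slope r x"
          have k: "0 \<le> ?k" "?k \<le> M" using m.slope_range[OF r(1)] by auto
          obtain q where q: "\<And>y. y \<in> {0..M} \<Longrightarrow> f ?k + q * (y - ?k) \<le> f1 y"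
            using tangent[of ?k] k by fastforce
          have sub: "m.avg (r + s) x \<le> m.avg r x - s * f ?k + s * (\<epsilon> / 2)"
          proof -
            have "m.avg (r + s) x \<le> m.avg r x - s * f ?k + s * (L * \<omega> / \<epsilon>)"
            proof (rule m.avg_subsolution[OF r(1,2), where g = f and q = q])
              show "f ?k + q * (y - ?k) \<le> f1 y" if "y \<in> {0..M}" for y by (rule q[OF that])
              fix r' assume "r' \<in> {r..r + s}"
              then have "u.dst r' r < \<omega>" using d0(2) r by (auto simp: d_def)
              then show "u.dst r' r \<le> \<omega>" by simp
            qed
            then show ?thesis by (simp only: \<omega>(2))
          qed
          define X where "X = x + a + c * r"
          \<comment> \<open>R - L s = (c + 1) s, so the shifted point X + c s is still inside the
            cone of dependence at the end of the step.\<close>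
          define R where "R = (L + c + 1) * s"
          \<comment> \<open>Lowering by the depth of the parabola at distance \<open>R\<close> puts
            the affine function below it on the whole base of the cone.\<close>
          define A where "A = m.avg r x - e - M / \<epsilon> * R\<^sup>2 - ?k * X"
          have "A + ?k * (X + c * s) - f2 ?k * s \<le> w.U (r + s) (X + c * s)"
          proof (rule w.affine_lower)
            show "0 < R" using s c u.L_pos by (simp add: R_def)
            show "?k \<in> {-B..B}" using k M by auto
            show "\<bar>X + c * s - X\<bar> < R - L * s" using s c by (simp add: R_def algebra_simps)
            fix y assume y: "\<bar>y - X\<bar> \<le> R"
            have "m.avg r x + ?k * (x + (y - X) - x) - M / \<epsilon> * (x + (y - X) - x)\<^sup>2 \<le> m.avg r (x + (y - X))"
              by (rule m.avg_parabola[OF r(1)])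
            also have "\<dots> \<le> w.U r (x + (y - X) + a + c * r) + e" using IH by blast
            also have "x + (y - X) + a + c * r = y" by (simp add: X_def)
            finally have "m.avg r x + ?k * (y - X) - M / \<epsilon> * (y - X)\<^sup>2 \<le> w.U r y + e" by simp
            moreover have "M / \<epsilon> * (y - X)\<^sup>2 \<le> M / \<epsilon> * R\<^sup>2"
              using M \<epsilon> y by (intro mult_left_mono abs_le_square_iff[THEN iffD1]) auto
            ultimately show "A + ?k * y \<le> w.U r y" by (simp add: A_def algebra_simps)
          qed (use r in auto)
          moreover have "f2 ?k * s \<le> (f ?k + c * ?k) * s" using flux[of ?k] k r by (intro mult_right_mono) auto
          moreover have "M / \<epsilon> * R\<^sup>2 \<le> s * (\<epsilon> / 2)"
          proof -
            have "M / \<epsilon> * R\<^sup>2 = (K * s) * s" by (simp add: R_def K_def power_mult_distrib power2_eq_square)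
            also have "K * s \<le> \<epsilon> / 2"
            proof -
              have "K * s \<le> (K + 1) * (\<epsilon> / (2 * (K + 1)))"
                using r K by (intro mult_mono) (auto simp: d_def)
              also have "\<dots> = \<epsilon> / 2" using K by (simp add: divide_simps)
              finally show ?thesis .
            qed
            finally show ?thesis using r by (simp add: mult.commute mult_right_mono)
          qed
          moreover have "A + ?k * (X + c * s) = m.avg r x - e - M / \<epsilon> * R\<^sup>2 + ?k * c * s"
            "(f ?k + c * ?k) * s = s * f ?k + ?k * c * s"
            by (simp_all add: A_def algebra_simps)
          ultimately have "m.avg r x - s * f ?k - s * (\<epsilon> / 2) - e \<le> w.U (r + s) (X + c * s)"
            by linarith
          moreover have "X + c * s = x + a + c * (r + s)" by (simp add: X_def algebra_simps)
          ultimately show "m.avg (r + s) x \<le> w.U (r + s) (x + a + c * (r + s)) + (e + \<epsilon> * s)"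
            using sub by (simp add: algebra_simps)
        qed
      qed (use IH in simp)
    qed (use t d in auto)
    then have "m.avg t x \<le> w.U t (x + a + c * t) + (M * \<epsilon> + \<epsilon> * t)" by simp
    then show ?thesis using m.avg_bounds(1)[OF t, of x] by linarith
  qed
  have "((\<lambda>\<epsilon>. w.U t (x + a + c * t) + (M * \<epsilon> + \<epsilon> * t)) \<longlongrightarrow> w.U t (x + a + c * t) + (M * 0 + 0 * t)) (at_right 0)"
    by (intro tendsto_intros)
  moreover have "\<forall>\<^sub>F \<epsilon> in at_right 0. u.U t x \<le> w.U t (x + a + c * t) + (M * \<epsilon> + \<epsilon> * t)"
    using approx by (auto simp: eventually_at_right_field intro: exI[of _ 1])
  ultimately have "u.U t x \<le> w.U t (x + a + c * t) + (M * 0 + 0 * t)" by (intro tendsto_lowerbound) auto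
  then show ?thesis by simp
qed

section \<open>Entropy solutions as curves\<close>

lemma antideriv_C1:
  assumes d: "\<And>x. (b has_real_derivative b' x) (at x)" and c: "continuous_on UNIV b'"
    and out: "\<And>x. x \<notin> {l..r} \<Longrightarrow> b' x = 0"
  shows "antideriv b b'"
  unfolding antideriv_def
proof (intro conjI allI impI)
  show "b' \<in> borel_measurable borel" by (rule borel_measurable_continuous_onI[OF c])
  have "bounded (b' ` {l..r})"
    using c by (intro compact_imp_bounded compact_continuous_image) (auto intro: continuous_on_subset)
  then obtain K where K: "\<forall>x\<in>{l..r}. \<bar>b' x\<bar> \<le> K" unfolding bounded_iff by auto
  then have "\<bar>b' x\<bar> \<le> \<bar>K\<bar>" for x using out[of x] by (cases "x \<in> {l..r}") force+
  then show "\<exists>K. \<forall>x. \<bar>b' x\<bar> \<le> K" by blast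
  fix x y :: real assume "x \<le> y"
  then have "(LBINT z. indicator {x..y} z *\<^sub>R b' z) = b y - b x"
    using d continuous_on_subset[OF c, of "{x..y}"]
    by (intro integral_FTC_Icc)
      (auto intro: has_field_derivative_at_within simp: has_real_derivative_iff_has_vector_derivative[symmetric])
  then show "b y - b x = (LBINT z. indicator {x..y} z * b' z)" by simp
qed

lemma integral_C1_compact_zero:
  assumes "\<And>x. (b has_real_derivative b' x) (at x)" "continuous_on UNIV b'"
    and "\<And>x. x \<notin> {l..r} \<Longrightarrow> b x = 0 \<and> b' x = 0"
  shows "(LBINT x. b' x) = 0"
proof (rule antideriv_integral_zero[OF antideriv_C1[OF assms(1,2), of l r]])
  fix x :: real assume "\<bar>l\<bar> + \<bar>r\<bar> < \<bar>x\<bar>"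
  then have "x \<notin> {l..r}" by auto
  then show "b x = 0" "b' x = 0" using assms(3) by auto
qed (use assms in auto)

lemma AE_interval_ex:
  assumes "AE t in lborel. P t" "a < (b::real)" shows "\<exists>t\<in>{a<..<b}. P t"
proof (rule ccontr)
  assume "\<not> (\<exists>t\<in>{a<..<b}. P t)"
  then have "AE t in lborel. t \<notin> {a<..<b}" using assms(1) by (auto elim: eventually_mono)
  then have "{a<..<b} \<in> null_sets lborel" by (subst (asm) AE_iff_null_sets[symmetric]) auto
  then show False using assms(2) by (simp add: null_sets_def)
qed

lemma half_plane_lebesgue: "({0<..} :: real set) \<times> (UNIV :: real set) \<in> sets lebesgue"
proof -
  have "open (({0<..} :: real set) \<times> (UNIV :: real set))" by (intro open_Times) auto
  then have "({0<..} :: real set) \<times> (UNIV :: real set) \<in> sets borel" by (rule borel_open)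
  then show ?thesis by (intro sets_completionI_sets, simp only: sets_lborel)
qed

lemma AE_half_planeD:
  assumes "AE p in lebesgue_on ({0<..} \<times> UNIV). P p"
  shows "AE t in lborel. 0 < t \<longrightarrow> (AE x in lborel. P (t :: real, x :: real))"
proof -
  have "AE p in lebesgue. p \<in> {0<..} \<times> UNIV \<longrightarrow> P p"
    using assms half_plane_lebesgue by (subst (asm) AE_restrict_space_iff) auto
  then have "AE p in lborel. p \<in> {0<..} \<times> UNIV \<longrightarrow> P p" by (simp only: AE_completion_iff)
  then have "AE p in lborel \<Otimes>\<^sub>M lborel. p \<in> {0<..} \<times> UNIV \<longrightarrow> P p" by (simp only: lborel_prod)
  from lborel_pair.AE_pair[OF this] show ?thesis
    by eventually_elim (auto elim: eventually_mono)
qed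

text \<open>The solution is jointly measurable only for Lebesgue sets of the plane, and its time
  slices agree with \<open>u t\<close> only up to null sets. A jointly Borel version
  \<open>w\<close>, clipped to [-B, B], agrees with \<open>u t\<close> for almost every t > 0, and
  Fubini turns the double integral into iterated ones. The normalising constants of the Kruzkov pair
  contribute multiples of the integrals of a' and b', which vanish.\<close>

lemma (in L1_curve) weak_ineq_of_entropy_solution:
  assumes sol: "entropy_solution f u0 v" and f: "continuous_on UNIV f"
    and eq: "\<And>t. 0 \<le> t \<Longrightarrow> AE x in lborel. u t x = v t x"
  shows "weak_ineq (kru_eta k) (kru_flux f k)"
  unfolding weak_ineq_def
proof (intro allI impI)
  fix a a' b b' \<alpha> \<beta> R
  assume ab: "\<forall>k. Ck1 k a" "\<forall>k. Ck1 k b" "\<forall>t. (a has_real_derivative a' t) (at t)"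
    "\<forall>x. (b has_real_derivative b' x) (at x)" "continuous_on UNIV a'" "continuous_on UNIV b'"
    "\<forall>t. 0 \<le> a t" "\<forall>x. 0 \<le> b x" "0 < \<alpha>"
    and aout: "\<forall>t. t \<notin> {\<alpha>..\<beta>} \<longrightarrow> a t = 0 \<and> a' t = 0" and bout: "\<forall>x. R < \<bar>x\<bar> \<longrightarrow> b x = 0 \<and> b' x = 0"
  have ac: "continuous_on UNIV a" "continuous_on UNIV b" using ab(1,2)[rule_format, of 0] by auto
  have [measurable]: "a \<in> borel_measurable borel" "a' \<in> borel_measurable borel" "b \<in> borel_measurable borel"
    "b' \<in> borel_measurable borel" "f \<in> borel_measurable borel"
    using ab ac f by (auto intro: borel_measurable_continuous_onI)
  have nn: "a t = 0" "a' t = 0" if "t \<le> 0" for t using aout[rule_format, of t] that ab(9) by auto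
  have bcs_cont: "bcs g" if "continuous_on UNIV g" "\<And>x. x \<notin> {l..r} \<Longrightarrow> g x = 0" for g and l r :: real
  proof -
    have "bounded (g ` {l..r})"
      using that by (intro compact_imp_bounded compact_continuous_image) (auto intro: continuous_on_subset)
    then obtain K where "\<forall>x\<in>{l..r}. \<bar>g x\<bar> \<le> K" unfolding bounded_iff by auto
    then have "\<bar>g x\<bar> \<le> \<bar>K\<bar>" for x using that(2)[of x] by (cases "x \<in> {l..r}") force+
    moreover have "\<bar>l\<bar> + \<bar>r\<bar> < \<bar>x\<bar> \<longrightarrow> g x = 0" for x
    proof
      assume "\<bar>l\<bar> + \<bar>r\<bar> < \<bar>x\<bar>"
      then have "x \<notin> {l..r}" by auto
      then show "g x = 0" by (rule that(2))
    qed
    ultimately show ?thesis unfolding bcs_def using borel_measurable_continuous_onI[OF that(1)] by blast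
  qed
  have bout': "x \<notin> {- R..R} \<Longrightarrow> b x = 0 \<and> b' x = 0" for x using bout[rule_format, of x] by auto
  have bb: "bcs a" "bcs a'" "bcs b" "bcs b'"
    by (rule bcs_cont[of _ \<alpha> \<beta>] bcs_cont[of _ "- R" R]; use ab ac aout bout' in auto)+
  have "bounded (f ` {-B..B})"
    using f by (intro compact_imp_bounded compact_continuous_image) (auto intro: continuous_on_subset)
  then obtain F where F: "\<And>y. y \<in> {-B..B} \<Longrightarrow> \<bar>f y\<bar> \<le> F"
    unfolding bounded_iff by (metis image_eqI real_norm_def)
  have F0: "0 \<le> F" using F[of 0] B_nonneg by auto
  define E where "E y = \<bar>y - k\<bar>" for y :: real
  define Q where "Q y = sgn (y - k) * (f y - f k)" for y
  have [measurable]: "E \<in> borel_measurable borel" "Q \<in> borel_measurable borel"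
    unfolding E_def[abs_def] Q_def[abs_def] by measurable
  have EQ: "\<bar>E y\<bar> \<le> B + \<bar>k\<bar>" "\<bar>Q y\<bar> \<le> F + \<bar>f k\<bar>" if "y \<in> {-B..B}" for y
    using that F[OF that] by (auto simp: E_def Q_def abs_mult sgn_real_def)
  define Z where "Z w p = E (w p) * (a' (fst p) * b (snd p)) + Q (w p) * (a (fst p) * b' (snd p))"
    for w and p :: "real \<times> real"
  let ?S = "{0<..} \<times> UNIV :: (real \<times> real) set"
  define v0 where "v0 p = indicator ?S p *\<^sub>R (case p of (t, x) \<Rightarrow> v t x)" for p
  have v0m: "v0 \<in> borel_measurable lebesgue"
  proof -
    have "(\<lambda>(t, x). v t x) \<in> borel_measurable (lebesgue_on ?S)"
      using sol by (simp add: entropy_solution_def in_Linf_def)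
    then show ?thesis
      unfolding v0_def using half_plane_lebesgue by (subst (asm) borel_measurable_restrict_space_iff) auto
  qed
  obtain w0 where w0: "w0 \<in> borel_measurable lborel" "AE p in lborel. v0 p = w0 p"
    using completion_ex_borel_measurable_real[OF v0m] by blast
  define w where "w p = max (-B) (min B (w0 p))" for p
  have wm [measurable]: "w \<in> borel_measurable borel" using w0(1) unfolding w_def by measurable
  have Zm: "Z w \<in> borel_measurable lborel"
  proof -
    have [measurable]: "w \<in> borel_measurable (borel \<Otimes>\<^sub>M borel)" unfolding borel_prod by (rule wm)
    have "Z w \<in> borel_measurable (borel \<Otimes>\<^sub>M borel)" unfolding Z_def by measurable
    then show ?thesis unfolding borel_prod by simp
  qed
  have wB: "w p \<in> {-B..B}" for p using B_nonneg by (auto simp: w_def)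
  have w_eq: "AE t in lborel. 0 < t \<longrightarrow> (AE x in lborel. w (t, x) = u t x)"
  proof -
    have "AE p in lborel \<Otimes>\<^sub>M lborel. v0 p = w0 p" using w0(2) by (simp only: lborel_prod)
    from lborel_pair.AE_pair[OF this] show ?thesis
    proof eventually_elim
      case (elim t)
      show ?case
      proof
        assume "0 < t"
        then have "AE x in lborel. u t x = v t x" using eq[of t] by simp
        with elim show "AE x in lborel. w (t, x) = u t x"
        proof eventually_elim
          case (elim x)
          then have "w0 (t, x) = u t x" using \<open>0 < t\<close> by (simp add: v0_def)
          then show ?case using bound[of t x] by (auto simp: w_def)
        qed
      qed
    qed
  qed
  have Zw_eq: "AE p in lborel. Z v0 p = Z w p"
  proof -
    have [measurable]: "w0 \<in> borel_measurable (lborel \<Otimes>\<^sub>M lborel)" "w \<in> borel_measurable (lborel \<Otimes>\<^sub>M lborel)"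
      unfolding lborel_prod using w0(1) wm by simp_all
    have "AE p in lborel \<Otimes>\<^sub>M lborel. 0 < fst p \<longrightarrow> w p = w0 p"
    proof (rule lborel_pair.AE_pair_measure)
      show "{p \<in> space (lborel \<Otimes>\<^sub>M lborel). 0 < fst p \<longrightarrow> w p = w0 p} \<in> sets (lborel \<Otimes>\<^sub>M lborel)" by measurable
      have "AE p in lborel \<Otimes>\<^sub>M lborel. v0 p = w0 p" using w0(2) by (simp only: lborel_prod)
      from lborel_pair.AE_pair[OF this]
      show "AE t in lborel. AE x in lborel. 0 < fst (t, x) \<longrightarrow> w (t, x) = w0 (t, x)"
      proof eventually_elim
        case (elim t)
        show ?case
        proof (cases "0 < t")
          case True
          then have "AE x in lborel. u t x = v t x" using eq[of t] by simp
          with elim show ?thesis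
          proof eventually_elim
            case (elim x)
            then have "w0 (t, x) = u t x" using True by (simp add: v0_def)
            then show ?case using bound[of t x] by (auto simp: w_def)
          qed
        qed simp
      qed
    qed
    then have "AE p in lborel. 0 < fst p \<longrightarrow> w p = w0 p" by (simp only: lborel_prod)
    with w0(2) show ?thesis
    proof eventually_elim
      case (elim p)
      then show ?case using nn[of "fst p"] by (cases "0 < fst p") (auto simp: Z_def)
    qed
  qed
  have test: "test_fun (\<lambda>p. a (fst p) * b (snd p))"
    by (rule test_fun_prod[of a b \<alpha> \<beta> R]) (use ab aout bout in auto)
  have "0 \<le> (LINT (t, x)|lebesgue_on ?S. \<bar>v t x - k\<bar> * deriv (\<lambda>s. a (fst (s, x)) * b (snd (s, x))) t
      + sgn (v t x - k) * (f (v t x) - f k) * deriv (\<lambda>y. a (fst (t, y)) * b (snd (t, y))) x)"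
    using sol test unfolding entropy_solution_def by blast
  also have "\<dots> = (LINT p|lebesgue_on ?S. Z v0 p)"
  proof (rule Bochner_Integration.integral_cong[OF refl])
    fix p assume "p \<in> space (lebesgue_on ?S)"
    then obtain t x where p: "p = (t, x)" "0 < t" by (cases p) (auto simp: space_restrict_space)
    have "deriv (\<lambda>s. a s * b x) t = a' t * b x" "deriv (\<lambda>y. a t * b y) x = a t * b' x"
      using ab(3,4) by (auto intro!: DERIV_imp_deriv derivative_eq_intros)
    then show "(case p of (t, x) \<Rightarrow> \<bar>v t x - k\<bar> * deriv (\<lambda>s. a (fst (s, x)) * b (snd (s, x))) t
      + sgn (v t x - k) * (f (v t x) - f k) * deriv (\<lambda>y. a (fst (t, y)) * b (snd (t, y))) x) = Z v0 p"
      using p by (simp add: Z_def E_def Q_def v0_def)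
  qed
  also have "\<dots> = (LINT p|lebesgue. Z v0 p)"
  proof -
    have "(LINT p|lebesgue_on ?S. Z v0 p) = (LINT p|lebesgue. indicator ?S p *\<^sub>R Z v0 p)"
      using half_plane_lebesgue by (intro integral_restrict_space) auto
    moreover have "(\<lambda>p. indicator ?S p *\<^sub>R Z v0 p) = Z v0"
    proof
      fix p show "indicator ?S p *\<^sub>R Z v0 p = Z v0 p"
        using nn[of "fst p"] by (cases "0 < fst p"; cases p) (auto simp: Z_def)
    qed
    ultimately show ?thesis by (simp only:)
  qed
  also have "\<dots> = (LINT p|lebesgue. Z w p)"
  proof (rule integral_cong_AE)
    have c: "g \<in> borel_measurable borel \<Longrightarrow> (\<lambda>p. g (h p)) \<in> borel_measurable lebesgue"
      if "h \<in> borel_measurable lebesgue" for g :: "real \<Rightarrow> real" and h :: "real \<times> real \<Rightarrow> real"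
      by (rule measurable_compose[OF that])
    have m: "(\<lambda>p :: real \<times> real. g (fst p)) \<in> borel_measurable lebesgue"
      "(\<lambda>p :: real \<times> real. g (snd p)) \<in> borel_measurable lebesgue"
      if [measurable]: "g \<in> borel_measurable borel" for g :: "real \<Rightarrow> real"
    proof -
      have h: "(\<lambda>p. g (fst p)) \<in> borel_measurable (lborel :: (real \<times> real) measure)"
        "(\<lambda>p. g (snd p)) \<in> borel_measurable (lborel :: (real \<times> real) measure)"
        by (simp_all add: borel_prod[symmetric])
      from measurable_completion[OF h(1)] measurable_completion[OF h(2)]
      show "(\<lambda>p :: real \<times> real. g (fst p)) \<in> borel_measurable lebesgue"
      "(\<lambda>p :: real \<times> real. g (snd p)) \<in> borel_measurable lebesgue"
        by blast+
    qed
    show "Z v0 \<in> borel_measurable lebesgue"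
      unfolding Z_def by (intro borel_measurable_add borel_measurable_times c[OF v0m] m) auto
    have wl: "w \<in> borel_measurable lebesgue" using wm by (intro measurable_completion) simp
    show "Z w \<in> borel_measurable lebesgue"
      unfolding Z_def by (intro borel_measurable_add borel_measurable_times c[OF wl] m) auto
    show "AE p in lebesgue. Z v0 p = Z w p" using Zw_eq by (rule AE_completion)
  qed
  also have "\<dots> = (LINT p|lborel. Z w p)"
  proof (rule integral_completion)
    show "Z w \<in> borel_measurable lborel" by (rule Zm)
  qed
  also have "\<dots> = integral\<^sup>L (lborel \<Otimes>\<^sub>M lborel) (Z w)" by (simp only: lborel_prod)
  finally have pos: "0 \<le> integral\<^sup>L (lborel \<Otimes>\<^sub>M lborel) (Z w)" .
  obtain Ka Kb where Kab: "\<And>t. \<bar>a t\<bar> \<le> Ka \<and> \<bar>a' t\<bar> \<le> Ka" "\<And>x. \<bar>b x\<bar> \<le> Kb \<and> \<bar>b' x\<bar> \<le> Kb"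
  proof -
    obtain k1 k2 k3 k4 where "\<And>t. \<bar>a t\<bar> \<le> k1" "\<And>t. \<bar>a' t\<bar> \<le> k2" "\<And>t. \<bar>b t\<bar> \<le> k3" "\<And>t. \<bar>b' t\<bar> \<le> k4"
      using bb unfolding bcs_def by metis
    then have "\<And>t. \<bar>a t\<bar> \<le> max k1 k2 \<and> \<bar>a' t\<bar> \<le> max k1 k2" "\<And>t. \<bar>b t\<bar> \<le> max k3 k4 \<and> \<bar>b' t\<bar> \<le> max k3 k4"
      by (auto simp: le_max_iff_disj)
    then show ?thesis by (rule that)
  qed
  have int2: "integrable (lborel \<Otimes>\<^sub>M lborel) (Z w)"
    unfolding lborel_prod
  proof (rule integrableI_bounded_set[where A = "{\<alpha>..\<beta>} \<times> {- R..R}"])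
    show "Z w \<in> borel_measurable lborel" by (rule Zm)
    have "{\<alpha>..\<beta>} \<times> {- R..R} = cbox (\<alpha>, - R) (\<beta>, R)" by (simp add: cbox_Pair_eq)
    then show "{\<alpha>..\<beta>} \<times> {- R..R} \<in> sets lborel" "emeasure lborel ({\<alpha>..\<beta>} \<times> {- R..R}) < \<infinity>"
      using emeasure_lborel_cbox_finite by auto
    show "AE p in lborel. p \<in> {\<alpha>..\<beta>} \<times> {- R..R} \<longrightarrow> norm (Z w p) \<le> (B + \<bar>k\<bar>) * (Ka * Kb) + (F + \<bar>f k\<bar>) * (Ka * Kb)"
    proof (intro always_eventually allI impI)
      fix p
      show "norm (Z w p) \<le> (B + \<bar>k\<bar>) * (Ka * Kb) + (F + \<bar>f k\<bar>) * (Ka * Kb)"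
        unfolding Z_def real_norm_def using Kab(1)[of "fst p"] Kab(2)[of "snd p"]
        by (intro order_trans[OF abs_triangle_ineq] add_mono abs_mult_le EQ wB) auto
    qed
    show "AE p in lborel. p \<notin> {\<alpha>..\<beta>} \<times> {- R..R} \<longrightarrow> Z w p = 0"
    proof (intro always_eventually allI impI)
      fix p :: "real \<times> real" assume "p \<notin> {\<alpha>..\<beta>} \<times> {- R..R}"
      then have "fst p \<notin> {\<alpha>..\<beta>} \<or> snd p \<notin> {- R..R}" by (cases p) auto
      then show "Z w p = 0" using aout bout'[of "snd p"] by (auto simp: Z_def)
    qed
  qed
  define G where "G t = (LBINT x. Z w (t, x))" for t
  have Gi: "integrable lborel G" unfolding G_def by (rule lborel_pair.integrable_fst'[OF int2])
  have Gpos: "0 \<le> (LBINT t. G t)" unfolding G_def using pos lborel_pair.integral_fst'[OF int2] by simp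
  define I where "I t = a' t * (LBINT x. kru_eta k (u t x) * b x) + a t * (LBINT x. kru_flux f k (u t x) * b' x)" for t
  have b'0: "(LBINT x. b' x) = 0"
    by (rule integral_C1_compact_zero[of b b' "- R" R]) (use ab bout' in auto)
  have a'0: "(LBINT x. a' x) = 0"
    by (rule integral_C1_compact_zero[of a a' \<alpha> \<beta>]) (use ab aout in auto)
  have GI: "AE t in lborel. G t = I t + a' t * (\<bar>k\<bar> * (LBINT x. b x))"
    using w_eq
  proof eventually_elim
    case (elim t)
    show ?case
    proof (cases "0 < t")
      case True
      have i1: "integrable lborel (\<lambda>x. E (u t x) * b x)" "integrable lborel (\<lambda>x. Q (u t x) * b' x)"
        by (rule bcs_integrable[OF bcs_mult[OF bb(3) _ EQ(1)[OF u_range]]]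
            bcs_integrable[OF bcs_mult[OF bb(4) _ EQ(2)[OF u_range]]]; simp)+
      note i2 = bcs_integrable[OF bb(3)] bcs_integrable[OF bb(4)]
      have [measurable]: "(\<lambda>x. w (t, x)) \<in> borel_measurable borel"
        using wm by (simp add: borel_prod[symmetric])
      have "G t = (LBINT x. a' t * (E (u t x) * b x) + a t * (Q (u t x) * b' x))"
        unfolding G_def
      proof (rule integral_cong_AE)
        show "AE x in lborel. Z w (t, x) = a' t * (E (u t x) * b x) + a t * (Q (u t x) * b' x)"
          using elim[rule_format, OF True] by eventually_elim (simp add: Z_def mult_ac)
      qed (simp_all add: Z_def)
      also have "\<dots> = a' t * (LBINT x. E (u t x) * b x) + a t * (LBINT x. Q (u t x) * b' x)"
        using i1 by simp
      also have "(LBINT x. E (u t x) * b x) = (LBINT x. kru_eta k (u t x) * b x) + \<bar>k\<bar> * (LBINT x. b x)"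
      proof -
        have "(LBINT x. kru_eta k (u t x) * b x) = (LBINT x. E (u t x) * b x - \<bar>k\<bar> * b x)"
          by (intro Bochner_Integration.integral_cong refl) (simp add: kru_eta_def E_def algebra_simps)
        then show ?thesis using i1 i2 by simp
      qed
      also have "(LBINT x. Q (u t x) * b' x) = (LBINT x. kru_flux f k (u t x) * b' x)"
      proof -
        have "(LBINT x. kru_flux f k (u t x) * b' x) = (LBINT x. Q (u t x) * b' x - (sgn (- k) * (f 0 - f k)) * b' x)"
          by (intro Bochner_Integration.integral_cong refl) (simp add: kru_flux_def Q_def algebra_simps)
        then show ?thesis using i1 i2 b'0 by simp
      qed
      finally show ?thesis by (simp add: I_def algebra_simps)
    next
      case False
      then show ?thesis using nn[of t] by (simp add: G_def I_def Z_def)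
    qed
  qed
  \<comment> \<open>If \<open>I\<close> were not integrable its integral would be 0 by convention
    and the inequality would hold all the same; a case split replaces a proof of
    integrability.\<close>
  have "0 \<le> (LBINT t. I t)"
  proof (cases "integrable lborel I")
    case True
    have "(LBINT t. G t) = (LBINT t. I t + a' t * (\<bar>k\<bar> * (LBINT x. b x)))"
      using GI Gi True bcs_integrable[OF bb(2)]
      by (intro integral_cong_AE) (auto dest: borel_measurable_integrable)
    also have "\<dots> = (LBINT t. I t)" using True bcs_integrable[OF bb(2)] a'0 by simp
    finally show ?thesis using Gpos by simp
  qed (simp add: not_integrable_integral_eq)
  then show "0 \<le> (LBINT t. a' t * (LBINT x. kru_eta k (u t x) * b x) + a t * (LBINT x. kru_flux f k (u t x) * b' x))"
    by (simp add: I_def[abs_def])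
qed

text \<open>A bound on the half plane gives a bound on almost every time slice only. Every t \<ge> 0
  is a limit of such slices from the right, and the integral of the excess over \<open>B\<close> is
  at most the L1 distance to a slice without excess.\<close>

lemma AE_lebesgue_bounded_of_L1_limit:
  fixes u :: "real \<Rightarrow> real \<Rightarrow> real"
  assumes int: "\<And>t. 0 \<le> t \<Longrightarrow> integrable lebesgue (u t)"
    and cont: "((\<lambda>s. LINT x|lebesgue. \<bar>u s x - u t x\<bar>) \<longlongrightarrow> 0) (at t within {0..})"
    and ae: "AE t in lborel. 0 < t \<longrightarrow> (AE x in lborel. \<bar>u t x\<bar> \<le> B)" and t: "0 \<le> t" and B: "0 \<le> B"
  shows "AE x in lebesgue. \<bar>u t x\<bar> \<le> B"
proof -
  define p where "p x = max 0 (\<bar>u t x\<bar> - B)" for x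
  have [measurable]: "u t \<in> borel_measurable lebesgue" using int[OF t] by auto
  have pm [measurable]: "p \<in> borel_measurable lebesgue" unfolding p_def by measurable
  have pi: "integrable lebesgue p"
    by (rule Bochner_Integration.integrable_bound[OF integrable_abs[OF int[OF t]]])
      (use B in \<open>auto simp: p_def\<close>)
  have "(LINT x|lebesgue. p x) \<le> 0 + e" if "0 < e" for e
  proof -
    from tendstoD[OF cont that] obtain d where d: "0 < d" "\<And>s. 0 \<le> s \<Longrightarrow> s \<noteq> t \<Longrightarrow> \<bar>s - t\<bar> < d \<Longrightarrow>
      (LINT x|lebesgue. \<bar>u s x - u t x\<bar>) < e"
      unfolding eventually_at by (auto simp: dist_real_def)
    obtain s where s: "t < s" "s < t + d" "AE x in lborel. \<bar>u s x\<bar> \<le> B"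
      using AE_interval_ex[OF ae, of t "t + d"] d(1) t by force
    have s0: "0 \<le> s" using s t by simp
    have di: "integrable lebesgue (\<lambda>x. \<bar>u s x - u t x\<bar>)"
      by (intro integrable_abs Bochner_Integration.integrable_diff int s0 t)
    have "AE x in lebesgue. \<bar>u s x\<bar> \<le> B" using s(3) by (rule AE_completion)
    then have "(LINT x|lebesgue. p x) \<le> (LINT x|lebesgue. \<bar>u s x - u t x\<bar>)"
      by (intro integral_mono_AE pi di) (auto elim!: eventually_mono simp: p_def)
    also have "\<dots> < e" using d(2)[of s] s s0 by auto
    finally show ?thesis by simp
  qed
  then have "(LINT x|lebesgue. p x) \<le> 0" by (rule field_le_epsilon)
  then have "(LINT x|lebesgue. p x) = 0"
    by (intro antisym) (auto simp: p_def intro!: integral_nonneg_AE)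
  then have "AE x in lebesgue. p x = 0"
    using integral_nonneg_eq_0_iff_AE[OF pi] unfolding p_def by simp
  then show ?thesis by eventually_elim (auto simp: p_def max_def split: if_splits)
qed

text \<open>The curve \<open>w\<close> consists of bounded Borel representatives and is constant for negative times.\<close>

theorem entropy_solution_curve:
  assumes sol: "entropy_solution f u0 u" and f: "continuous_on UNIV f" "f 0 = 0"
  obtains B0 where "0 < B0" "\<And>B L. B0 \<le> B \<Longrightarrow> 0 < L \<Longrightarrow>
    (\<And>a b. a \<in> {-B..B} \<Longrightarrow> b \<in> {-B..B} \<Longrightarrow> \<bar>f a - f b\<bar> \<le> L * \<bar>a - b\<bar>) \<Longrightarrow>
    \<exists>w. entropy_curve w B f L \<and> (\<forall>t\<ge>0. AE x in lebesgue. w t x = u t x)"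
proof -
  let ?S = "{0<..} \<times> UNIV :: (real \<times> real) set"
  define e where "e = Linf_norm (lebesgue_on ?S) (\<lambda>(t, x). u t x)"
  have um: "(\<lambda>(t, x). u t x) \<in> borel_measurable (lebesgue_on ?S)" and fin: "e < \<infinity>"
    using sol by (auto simp: entropy_solution_def in_Linf_def e_def)
  have int: "integrable lebesgue (u t)" if "0 \<le> t" for t using sol that by (simp add: entropy_solution_def)
  have cont: "((\<lambda>s. LINT x|lebesgue. \<bar>u s x - u t x\<bar>) \<longlongrightarrow> 0) (at t within {0..})" if "0 \<le> t" for t
    using sol that by (simp add: entropy_solution_def)
  define B0 where "B0 = max 1 (real_of_ereal e)"
  have e_le: "e \<le> ereal B0" using fin by (cases e) (auto simp: B0_def)
  have "AE p in lebesgue_on ?S. ereal \<bar>case p of (t, x) \<Rightarrow> u t x\<bar> \<le> e"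
    unfolding e_def Linf_norm_def by (rule esssup_AE)
  then have "AE p in lebesgue_on ?S. \<bar>case p of (t, x) \<Rightarrow> u t x\<bar> \<le> B0"
    by eventually_elim (use e_le in \<open>auto dest: order_trans\<close>)
  from AE_half_planeD[OF this] have ae: "AE t in lborel. 0 < t \<longrightarrow> (AE x in lborel. \<bar>u t x\<bar> \<le> B0)" by simp
  have B0: "0 < B0" by (simp add: B0_def)
  have ub: "AE x in lebesgue. \<bar>u t x\<bar> \<le> B0" if "0 \<le> t" for t
    by (rule AE_lebesgue_bounded_of_L1_limit[OF int cont[OF that] ae that]) (use B0 in auto)
  have "\<forall>t. \<exists>g. 0 \<le> t \<longrightarrow> g \<in> borel_measurable lborel \<and> (AE x in lborel. u t x = g x)"
    using completion_ex_borel_measurable_real[OF borel_measurable_integrable[OF int]] by blast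
  then obtain g where g: "\<And>t. 0 \<le> t \<Longrightarrow> g t \<in> borel_measurable lborel"
    "\<And>t. 0 \<le> t \<Longrightarrow> AE x in lborel. u t x = g t x" by metis
  show ?thesis
  proof (rule that[OF B0])
    fix B L :: real assume B: "B0 \<le> B" and L: "0 < L"
      and lip: "\<And>a b. a \<in> {-B..B} \<Longrightarrow> b \<in> {-B..B} \<Longrightarrow> \<bar>f a - f b\<bar> \<le> L * \<bar>a - b\<bar>"
    \<comment> \<open>Freezing the curve for negative times provides the two-sided continuity that
      \<open>L1_curve\<close> asks for at every real time.\<close>
    define w where "w t x = max (- B) (min B (g (max 0 t) x))" for t x
    have weq: "AE x in lebesgue. w t x = u (max 0 t) x" for t
    proof -
      have "AE x in lebesgue. u (max 0 t) x = g (max 0 t) x" using g(2)[of "max 0 t"] by (intro AE_completion) auto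
      moreover have "AE x in lebesgue. \<bar>u (max 0 t) x\<bar> \<le> B0" by (rule ub) simp
      ultimately show ?thesis by eventually_elim (use B in \<open>auto simp: w_def\<close>)
    qed
    have wm: "w t \<in> borel_measurable borel" for t
      using g(1)[of "max 0 t"] unfolding w_def by measurable
    have um': "u t \<in> borel_measurable lebesgue" if "0 \<le> t" for t
      using int[OF that] by (rule borel_measurable_integrable)
    have wml: "w t \<in> borel_measurable lebesgue" for t
      using wm[of t] by (intro measurable_completion) simp
    interpret L1_curve w B
    proof
      fix t
      show "w t \<in> borel_measurable borel" by (rule wm)
      have "integrable lebesgue (w t)"
        by (rule Bochner_Integration.integrable_bound[OF int[of "max 0 t"]])
          (use wml weq[of t] in \<open>auto elim: eventually_mono\<close>)
      then show "integrable lborel (w t)" using wm[of t] by (simp add: integrable_completion)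
      show "\<bar>w t x\<bar> \<le> B" for x using B B0 by (auto simp: w_def)
      have eq: "(LBINT x. \<bar>w s x - w t x\<bar>) = (LINT x|lebesgue. \<bar>u (max 0 s) x - u (max 0 t) x\<bar>)" for s
      proof -
        have "(LBINT x. \<bar>w s x - w t x\<bar>) = (LINT x|lebesgue. \<bar>w s x - w t x\<bar>)"
          using wm by (intro integral_completion[symmetric]) simp
        also have "\<dots> = (LINT x|lebesgue. \<bar>u (max 0 s) x - u (max 0 t) x\<bar>)"
        proof (rule integral_cong_AE)
          show "(\<lambda>x. \<bar>w s x - w t x\<bar>) \<in> borel_measurable lebesgue"
            by (intro borel_measurable_abs borel_measurable_diff wml)
          show "(\<lambda>x. \<bar>u (max 0 s) x - u (max 0 t) x\<bar>) \<in> borel_measurable lebesgue"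
            by (intro borel_measurable_abs borel_measurable_diff um') auto
          show "AE x in lebesgue. \<bar>w s x - w t x\<bar> = \<bar>u (max 0 s) x - u (max 0 t) x\<bar>"
            using weq[of s] weq[of t] by eventually_elim simp
        qed
        finally show ?thesis .
      qed
      show "((\<lambda>s. LBINT x. \<bar>w s x - w t x\<bar>) \<longlongrightarrow> 0) (at t)"
        unfolding eq
      proof (rule tendstoI)
        fix \<epsilon> :: real assume \<epsilon>: "0 < \<epsilon>"
        from tendstoD[OF cont[of "max 0 t"] \<epsilon>]
        obtain d where d: "0 < d" "\<And>s. 0 \<le> s \<Longrightarrow> s \<noteq> max 0 t \<Longrightarrow> \<bar>s - max 0 t\<bar> < d \<Longrightarrow>
          (LINT x|lebesgue. \<bar>u s x - u (max 0 t) x\<bar>) < \<epsilon>"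
          unfolding eventually_at by (auto simp: dist_real_def)
        have "(LINT x|lebesgue. \<bar>u (max 0 s) x - u (max 0 t) x\<bar>) < \<epsilon>" if "\<bar>s - t\<bar> < d" for s
        proof (cases "max 0 s = max 0 t")
          case False
          then show ?thesis using that by (intro d(2)) auto
        qed (use \<epsilon> in simp)
        then show "\<forall>\<^sub>F s in at t. dist (LINT x|lebesgue. \<bar>u (max 0 s) x - u (max 0 t) x\<bar>) 0 < \<epsilon>"
          unfolding eventually_at using d(1) by (auto simp: dist_real_def)
      qed
    qed
    have weq': "AE x in lborel. w t x = u t x" if "0 \<le> t" for t
      using weq[of t] that by (simp add: AE_completion_iff max_def)
    have "entropy_curve w B f L"
    proof
      show "weak_ineq (kru_eta k) (kru_flux f k)" for k
        by (rule weak_ineq_of_entropy_solution[OF sol f(1) weq'])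
    qed (use f L B B0 lip in auto)
    moreover have "\<forall>t\<ge>0. AE x in lebesgue. w t x = u t x" using weq' by (auto intro: AE_completion)
    ultimately show "\<exists>w. entropy_curve w B f L \<and> (\<forall>t\<ge>0. AE x in lebesgue. w t x = u t x)" by blast
  qed
qed

section \<open>Interpolated flux, cell averages and the Wasserstein distance\<close>

lemma C2_funD:
  assumes "C2_fun f"
  shows "(f has_real_derivative deriv f x) (at x)" "(deriv f has_real_derivative deriv (deriv f) x) (at x)"
    "continuous_on UNIV (deriv (deriv f))"
  using assms unfolding C2_fun_def differentiable_on_def
  by (auto simp: DERIV_deriv_iff_real_differentiable)

lemma lipschitz_of_deriv_bound:
  fixes f :: "real \<Rightarrow> real"
  assumes "\<And>x. (f has_real_derivative f' x) (at x)" "\<And>x. x \<in> {l..r} \<Longrightarrow> \<bar>f' x\<bar> \<le> L" "a \<in> {l..r}" "b \<in> {l..r}"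
  shows "\<bar>f a - f b\<bar> \<le> L * \<bar>a - b\<bar>"
  using field_differentiable_bound[of "{l..r}" f f' L a b] assms
  by (auto intro: has_field_derivative_at_within)

lemma C2_lipschitz:
  assumes "C2_fun f"
  obtains L where "0 < L" "\<And>a b. a \<in> {l..r} \<Longrightarrow> b \<in> {l..r} \<Longrightarrow> \<bar>f a - f b\<bar> \<le> L * \<bar>a - b\<bar>"
proof -
  have "continuous_on {l..r} (deriv f)"
    using C2_funD(2)[OF assms] by (meson DERIV_isCont continuous_at_imp_continuous_on)
  then have "bounded (deriv f ` {l..r})" by (intro compact_imp_bounded compact_continuous_image) auto
  then obtain K where K: "\<forall>x\<in>{l..r}. \<bar>deriv f x\<bar> \<le> K" unfolding bounded_iff by auto
  show ?thesis
  proof (rule that[of "\<bar>K\<bar> + 1"])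
    show "\<bar>f a - f b\<bar> \<le> (\<bar>K\<bar> + 1) * \<bar>a - b\<bar>" if "a \<in> {l..r}" "b \<in> {l..r}" for a b
      by (rule lipschitz_of_deriv_bound[OF C2_funD(1)[OF assms] _ that]) (use K in force)
  qed simp
qed

lemma max_abs_deriv2_upper:
  assumes "C2_fun f" "p \<in> {0..b}" shows "\<bar>deriv (deriv f) p\<bar> \<le> max_abs_deriv2 f b"
  unfolding max_abs_deriv2_def
proof (rule cSUP_upper[OF assms(2)])
  have "compact ((\<lambda>p. \<bar>deriv (deriv f) p\<bar>) ` {0..b})"
    using C2_funD(3)[OF assms(1)]
    by (intro compact_continuous_image continuous_intros) (auto intro: continuous_on_subset)
  then show "bdd_above ((\<lambda>p. \<bar>deriv (deriv f) p\<bar>) ` {0..b})" by (intro bounded_imp_bdd_above compact_imp_bounded)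
qed

lemma max_abs_deriv2_nonneg: "C2_fun f \<Longrightarrow> 0 \<le> b \<Longrightarrow> 0 \<le> max_abs_deriv2 f b"
  using max_abs_deriv2_upper[of f 0 b] by force

lemma max_abs_deriv2_mono:
  assumes "C2_fun f" "0 \<le> b" "b \<le> c" shows "max_abs_deriv2 f b \<le> max_abs_deriv2 f c"
  unfolding max_abs_deriv2_def[of f b]
  by (rule cSUP_least) (use assms in \<open>auto intro: max_abs_deriv2_upper\<close>)

section \<open>The piecewise linear flux\<close>

context
  fixes d :: real and f :: "real \<Rightarrow> real"
  assumes d: "0 < d"
begin

text \<open>Index, as a real number, of the cell (j d, (j + 1) d] containing \<open>u\<close>. Right
  end points belong to their cell, so 0 has index -1.\<close>

definition cell :: "real \<Rightarrow> real" where "cell u = real_of_int (\<lceil>u / d\<rceil> - 1)"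

lemma cell_bounds: "cell u * d < u" "u \<le> (cell u + 1) * d"
proof -
  have "real_of_int (\<lceil>u / d\<rceil> - 1) < u / d" by linarith
  then show "cell u * d < u" by (simp only: cell_def pos_less_divide_eq[OF d])
  have "u / d \<le> cell u + 1" by (simp add: cell_def)
  then show "u \<le> (cell u + 1) * d" by (simp only: pos_divide_le_eq[OF d])
qed

lemma cell_int: obtains i :: int where "cell u = real_of_int i"
  unfolding cell_def by blast

lemma pl_interp_cell: "pl_interp d f u = f (cell u * d) + (u - cell u * d) * ((f ((cell u + 1) * d) - f (cell u * d)) / d)"
  by (simp add: pl_interp_def cell_def Let_def)

lemma cell_less_imp: assumes "cell u < cell v" shows "(cell u + 1) * d \<le> cell v * d"
proof -
  obtain i j :: int where ij: "cell u = real_of_int i" "cell v = real_of_int j" using cell_int by metis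
  then have "i + 1 \<le> j" using assms by simp
  then have "cell u + 1 \<le> cell v" unfolding ij by linarith
  then show ?thesis using d by (intro mult_right_mono) auto
qed

lemma cell_mono: assumes "u \<le> v" shows "cell u \<le> cell v"
proof -
  have "\<lceil>u / d\<rceil> \<le> \<lceil>v / d\<rceil>" using assms d by (intro ceiling_mono divide_right_mono) auto
  then show ?thesis by (simp add: cell_def)
qed

lemma pl_interp_0: "pl_interp d f 0 = f 0"
  using d by (simp add: pl_interp_def)

text \<open>For points in different cells the increment is split at the nodes facing each other: two
  pieces of chords and one increment of \<open>f\<close> between nodes, each with constant
  \<open>L\<close>. Nodes next to a point of [-B, B] may overshoot by \<open>d\<close>, hence the
  larger interval for \<open>f\<close>.\<close>

lemma pl_interp_lipschitz:
  assumes lip: "\<And>a b. a \<in> {- B - d..B + d} \<Longrightarrow> b \<in> {- B - d..B + d} \<Longrightarrow> \<bar>f a - f b\<bar> \<le> L * \<bar>a - b\<bar>"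
    and ab: "a \<in> {-B..B}" "b \<in> {-B..B}"
  shows "\<bar>pl_interp d f a - pl_interp d f b\<bar> \<le> L * \<bar>a - b\<bar>"
proof -
  define s where "s u = (f ((cell u + 1) * d) - f (cell u * d)) / d" for u
  have rng: "cell u * d \<in> {- B - d..B + d}" "(cell u + 1) * d \<in> {- B - d..B + d}" if "u \<in> {-B..B}" for u
  proof -
    have "(cell u + 1) * d = cell u * d + d" by (simp add: algebra_simps)
    then show "cell u * d \<in> {- B - d..B + d}" "(cell u + 1) * d \<in> {- B - d..B + d}"
      using cell_bounds[of u] that d by auto
  qed
  have s: "\<bar>s u\<bar> \<le> L" if "u \<in> {-B..B}" for u
  proof -
    have "\<bar>f ((cell u + 1) * d) - f (cell u * d)\<bar> \<le> L * \<bar>(cell u + 1) * d - cell u * d\<bar>"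
      by (rule lip[OF rng(2)[OF that] rng(1)[OF that]])
    also have "(cell u + 1) * d - cell u * d = d" by (simp add: algebra_simps)
    finally show ?thesis using d by (simp add: s_def field_simps)
  qed
  have *: "\<bar>pl_interp d f v - pl_interp d f u\<bar> \<le> L * (v - u)" if uv: "u \<le> v" "u \<in> {-B..B}" "v \<in> {-B..B}" for u v
  proof (cases "cell u = cell v")
    case True
    have e: "pl_interp d f w = f (cell w * d) + (w - cell w * d) * s w" for w
      by (simp only: pl_interp_cell s_def)
    have "s u = s v" by (simp add: s_def True)
    then have "pl_interp d f v - pl_interp d f u = s u * (v - u)"
      unfolding e[of u] e[of v] True by (simp add: algebra_simps)
    moreover have "\<bar>s u * (v - u)\<bar> \<le> L * (v - u)" using s[OF uv(2)] uv(1) by (intro abs_mult_le) auto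
    ultimately show ?thesis by simp
  next
    case False
    then have lt: "(cell u + 1) * d \<le> cell v * d" using cell_mono[OF uv(1)] by (intro cell_less_imp) auto
    have 1: "pl_interp d f v = f (cell v * d) + s v * (v - cell v * d)"
      unfolding pl_interp_cell s_def by simp
    have 2: "pl_interp d f u = f ((cell u + 1) * d) - s u * ((cell u + 1) * d - u)"
      unfolding pl_interp_cell s_def using d by (simp add: field_simps)
    have "\<bar>s v * (v - cell v * d)\<bar> \<le> L * (v - cell v * d)"
      using s[OF uv(3)] cell_bounds(1)[of v] by (intro abs_mult_le) auto
    moreover have "\<bar>s u * ((cell u + 1) * d - u)\<bar> \<le> L * ((cell u + 1) * d - u)"
      using s[OF uv(2)] cell_bounds(2)[of u] by (intro abs_mult_le) auto
    moreover have "\<bar>f (cell v * d) - f ((cell u + 1) * d)\<bar> \<le> L * (cell v * d - (cell u + 1) * d)"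
      using lip[OF rng(1)[OF uv(3)] rng(2)[OF uv(2)]] lt by simp
    moreover have "L * (v - u) = L * (v - cell v * d) + L * ((cell u + 1) * d - u) + L * (cell v * d - (cell u + 1) * d)"
      by (simp add: algebra_simps)
    ultimately show ?thesis unfolding 1 2 by linarith
  qed
  show ?thesis
  proof (cases "a \<le> b")
    case True
    then show ?thesis using *[of a b] ab by (simp add: abs_minus_commute)
  next
    case False
    then show ?thesis using *[of b a] ab by simp
  qed
qed

lemma pl_interp_continuous:
  assumes "C2_fun f" shows "continuous_on UNIV (pl_interp d f)"
proof -
  have "isCont (pl_interp d f) x" for x
  proof -
    define B where "B = \<bar>x\<bar> + 1"
    obtain L where L: "0 < L" "\<And>a b. a \<in> {- B - d..B + d} \<Longrightarrow> b \<in> {- B - d..B + d} \<Longrightarrow> \<bar>f a - f b\<bar> \<le> L * \<bar>a - b\<bar>"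
      using C2_lipschitz[OF assms] by metis
    have "L-lipschitz_on {-B..B} (pl_interp d f)"
      unfolding lipschitz_on_def dist_real_def using pl_interp_lipschitz[OF L(2)] L(1) by auto
    then have "continuous_on {-B..B} (pl_interp d f)" by (rule lipschitz_on_continuous_on)
    moreover have "x \<in> interior {-B..B}" by (auto simp: B_def)
    ultimately show ?thesis by (rule continuous_on_interior)
  qed
  then show ?thesis by (simp add: continuous_on_eq_continuous_at)
qed

lemma pl_interp_ge:
  assumes "convex_on UNIV f" shows "f u \<le> pl_interp d f u"
proof -
  have c: "convex_on {cell u * d..(cell u + 1) * d} f" using assms by (rule convex_on_subset) auto
  have "f u \<le> (f ((cell u + 1) * d) - f (cell u * d)) / ((cell u + 1) * d - cell u * d) * (u - cell u * d) + f (cell u * d)"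
    by (rule convex_onD_Icc'[OF c]) (use cell_bounds[of u] in auto)
  also have "(cell u + 1) * d - cell u * d = d" by (simp add: algebra_simps)
  finally show ?thesis by (simp add: pl_interp_cell mult.commute)
qed

text \<open>By the mean value theorem the error is (u - l) (f'(\<xi>) - f'(\<eta>)) with l the left
  node. Estimating u - l by \<open>u\<close> instead of \<open>d\<close> gives a bound proportional
  to \<open>u\<close>; this uses l \<ge> 0, which holds for u > 0 because 0 is a node. The right
  node is at most M + d, whence the range of the maximum.\<close>

lemma pl_interp_le:
  assumes f: "C2_fun f" and u: "0 \<le> u" "u \<le> M"
  shows "pl_interp d f u \<le> f u + d * max_abs_deriv2 f (M + d) * u"
\<comment> \<open>The point 0 belongs to the cell (-d, 0], whose left node is negative, but there
  the interpolation is exact.\<close>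
proof (cases "u = 0")
  case False
  let ?l = "cell u * d" and ?r = "(cell u + 1) * d"
  have r: "?r = ?l + d" by (simp add: algebra_simps)
  have l0: "0 \<le> ?l"
  proof -
    have "0 < (cell u + 1) * d" using cell_bounds(2)[of u] u False by linarith
    then have "- 1 < cell u" using d by (simp add: zero_less_mult_iff)
    moreover obtain i :: int where "cell u = real_of_int i" using cell_int by metis
    ultimately have "0 \<le> cell u" by simp
    then show ?thesis using d by simp
  qed
  have lu: "?l < u" "u \<le> ?r" using cell_bounds by auto
  obtain \<xi> where \<xi>: "?l < \<xi>" "\<xi> < ?r" "f ?r - f ?l = (?r - ?l) * deriv f \<xi>"
    using MVT2[of ?l ?r f "deriv f"] C2_funD(1)[OF f] r d by auto
  obtain \<eta> where \<eta>: "?l < \<eta>" "\<eta> < u" "f u - f ?l = (u - ?l) * deriv f \<eta>"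
    using MVT2[of ?l u f "deriv f"] C2_funD(1)[OF f] lu by auto
  let ?m = "max_abs_deriv2 f (M + d)"
  have m0: "0 \<le> ?m" using max_abs_deriv2_nonneg[OF f] u d by simp
  have "\<bar>deriv f \<xi> - deriv f \<eta>\<bar> \<le> ?m * \<bar>\<xi> - \<eta>\<bar>"
    by (rule lipschitz_of_deriv_bound[OF C2_funD(2)[OF f], of 0 "M + d"])
      (use max_abs_deriv2_upper[OF f] \<xi> \<eta> l0 lu r u d in auto)
  also have "\<dots> \<le> ?m * d" using \<xi> \<eta> r lu m0 by (intro mult_left_mono) auto
  finally have D: "deriv f \<xi> - deriv f \<eta> \<le> d * ?m" by (simp add: mult.commute)
  have "pl_interp d f u - f u = (u - ?l) * (deriv f \<xi> - deriv f \<eta>)"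
    unfolding pl_interp_cell using \<xi>(3) \<eta>(3) d r by (simp add: algebra_simps)
  also have "\<dots> \<le> (u - ?l) * (d * ?m)" using D lu by (intro mult_left_mono) auto
  also have "\<dots> \<le> u * (d * ?m)" using l0 d m0 by (intro mult_right_mono) auto
  finally show ?thesis by (simp add: mult_ac)
qed (use pl_interp_0 in simp)

end

section \<open>Primitives with respect to Lebesgue measure\<close>

lemma integrable_lebesgue_indicator:
  fixes u :: "real \<Rightarrow> real"
  assumes "integrable lebesgue u" "A \<in> sets lebesgue"
  shows "integrable lebesgue (\<lambda>x. indicator A x *\<^sub>R u x)"
  using assms by (rule integrable_mult_indicator[rotated])

lemma measurable_lebesgue_indicator:
  fixes u :: "real \<Rightarrow> real"
  assumes "integrable lebesgue u" "A \<in> sets lebesgue"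
  shows "(\<lambda>x. indicator A x *\<^sub>R u x) \<in> borel_measurable lebesgue"
  by (intro borel_measurable_integrable integrable_lebesgue_indicator assms)

lemma primitive_limits:
  assumes u: "integrable lebesgue u"
  shows "((\<lambda>n. primitive u (- n)) \<longlongrightarrow> 0) at_top" "(primitive u \<longlongrightarrow> (LINT x|lebesgue. u x)) at_top"
proof -
  have [measurable]: "u \<in> borel_measurable lebesgue" using u by auto
  have m: "{..n} \<in> sets lebesgue" for n :: real by simp
  have "((\<lambda>n. LINT x|lebesgue. indicator {..- n} x *\<^sub>R u x) \<longlongrightarrow> integral\<^sup>L lebesgue (\<lambda>x::real. 0::real)) at_top"
  proof (rule integral_dominated_convergence_at_top[where w = "\<lambda>x. \<bar>u x\<bar>" and f = "\<lambda>x. 0"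
        and s = "\<lambda>n x. indicator {..- n} x *\<^sub>R u x"])
    show "AE x in lebesgue. ((\<lambda>n. indicator {..- n} x *\<^sub>R u x) \<longlongrightarrow> 0) at_top"
    proof (rule always_eventually, rule allI, rule tendsto_eventually)
      fix x show "\<forall>\<^sub>F n in at_top. indicator {..- n} x *\<^sub>R u x = 0"
        using eventually_gt_at_top[of "- x"] by eventually_elim auto
    qed
    show "\<forall>\<^sub>F n in at_top. AE x in lebesgue. norm (indicator {..- n} x *\<^sub>R u x) \<le> \<bar>u x\<bar>"
      by (intro always_eventually allI) (auto simp: indicator_def)
    show "(\<lambda>x. indicator {..- n} x *\<^sub>R u x) \<in> borel_measurable lebesgue" for n
      by (rule measurable_lebesgue_indicator[OF u m])
  qed (use u in auto)
  then show "((\<lambda>n. primitive u (- n)) \<longlongrightarrow> 0) at_top"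
    by (simp add: primitive_def set_lebesgue_integral_def)
  have "((\<lambda>n. LINT x|lebesgue. indicator {..n} x *\<^sub>R u x) \<longlongrightarrow> (LINT x|lebesgue. u x)) at_top"
  proof (rule integral_dominated_convergence_at_top[where w = "\<lambda>x. \<bar>u x\<bar>" and f = u
        and s = "\<lambda>n x. indicator {..n} x *\<^sub>R u x"])
    show "AE x in lebesgue. ((\<lambda>n. indicator {..n} x *\<^sub>R u x) \<longlongrightarrow> u x) at_top"
    proof (rule always_eventually, rule allI, rule tendsto_eventually)
      fix x show "\<forall>\<^sub>F n in at_top. indicator {..n} x *\<^sub>R u x = u x"
        using eventually_ge_at_top[of x] by eventually_elim auto
    qed
    show "\<forall>\<^sub>F n in at_top. AE x in lebesgue. norm (indicator {..n} x *\<^sub>R u x) \<le> \<bar>u x\<bar>"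
      by (intro always_eventually allI) (auto simp: indicator_def)
    show "(\<lambda>x. indicator {..n} x *\<^sub>R u x) \<in> borel_measurable lebesgue" for n
      by (rule measurable_lebesgue_indicator[OF u m])
  qed (use u in auto)
  then show "(primitive u \<longlongrightarrow> (LINT x|lebesgue. u x)) at_top"
    by (simp add: primitive_def[abs_def] set_lebesgue_integral_def)
qed

lemma primitive_diff:
  assumes u: "integrable lebesgue u" and "x \<le> y"
  shows "primitive u y - primitive u x = (LINT z:{x..y}|lebesgue. u z)"
proof -
  have [measurable]: "u \<in> borel_measurable lebesgue" using u by auto
  have "primitive u y - primitive u x = (LINT z|lebesgue. indicator {..y} z *\<^sub>R u z - indicator {..x} z *\<^sub>R u z)"
    unfolding primitive_def set_lebesgue_integral_def
    by (intro Bochner_Integration.integral_diff[symmetric] integrable_lebesgue_indicator u) auto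
  also have "\<dots> = (LINT z|lebesgue. indicator {x..y} z *\<^sub>R u z)"
  proof (rule integral_cong_AE)
    have "AE z in lebesgue. z \<noteq> x" by (intro AE_completion AE_lborel_singleton)
    then show "AE z in lebesgue. indicator {..y} z *\<^sub>R u z - indicator {..x} z *\<^sub>R u z = indicator {x..y} z *\<^sub>R u z"
      by eventually_elim (use \<open>x \<le> y\<close> in \<open>auto simp: indicator_def\<close>)
    show "(\<lambda>z. indicator {..y} z *\<^sub>R u z - indicator {..x} z *\<^sub>R u z) \<in> borel_measurable lebesgue"
      by (intro borel_measurable_diff measurable_lebesgue_indicator u) auto
    show "(\<lambda>z. indicator {x..y} z *\<^sub>R u z) \<in> borel_measurable lebesgue"
      by (intro measurable_lebesgue_indicator u) auto
  qed
  finally show ?thesis by (simp add: set_lebesgue_integral_def)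
qed

lemma primitive_mono:
  assumes u: "integrable lebesgue u" "AE x in lebesgue. 0 \<le> u x" and "x \<le> y"
  shows "primitive u x \<le> primitive u y"
proof -
  have "0 \<le> (LINT z:{x..y}|lebesgue. u z)"
    unfolding set_lebesgue_integral_def using u(2)
    by (intro integral_nonneg_AE) (auto elim!: eventually_mono simp: indicator_def)
  then show ?thesis using primitive_diff[OF u(1) assms(3)] by linarith
qed

section \<open>Cell averages and their primitives\<close>

context
  fixes h M :: real and u0 :: "real \<Rightarrow> real"
  assumes h: "0 < h" and u0: "integrable lebesgue u0" and range: "AE x in lebesgue. 0 \<le> u0 x \<and> u0 x \<le> M"
begin

text \<open>The right end point x_{i+1/2} of cell i.\<close>

definition node :: "int \<Rightarrow> real" where "node i = (real_of_int i + 1 / 2) * h"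

lemma node_diff: "node i - node (i - 1) = h"
  by (simp add: node_def algebra_simps)

lemma node_ex: obtains i where "x < node i" "node i \<le> x + h"
proof (rule that[of "\<lfloor>x / h + 1 / 2\<rfloor>"])
  have "x / h < real_of_int \<lfloor>x / h + 1 / 2\<rfloor> + 1 / 2" "real_of_int \<lfloor>x / h + 1 / 2\<rfloor> + 1 / 2 \<le> (x + h) / h"
    using h by (simp_all add: add_divide_distrib) linarith+
  then show "x < node \<lfloor>x / h + 1 / 2\<rfloor>" "node \<lfloor>x / h + 1 / 2\<rfloor> \<le> x + h"
    unfolding node_def using h by (simp_all only: pos_divide_less_eq pos_le_divide_eq)
qed

lemma cell_avg_node:
  assumes "node (i - 1) \<le> x" "x < node i"
  shows "cell_avg h u0 x = (1 / h) * (LINT y:{node (i - 1)..node i}|lebesgue. u0 y)"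
proof -
  have "\<lfloor>x / h + 1 / 2\<rfloor> = i"
    using assms h by (intro floor_unique) (auto simp: node_def field_simps)
  then show ?thesis by (simp add: cell_avg_def Let_def node_def algebra_simps)
qed

lemma cell_avg_range: "0 \<le> cell_avg h u0 x" "cell_avg h u0 x \<le> M"
proof -
  obtain i where i: "x < node i" "node i \<le> x + h" by (rule node_ex)
  then have e: "cell_avg h u0 x = (1 / h) * (LINT y:{node (i - 1)..node i}|lebesgue. u0 y)"
    using node_diff[of i] by (intro cell_avg_node) auto
  have "0 \<le> (LINT y:{node (i - 1)..node i}|lebesgue. u0 y)"
    unfolding set_lebesgue_integral_def using range
    by (intro integral_nonneg_AE) (auto elim!: eventually_mono simp: indicator_def)
  then show "0 \<le> cell_avg h u0 x" using e h by simp
  have "(LINT y:{node (i - 1)..node i}|lebesgue. u0 y) \<le> (LINT y|lebesgue. indicator {node (i - 1)..node i} y *\<^sub>R M)"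
    unfolding set_lebesgue_integral_def
  proof (rule integral_mono_AE)
    show "integrable lebesgue (\<lambda>y. indicator {node (i - 1)..node i} y *\<^sub>R u0 y)"
      by (intro integrable_lebesgue_indicator u0) auto
    show "integrable lebesgue (\<lambda>y. indicator {node (i - 1)..node i} y *\<^sub>R M)"
      by (simp add: integrable_completion)
    show "AE y in lebesgue. indicator {node (i - 1)..node i} y *\<^sub>R u0 y \<le> indicator {node (i - 1)..node i} y *\<^sub>R M"
      using range by eventually_elim (auto simp: indicator_def)
  qed
  also have "\<dots> = M * h" using node_diff[of i] h by (simp add: integral_completion)
  finally show "cell_avg h u0 x \<le> M" unfolding e using h by (simp add: pos_divide_le_eq)
qed

text \<open>Averaging preserves the integral over each cell, so the difference of the two primitives
  is the same at all nodes; along nodes tending to minus infinity it tends to 0.\<close>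

lemma primitive_cell_avg_node:
  assumes v0: "integrable lebesgue (cell_avg h u0)"
  shows "primitive (cell_avg h u0) (node i) = primitive u0 (node i)"
proof -
  define D where "D i = primitive (cell_avg h u0) (node i) - primitive u0 (node i)" for i
  have step: "D i = D (i - 1)" for i
  proof -
    have le: "node (i - 1) \<le> node i" using node_diff[of i] h by simp
    have "(LINT z:{node (i - 1)..node i}|lebesgue. cell_avg h u0 z) =
      (LINT z|lebesgue. indicator {node (i - 1)..node i} z *\<^sub>R ((1 / h) * (LINT y:{node (i - 1)..node i}|lebesgue. u0 y)))"
      unfolding set_lebesgue_integral_def[of lebesgue _ "cell_avg h u0"]
    proof (rule integral_cong_AE)
      \<comment> \<open>The right node already belongs to the next cell, so the constant value may
        fail there, on a null set.\<close>
      have "AE z in lebesgue. z \<noteq> node i" by (intro AE_completion AE_lborel_singleton)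
      then show "AE z in lebesgue. indicator {node (i - 1)..node i} z *\<^sub>R cell_avg h u0 z =
        indicator {node (i - 1)..node i} z *\<^sub>R ((1 / h) * (LINT y:{node (i - 1)..node i}|lebesgue. u0 y))"
        by eventually_elim (auto simp: indicator_def cell_avg_node[of i])
      show "(\<lambda>z. indicator {node (i - 1)..node i} z *\<^sub>R cell_avg h u0 z) \<in> borel_measurable lebesgue"
        by (rule measurable_lebesgue_indicator[OF v0]) simp
      show "(\<lambda>z. indicator {node (i - 1)..node i} z *\<^sub>R ((1 / h) * (LINT y:{node (i - 1)..node i}|lebesgue. u0 y)))
        \<in> borel_measurable lebesgue"
        by (intro measurable_completion) simp
    qed
    also have "\<dots> = (LINT y:{node (i - 1)..node i}|lebesgue. u0 y)"
      using node_diff[of i] le h by (simp add: integral_completion)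
    finally have "primitive (cell_avg h u0) (node i) - primitive (cell_avg h u0) (node (i - 1)) =
      primitive u0 (node i) - primitive u0 (node (i - 1))"
      using primitive_diff[OF v0 le] primitive_diff[OF u0 le] by simp
    then show ?thesis by (simp add: D_def)
  qed
  have const: "D (i - int n) = D i" for n
  proof (induction n)
    case (Suc n)
    have "i - int (Suc n) = (i - int n) - 1" by simp
    then show ?case using step[of "i - int n"] Suc by metis
  qed simp
  have lim: "filterlim (\<lambda>n. - node (i - int n)) at_top sequentially"
  proof -
    have "filterlim (\<lambda>n. - node i + h * real n) at_top sequentially"
      by (intro filterlim_tendsto_add_at_top[OF tendsto_const] filterlim_tendsto_pos_mult_at_top[OF tendsto_const h]
          filterlim_real_sequentially)
    moreover have "- node (i - int n) = - node i + h * real n" for n by (simp add: node_def algebra_simps)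
    ultimately show ?thesis by simp
  qed
  have "(\<lambda>n. primitive (cell_avg h u0) (- (- node (i - int n))) - primitive u0 (- (- node (i - int n)))) \<longlonglongrightarrow> 0 - 0"
    by (intro tendsto_diff filterlim_compose[OF primitive_limits(1)[OF v0] lim] filterlim_compose[OF primitive_limits(1)[OF u0] lim])
  then have "(\<lambda>n. D (i - int n)) \<longlonglongrightarrow> 0" by (simp add: D_def)
  then have "D i = 0" unfolding const by (simp add: LIMSEQ_const_iff)
  then show ?thesis by (simp add: D_def)
qed

text \<open>Some node lies in (x, x + h]; both primitives agree there and are monotone, so each
  comparison passes through that node.\<close>

lemma primitive_cell_avg_shift:
  assumes v0: "integrable lebesgue (cell_avg h u0)"
  shows "primitive (cell_avg h u0) x \<le> primitive u0 (x + h)" "primitive u0 x \<le> primitive (cell_avg h u0) (x + h)"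
proof -
  obtain i where i: "x < node i" "node i \<le> x + h" by (rule node_ex)
  have nn: "AE x in lebesgue. 0 \<le> u0 x" "AE x in lebesgue. 0 \<le> cell_avg h u0 x"
    using range cell_avg_range by (auto elim: eventually_mono)
  note m = primitive_mono[OF u0 nn(1)] primitive_mono[OF v0 nn(2)] primitive_cell_avg_node[OF v0, of i]
  show "primitive (cell_avg h u0) x \<le> primitive u0 (x + h)"
    using m(2)[of x "node i"] m(1)[of "node i" "x + h"] m(3) i by linarith
  show "primitive u0 x \<le> primitive (cell_avg h u0) (x + h)"
    using m(1)[of x "node i"] m(2)[of "node i" "x + h"] m(3) i by linarith
qed

end

section \<open>From shifted primitives to quantile functions\<close>

lemma pseudo_inv_le:
  assumes le: "\<And>x. U x \<le> V (x + c)" and U: "mono U" and lim: "(U \<longlongrightarrow> 1) at_top"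
    and V: "\<And>x. V x \<le> U (x + c')" and lim0: "((\<lambda>n. U (- n)) \<longlongrightarrow> 0) at_top" and \<xi>: "0 < \<xi>" "\<xi> < 1"
  shows "pseudo_inv V \<xi> \<le> pseudo_inv U \<xi> + (c :: real)"
proof -
  \<comment> \<open>A real infimum is meaningful only for nonempty sets bounded below:
    \<open>lim0\<close> and the reverse inequality \<open>V\<close> bound both superlevel sets, and
    \<open>lim\<close> provides a point of the first.\<close>
  obtain a where a: "U (- a) < \<xi>" using order_tendstoD(2)[OF lim0 \<xi>(1)] by (auto simp: eventually_at_top_linorder)
  have bU: "- a \<le> x" if "U x > \<xi>" for x
    using a that monoD[OF U, of x "- a"] by (cases "x \<le> - a") auto
  have bV: "- a - c' \<le> x" if "V x > \<xi>" for x
    using bU[of "x + c'"] V[of x] that by auto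
  have ne: "{x. U x > \<xi>} \<noteq> {}"
  proof -
    obtain b where "U b > \<xi>" using order_tendstoD(1)[OF lim \<xi>(2)] by (auto simp: eventually_at_top_linorder)
    then show ?thesis by auto
  qed
  have "pseudo_inv V \<xi> - c \<le> Inf {x. U x > \<xi>}"
  proof (rule cInf_greatest[OF ne])
    fix x assume "x \<in> {x. U x > \<xi>}"
    then have "V (x + c) > \<xi>" using le[of x] by auto
    then have "pseudo_inv V \<xi> \<le> x + c"
      unfolding pseudo_inv_def using bV by (intro cInf_lower) (auto simp: bdd_below_def)
    then show "pseudo_inv V \<xi> - c \<le> x" by simp
  qed
  then show ?thesis by (simp add: pseudo_inv_def)
qed

text \<open>The quantile function is monotone on the open interval. At 0 the set may be unbounded
  below and at 1 it may be empty, so these two values are added separately as multiples of point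
  indicators.\<close>

lemma pseudo_inv_measurable:
  assumes U: "mono U" and lim: "(U \<longlongrightarrow> 1) at_top" and lim0: "((\<lambda>n. U (- n)) \<longlongrightarrow> 0) at_top"
  shows "pseudo_inv U \<in> borel_measurable (lebesgue_on {0..1})"
proof -
  have "mono_on {0<..<1} (pseudo_inv U)"
  proof (rule mono_onI)
    fix \<xi> \<eta> :: real assume \<xi>: "\<xi> \<in> {0<..<1}" "\<eta> \<in> {0<..<1}" "\<xi> \<le> \<eta>"
    obtain a where a: "U (- a) < \<xi>" using order_tendstoD(2)[OF lim0, of \<xi>] \<xi> by (auto simp: eventually_at_top_linorder)
    have bU: "- a \<le> x" if "U x > \<xi>" for x
      using a that monoD[OF U, of x "- a"] by (cases "x \<le> - a") auto
    obtain b where "U b > \<eta>" using order_tendstoD(1)[OF lim, of \<eta>] \<xi> by (auto simp: eventually_at_top_linorder)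
    then show "pseudo_inv U \<xi> \<le> pseudo_inv U \<eta>"
      unfolding pseudo_inv_def using \<xi> bU by (intro cInf_superset_mono) (auto simp: bdd_below_def)
  qed
  then have "pseudo_inv U \<in> borel_measurable (restrict_space borel {0<..<1})"
    by (rule borel_measurable_mono_on_fnc)
  then have m: "(\<lambda>\<xi>. indicator {0<..<1} \<xi> *\<^sub>R pseudo_inv U \<xi>) \<in> borel_measurable borel"
    by (subst (asm) borel_measurable_restrict_space_iff) auto
  have "(\<lambda>\<xi>. indicator {0<..<1} \<xi> *\<^sub>R pseudo_inv U \<xi> + indicator {0} \<xi> * pseudo_inv U 0 + indicator {1} \<xi> * pseudo_inv U 1)
    \<in> borel_measurable lborel" using m by simp
  then have "(\<lambda>\<xi>. indicator {0<..<1} \<xi> *\<^sub>R pseudo_inv U \<xi> + indicator {0} \<xi> * pseudo_inv U 0 + indicator {1} \<xi> * pseudo_inv U 1)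
    \<in> borel_measurable (lebesgue_on {0..1})"
    by (intro measurable_restrict_space1 measurable_completion)
  then show ?thesis
    by (rule measurable_cong[THEN iffD1, rotated]) (auto simp: space_restrict_space indicator_def)
qed

lemma W_infty_le:
  assumes u: "integrable lebesgue u" "AE x in lebesgue. 0 \<le> u x" "(LINT x|lebesgue. u x) = 1"
    and v: "integrable lebesgue v" "AE x in lebesgue. 0 \<le> v x"
    and uv: "\<And>x. primitive u x \<le> primitive v (x + c)" and vu: "\<And>x. primitive v x \<le> primitive u (x + c)"
  shows "W_infty u v \<le> ereal c"
proof -
  have mu: "mono (primitive u)" and mv: "mono (primitive v)"
    using primitive_mono[OF u(1,2)] primitive_mono[OF v] by (auto intro: monoI)
  have l1: "(primitive u \<longlongrightarrow> 1) at_top" using primitive_limits(2)[OF u(1)] u(3) by simp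
  \<comment> \<open>The total mass 1 is inherited by \<open>v\<close>, since
    \<open>primitive v\<close> is squeezed between two translates of
    \<open>primitive u\<close>.\<close>
  have l2: "(primitive v \<longlongrightarrow> 1) at_top"
  proof (rule tendsto_sandwich)
    have s: "filterlim (\<lambda>x. x + d) at_top at_top" for d :: real
      using filterlim_tendsto_add_at_top[OF tendsto_const[of d] filterlim_ident] by (simp add: add.commute)
    show "((\<lambda>x. primitive u (x + (- c))) \<longlongrightarrow> 1) at_top" "((\<lambda>x. primitive u (x + c)) \<longlongrightarrow> 1) at_top"
      by (rule filterlim_compose[OF l1 s])+
    show "\<forall>\<^sub>F x in at_top. primitive u (x + (- c)) \<le> primitive v x"
      using uv[of "_ - c"] by (intro always_eventually) auto
    show "\<forall>\<^sub>F x in at_top. primitive v x \<le> primitive u (x + c)" using vu by (intro always_eventually) auto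
  qed
  note l0 = primitive_limits(1)[OF u(1)] primitive_limits(1)[OF v(1)]
  let ?g = "\<lambda>\<xi>. pseudo_inv (primitive u) \<xi> - pseudo_inv (primitive v) \<xi>"
  have gm: "?g \<in> borel_measurable (lebesgue_on {0..1})"
    by (intro borel_measurable_diff pseudo_inv_measurable mu mv l1 l2 l0)
  have bd: "\<bar>?g \<xi>\<bar> \<le> c" if "0 < \<xi>" "\<xi> < 1" for \<xi>
    using pseudo_inv_le[OF uv mu l1 vu l0(1) that] pseudo_inv_le[OF vu mv l2 uv l0(2) that] by auto
  have "AE \<xi> in lebesgue_on {0..1}. \<xi> \<noteq> (0::real) \<and> \<xi> \<noteq> 1"
  proof -
    have "AE \<xi> in lebesgue. \<xi> \<noteq> (0::real)" "AE \<xi> in lebesgue. \<xi> \<noteq> (1::real)"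
      by (intro AE_completion AE_lborel_singleton)+
    then have "AE \<xi> in lebesgue. \<xi> \<in> {0..1} \<longrightarrow> \<xi> \<noteq> (0::real) \<and> \<xi> \<noteq> 1" by eventually_elim auto
    then show ?thesis by (subst AE_restrict_space_iff) auto
  qed
  then have "AE \<xi> in lebesgue_on {0..1}. ereal \<bar>?g \<xi>\<bar> \<le> ereal c"
    using AE_space[of "lebesgue_on {0..1::real}"]
    by eventually_elim (use bd in \<open>auto simp: space_restrict_space\<close>)
  then show ?thesis
    unfolding W_infty_def Linf_norm_def using gm by (intro esssup_I) auto
qed

lemma (in L1_curve) U_eq_primitive:
  assumes eq: "AE x in lebesgue. u t x = v x" and v: "integrable lebesgue v"
  shows "U t x = primitive v x"
proof -
  have "U t x = (LINT z|lebesgue. indicator {..x} z * u t z)"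
    unfolding U_def by (rule integral_completion[symmetric]) simp
  also have "\<dots> = (LINT z|lebesgue. indicator {..x} z *\<^sub>R v z)"
  proof (rule integral_cong_AE)
    show "(\<lambda>z. indicator {..x} z * u t z) \<in> borel_measurable lebesgue"
      by (rule measurable_completion) simp
    show "(\<lambda>z. indicator {..x} z *\<^sub>R v z) \<in> borel_measurable lebesgue"
      by (rule measurable_lebesgue_indicator[OF v]) simp
    show "AE z in lebesgue. indicator {..x} z * u t z = indicator {..x} z *\<^sub>R v z"
      using eq by eventually_elim simp
  qed
  finally show ?thesis by (simp add: primitive_def set_lebesgue_integral_def)
qed

section \<open>The Wasserstein estimate for fixed mesh sizes\<close>

lemma front_tracking_W_infty:
  assumes u0: "u0 \<in> class_B" and u0_range: "AE x in lebesgue. 0 \<le> u0 x \<and> u0 x \<le> M"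
    and f: "C2_fun f" "convex_on UNIV f" "f 0 = 0"
    and h: "0 < h" and d: "0 < d"
    and u: "entropy_solution f u0 u" and v: "entropy_solution (pl_interp d f) (cell_avg h u0) v"
    and t: "0 \<le> t"
  shows "W_infty (u t) (v t) \<le> ereal (h + d * max_abs_deriv2 f (M + d) * t)"
proof -
  let ?g = "pl_interp d f" and ?v0 = "cell_avg h u0"
  define c where "c = d * max_abs_deriv2 f (M + d)"
  have u0i: "integrable lebesgue u0" and u01: "(LINT x|lebesgue. u0 x) = 1"
    using u0 not_integrable_integral_eq[of lebesgue u0] by (auto simp: class_B_def)
  have ui: "integrable lebesgue (u s)" and vi: "integrable lebesgue (v s)" if "0 \<le> s" for s
    using u v that by (auto simp: entropy_solution_def)
  have u_init: "AE x in lebesgue. u 0 x = u0 x" and v_init: "AE x in lebesgue. v 0 x = ?v0 x"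
    using u v by (auto simp: entropy_solution_def)
  note v0_range = cell_avg_range[OF h u0i u0_range]
  have M: "0 \<le> M" using v0_range[of 0] by linarith
  have c0: "0 \<le> c" unfolding c_def using d M f(1) by (intro mult_nonneg_nonneg max_abs_deriv2_nonneg) auto
  \<comment> \<open>Measurability and integrability of the cell averages are inherited from
    \<open>v 0\<close>, which equals them almost everywhere.\<close>
  have v0i: "integrable lebesgue ?v0"
  proof -
    have v0m: "?v0 \<in> borel_measurable lebesgue"
      using borel_measurable_AE[OF borel_measurable_integrable[OF vi[of 0]] v_init] by simp
    show ?thesis
      using integrable_cong_AE[OF _ v0m v_init] vi[of 0] by (auto dest: borel_measurable_integrable)
  qed
  have f_cont: "continuous_on UNIV f"
    using C2_funD(1)[OF f(1)] by (meson DERIV_isCont continuous_at_imp_continuous_on)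
  obtain Bu where Bu: "0 < Bu" "\<And>B L. Bu \<le> B \<Longrightarrow> 0 < L \<Longrightarrow>
    (\<And>a b. a \<in> {-B..B} \<Longrightarrow> b \<in> {-B..B} \<Longrightarrow> \<bar>f a - f b\<bar> \<le> L * \<bar>a - b\<bar>) \<Longrightarrow>
    \<exists>w. entropy_curve w B f L \<and> (\<forall>t\<ge>0. AE x in lebesgue. w t x = u t x)"
    using entropy_solution_curve[OF u f_cont f(3)] by blast
  have g0: "?g 0 = 0" using pl_interp_0[OF d] f(3) by simp
  obtain Bv where Bv: "0 < Bv" "\<And>B L. Bv \<le> B \<Longrightarrow> 0 < L \<Longrightarrow>
    (\<And>a b. a \<in> {-B..B} \<Longrightarrow> b \<in> {-B..B} \<Longrightarrow> \<bar>?g a - ?g b\<bar> \<le> L * \<bar>a - b\<bar>) \<Longrightarrow>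
    \<exists>w. entropy_curve w B ?g L \<and> (\<forall>t\<ge>0. AE x in lebesgue. w t x = v t x)"
    using entropy_solution_curve[OF v pl_interp_continuous[OF d f(1)] g0] by blast
  \<comment> \<open>The comparison needs one range \<open>B\<close> and one speed \<open>L\<close>
    for both curves. \<open>L\<close> is taken on [-B - d, B + d], so that it is also a Lipschitz
    constant of the interpolated flux on [-B, B].\<close>
  define B where "B = max M (max Bu Bv)"
  have B: "Bu \<le> B" "Bv \<le> B" "M \<le> B" by (auto simp: B_def)
  obtain L where L: "0 < L" "\<And>a b. a \<in> {- B - d..B + d} \<Longrightarrow> b \<in> {- B - d..B + d} \<Longrightarrow> \<bar>f a - f b\<bar> \<le> L * \<bar>a - b\<bar>"
    using C2_lipschitz[OF f(1)] by metis
  obtain wu where wu: "entropy_curve wu B f L" "\<And>s. 0 \<le> s \<Longrightarrow> AE x in lebesgue. wu s x = u s x"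
    using Bu(2)[OF B(1) L(1)] L(2) d by force
  obtain wv where wv: "entropy_curve wv B ?g L" "\<And>s. 0 \<le> s \<Longrightarrow> AE x in lebesgue. wv s x = v s x"
    using Bv(2)[OF B(2) L(1)] pl_interp_lipschitz[OF d L(2)] by blast
  interpret wu: entropy_curve wu B f L by (rule wu(1))
  interpret wv: entropy_curve wv B ?g L by (rule wv(1))
  have wu_range: "AE x in lborel. 0 \<le> wu s x \<and> wu s x \<le> M" if "0 \<le> s" for s
  proof (rule wu.max_principle[OF _ M B(3) that])
    have "AE x in lebesgue. 0 \<le> wu 0 x \<and> wu 0 x \<le> M"
      using wu(2)[of 0, simplified] u_init u0_range by eventually_elim simp
    then show "AE x in lborel. 0 \<le> wu 0 x \<and> wu 0 x \<le> M" by (simp only: AE_completion_iff)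
  qed
  have wv_range: "AE x in lborel. 0 \<le> wv s x \<and> wv s x \<le> M" if "0 \<le> s" for s
  proof (rule wv.max_principle[OF _ M B(3) that])
    have "AE x in lebesgue. 0 \<le> wv 0 x \<and> wv 0 x \<le> M"
      using wv(2)[of 0, simplified] v_init by eventually_elim (simp add: v0_range)
    then show "AE x in lborel. 0 \<le> wv 0 x \<and> wv 0 x \<le> M" by (simp only: AE_completion_iff)
  qed
  have Uu: "wu.U s x = primitive (u s) x" and Uv: "wv.U s x = primitive (v s) x" if "0 \<le> s" for s x
    by (rule wu.U_eq_primitive[OF wu(2)[OF that] ui[OF that]], rule wv.U_eq_primitive[OF wv(2)[OF that] vi[OF that]])
  have wu0: "AE x in lebesgue. wu 0 x = u0 x" using wu(2)[of 0, simplified] u_init by eventually_elim simp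
  have wv0: "AE x in lebesgue. wv 0 x = ?v0 x" using wv(2)[of 0, simplified] v_init by eventually_elim simp
  have U0: "wu.U 0 x = primitive u0 x" "wv.U 0 x = primitive ?v0 x" for x
    by (rule wu.U_eq_primitive[OF wu0 u0i], rule wv.U_eq_primitive[OF wv0 v0i])
  note shift = primitive_cell_avg_shift[OF h u0i u0_range v0i]
  have tangent: "f z + deriv f z * (y - z) \<le> f y" for y z
    using convex_on_imp_above_tangent[OF f(2), of z y "deriv f z"] C2_funD(1)[OF f(1), of z]
    by (simp add: algebra_simps)
  \<comment> \<open>The tangents of \<open>f\<close> lie below \<open>f\<close>, and the flux of the
    second curve exceeds \<open>f\<close> by at most c z: the drift is \<open>c\<close>.\<close>
  have uv: "wu.U t x \<le> wv.U t (x + h + c * t)" for x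
  proof (rule primitive_comparison[OF wu(1) wv(1) M B(3) wu_range _ _ c0 _ t])
    show "\<exists>q. \<forall>y\<in>{0..M}. f z + q * (y - z) \<le> f y" for z using tangent by blast
    show "?g z \<le> f z + c * z" if "z \<in> {0..M}" for z
      unfolding c_def using that by (intro pl_interp_le[OF d f(1)]) auto
    show "wu.U 0 x \<le> wv.U 0 (x + h)" for x unfolding U0 by (rule shift(2))
  qed
  \<comment> \<open>With the roles exchanged, the tangents of \<open>f\<close> lie below the
    interpolated flux because \<open>f \<le> ?g\<close>, and the second curve evolves with
    \<open>f\<close> itself, so no drift arises.\<close>
  have vu: "wv.U t x \<le> wu.U t (x + h + 0 * t)" for x
  proof (rule primitive_comparison[OF wv(1) wu(1) M B(3) wv_range _ _ _ _ t])
    show "\<exists>q. \<forall>y\<in>{0..M}. f z + q * (y - z) \<le> ?g y" for z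
      using tangent pl_interp_ge[OF d f(2)] by (meson order_trans)
    show "wv.U 0 x \<le> wu.U 0 (x + h)" for x unfolding U0 by (rule shift(1))
  qed auto
  have u_nonneg: "AE x in lebesgue. 0 \<le> u t x"
    using AE_completion[OF wu_range[OF t]] wu(2)[OF t] by eventually_elim auto
  have v_nonneg: "AE x in lebesgue. 0 \<le> v t x"
    using AE_completion[OF wv_range[OF t]] wv(2)[OF t] by eventually_elim auto
  have mass: "(LINT x|lebesgue. u t x) = 1"
  proof -
    have eq: "(LINT x|lebesgue. w x) = (LBINT x. w' x)"
      if "integrable lebesgue w" "w' \<in> borel_measurable borel" "AE x in lebesgue. w' x = w x" for w w' :: "real \<Rightarrow> real"
    proof -
      have "(LINT x|lebesgue. w x) = (LINT x|lebesgue. w' x)"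
        using that by (intro integral_cong_AE) (auto intro: measurable_completion elim: eventually_mono)
      then show ?thesis using that(2) by (simp add: integral_completion)
    qed
    show ?thesis
      using eq[OF ui[OF t] wu.meas wu(2)[OF t]] eq[OF u0i wu.meas wu0] wu.mass_conservation[OF t] u01 by simp
  qed
  have ct: "0 \<le> c * t" using c0 t by simp
  have "W_infty (u t) (v t) \<le> ereal (h + c * t)"
  proof (rule W_infty_le[OF ui[OF t] u_nonneg mass vi[OF t] v_nonneg])
    show "primitive (u t) x \<le> primitive (v t) (x + (h + c * t))" for x
      using uv[of x] by (simp add: Uu[OF t] Uv[OF t] add.assoc)
    show "primitive (v t) x \<le> primitive (u t) (x + (h + c * t))" for x
    proof -
      have "primitive (v t) x \<le> primitive (u t) (x + h)" using vu[of x] by (simp add: Uu[OF t] Uv[OF t])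
      also have "\<dots> \<le> primitive (u t) (x + (h + c * t))"
        by (rule primitive_mono[OF ui[OF t] u_nonneg]) (use ct in simp)
      finally show ?thesis .
    qed
  qed
  then show ?thesis by (simp add: c_def)
qed

lemma class_B_range:
  assumes "u0 \<in> class_B" "M = real_of_ereal (Linf_norm lebesgue u0)"
  shows "AE x in lebesgue. 0 \<le> u0 x \<and> u0 x \<le> M"
proof -
  have fin: "Linf_norm lebesgue u0 < \<infinity>" and pos: "AE x in lebesgue. 0 \<le> u0 x"
    using assms(1) by (auto simp: class_B_def in_Linf_def)
  have "AE x in lebesgue. ereal \<bar>u0 x\<bar> \<le> Linf_norm lebesgue u0"
    unfolding Linf_norm_def by (rule esssup_AE)
  with pos show ?thesis
  proof eventually_elim
    case (elim x)
    then show ?case using fin assms(2) by (cases "Linf_norm lebesgue u0") auto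
  qed
qed

text \<open>Under \<delta> \<le> C h the drift contributes at most C t max|f''| h. The constant L(t)
  in its stated form is thus the case C = 1, a general \<delta> = O(h) brings in the factor C, and
  the last clause is the rate itself, with a constant independent of h.\<close>

theorem theorem4p6:
  fixes u0 f :: "real \<Rightarrow> real" and M :: real
    and \<delta> :: "real \<Rightarrow> real"
    and u :: "real \<Rightarrow> real \<Rightarrow> real"
    and v :: "real \<Rightarrow> real \<Rightarrow> real \<Rightarrow> real"
  assumes u0: "u0 \<in> class_B \<inter> class_BV"
    and M: "M = real_of_ereal (Linf_norm lebesgue u0)"
    and f: "C2_fun f" "convex_on UNIV f" "f 0 = 0" "\<And>p. f 0 \<le> f p"
    and \<delta>_pos: "\<And>h. h > 0 \<Longrightarrow> \<delta> h > 0"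
    and \<delta>_bigo: "\<delta> \<in> O[at_right 0](\<lambda>h. h)"
    and u: "entropy_solution f u0 u"
    and v: "\<And>h. h > 0 \<Longrightarrow> entropy_solution (pl_interp (\<delta> h) f) (cell_avg h u0) (v h)"
  shows "\<forall>t\<ge>0.
      (\<forall>h>0. \<delta> h \<le> h \<longrightarrow>
         W_infty (u t) (v h t) \<le> ereal ((1 + t * max_abs_deriv2 f (M + \<delta> h)) * h)) \<and>
      (\<forall>C. \<forall>h>0. \<delta> h \<le> C * h \<longrightarrow>
         W_infty (u t) (v h t) \<le> ereal ((1 + C * t * max_abs_deriv2 f (M + \<delta> h)) * h)) \<and>
      (\<exists>K. \<forall>\<^sub>F h in at_right 0. W_infty (u t) (v h t) \<le> ereal (K * h))"
proof (intro allI impI)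
  fix t :: real assume t: "0 \<le> t"
  have u0B: "u0 \<in> class_B" using u0 by simp
  note range = class_B_range[OF u0B M]
  have M0: "0 \<le> M"
  proof -
    obtain x where "0 \<le> u0 x \<and> u0 x \<le> M"
      using AE_interval_ex[of "\<lambda>x. 0 \<le> u0 x \<and> u0 x \<le> M" 0 1] range by (auto simp: AE_completion_iff)
    then show ?thesis by linarith
  qed
  have main: "W_infty (u t) (v h t) \<le> ereal ((1 + C * t * max_abs_deriv2 f (M + \<delta> h)) * h)"
    if h: "0 < h" "\<delta> h \<le> C * h" for C h
  proof -
    let ?m = "max_abs_deriv2 f (M + \<delta> h)"
    have m: "0 \<le> ?m" using \<delta>_pos[OF h(1)] M0 by (intro max_abs_deriv2_nonneg[OF f(1)]) simp
    have "W_infty (u t) (v h t) \<le> ereal (h + \<delta> h * ?m * t)"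
      by (rule front_tracking_W_infty[OF u0B range f(1-3) h(1) \<delta>_pos[OF h(1)] u v[OF h(1)] t])
    also have "\<delta> h * (?m * t) \<le> (C * h) * (?m * t)" using h(2) m t by (intro mult_right_mono) auto
    then have "ereal (h + \<delta> h * ?m * t) \<le> ereal ((1 + C * t * ?m) * h)" by (simp add: algebra_simps)
    finally show ?thesis .
  qed
  obtain C where C: "0 < C" "\<forall>\<^sub>F h in at_right 0. norm (\<delta> h) \<le> C * norm h"
    using \<delta>_bigo by (rule landau_o.bigE)
  have "\<forall>\<^sub>F h in at_right 0. W_infty (u t) (v h t) \<le> ereal ((1 + C * t * max_abs_deriv2 f (M + C)) * h)"
    using C(2) eventually_at_right_real[OF zero_less_one]
  proof eventually_elim
    case (elim h)
    then have h: "0 < h" "h < 1" "\<delta> h \<le> C * h" by auto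
    \<comment> \<open>For h < 1 the interval [0, M + \<delta> h] is contained in the fixed interval
      [0, M + C], which frees the constant from h.\<close>
    have "C * h \<le> C * 1" using h C(1) by (intro mult_left_mono) auto
    then have "max_abs_deriv2 f (M + \<delta> h) \<le> max_abs_deriv2 f (M + C)"
      using h M0 \<delta>_pos[OF h(1)] by (intro max_abs_deriv2_mono[OF f(1)]) auto
    then have "(1 + C * t * max_abs_deriv2 f (M + \<delta> h)) * h \<le> (1 + C * t * max_abs_deriv2 f (M + C)) * h"
      using C(1) t h by (intro mult_right_mono add_left_mono mult_left_mono) auto
    then show ?case using main[OF h(1,3)] by (meson ereal_less_eq(3) order_trans)
  qed
  then show "(\<forall>h>0. \<delta> h \<le> h \<longrightarrow>
         W_infty (u t) (v h t) \<le> ereal ((1 + t * max_abs_deriv2 f (M + \<delta> h)) * h)) \<and>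
      (\<forall>C. \<forall>h>0. \<delta> h \<le> C * h \<longrightarrow>
         W_infty (u t) (v h t) \<le> ereal ((1 + C * t * max_abs_deriv2 f (M + \<delta> h)) * h)) \<and>
      (\<exists>K. \<forall>\<^sub>F h in at_right 0. W_infty (u t) (v h t) \<le> ereal (K * h))"
    using main main[where C = 1] by auto
qed

end
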